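(* Let $(G,g)$ be a connected cyclic metric Lie group. Then $(G,g)$ is flat (that is, its Riemannian sectional curvature vanishes identically) if and only if $G$ is abelian.
   Context: A metric Lie group $(G,g)$ is a real Lie group $G$ with a left-invariant Riemannian metric $g$; $\mathfrak{g}$ is its Lie algebra and $\langle\cdot,\cdot\rangle$ is the inner product on $\mathfrak{g}$ induced by $g$. $(G,g)$ is called cyclic if $\langle [X,Y],Z\rangle+\langle [Y,Z],X\rangle+\langle [Z,X],Y\rangle=0$ for all $X,Y,Z\in\mathfrak{g}$. *)

theory Defs
  imports "HOL-Analysis.Analysis" "HOL-Algebra.Group"
begin

section \<open>Smooth maps between subsets of Euclidean spaces\<close>

primrec Ck_on :: "nat \<Rightarrow> ('a::euclidean_space \<Rightarrow> 'b::euclidean_space) \<Rightarrow> 'a set \<Rightarrow> bool" where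
  "Ck_on 0 F S \<longleftrightarrow> continuous_on S F"
| "Ck_on (Suc k) F S \<longleftrightarrow>
     (\<forall>x\<in>S. F differentiable (at x)) \<and> (\<forall>v. Ck_on k (\<lambda>x. frechet_derivative F (at x) v) S)"

text \<open>As usual, a map on an arbitrary subset of a Euclidean space is smooth if locally it extends to
  a smooth map on an open set of the ambient space.\<close>

definition smooth_on :: "'a::euclidean_space set \<Rightarrow> ('a \<Rightarrow> 'b::euclidean_space) \<Rightarrow> bool" where
  "smooth_on A f \<longleftrightarrow>
     (\<forall>x\<in>A. \<exists>U F. open U \<and> x \<in> U \<and> (\<forall>k. Ck_on k F U) \<and> (\<forall>y\<in>A \<inter> U. F y = f y))"


section \<open>Smooth manifolds\<close>

text \<open>Charts take values in a linear subspace (the model space) of the Euclidean space \<open>'e\<close>.  This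
  admits every dimension, including 0, which no type of class \<open>euclidean_space\<close> has.  A chart is a
  pair of its domain and a coordinate map, whose values off the domain are irrelevant.\<close>

record ('a, 'e) manifold_data =
  mtop :: "'a topology"
  model :: "'e set"
  charts :: "('a set \<times> ('a \<Rightarrow> 'e)) set"

definition smooth_manifold :: "('a, 'e::euclidean_space) manifold_data \<Rightarrow> bool" where
  "smooth_manifold M \<longleftrightarrow>
     Hausdorff_space (mtop M) \<and> second_countable (mtop M) \<and> subspace (model M) \<and>
     (\<forall>(U, \<phi>)\<in>charts M.
        openin (mtop M) U \<and> openin (top_of_set (model M)) (\<phi> ` U) \<and>
        homeomorphic_map (subtopology (mtop M) U) (top_of_set (\<phi> ` U)) \<phi>) \<and>
     (\<Union>(U, \<phi>)\<in>charts M. U) = topspace (mtop M) \<and>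
     (\<forall>(U, \<phi>)\<in>charts M. \<forall>(W, \<psi>)\<in>charts M. smooth_on (\<phi> ` (U \<inter> W)) (\<psi> \<circ> inv_into U \<phi>))"

definition smooth_map ::
  "('a, 'e::euclidean_space) manifold_data \<Rightarrow> ('b, 'd::euclidean_space) manifold_data \<Rightarrow> ('a \<Rightarrow> 'b) \<Rightarrow> bool"
where
  "smooth_map M N F \<longleftrightarrow>
     continuous_map (mtop M) (mtop N) F \<and>
     (\<forall>(U, \<phi>)\<in>charts M. \<forall>(W, \<psi>)\<in>charts N.
        smooth_on (\<phi> ` (U \<inter> F -` W)) (\<psi> \<circ> F \<circ> inv_into U \<phi>))"

definition real_line :: "(real, real) manifold_data" where
  "real_line = \<lparr>mtop = euclideanreal, model = UNIV, charts = {(UNIV, \<lambda>x. x)}\<rparr>"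

definition open_submanifold ::
  "('a, 'e) manifold_data \<Rightarrow> 'a set \<Rightarrow> ('a, 'e) manifold_data" where
  "open_submanifold M W =
     \<lparr>mtop = subtopology (mtop M) W, model = model M, charts = {(U \<inter> W, \<phi>) | U \<phi>. (U, \<phi>) \<in> charts M}\<rparr>"

definition product_manifold ::
  "('a, 'e) manifold_data \<Rightarrow> ('b, 'd) manifold_data \<Rightarrow> ('a \<times> 'b, 'e \<times> 'd) manifold_data" where
  "product_manifold M N =
     \<lparr>mtop = prod_topology (mtop M) (mtop N),
      model = model M \<times> model N,
      charts = {(U \<times> W, map_prod \<phi> \<psi>) | U \<phi> W \<psi>. (U, \<phi>) \<in> charts M \<and> (W, \<psi>) \<in> charts N}\<rparr>"

definition smooth_fun_on :: "('a, 'e::euclidean_space) manifold_data \<Rightarrow> 'a set \<Rightarrow> ('a \<Rightarrow> real) \<Rightarrow> bool" where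
  "smooth_fun_on M W f \<longleftrightarrow> openin (mtop M) W \<and> smooth_map (open_submanifold M W) real_line f"

definition smooth_near :: "('a, 'e::euclidean_space) manifold_data \<Rightarrow> 'a \<Rightarrow> ('a \<Rightarrow> real) \<Rightarrow> bool" where
  "smooth_near M p f \<longleftrightarrow> (\<exists>W. p \<in> W \<and> smooth_fun_on M W f)"


section \<open>Tangent vectors and vector fields\<close>

text \<open>A tangent vector at \<open>p\<close> is the directional derivative along a smooth curve through \<open>p\<close>, acting on
  the real functions that are smooth near \<open>p\<close>; by convention it is 0 on all other functions.\<close>

type_synonym 'a tvec = "('a \<Rightarrow> real) \<Rightarrow> real"
type_synonym 'a vfield = "'a \<Rightarrow> 'a tvec"

definition velocity :: "('a, 'e::euclidean_space) manifold_data \<Rightarrow> (real \<Rightarrow> 'a) \<Rightarrow> 'a tvec" where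
  "velocity M \<alpha> = (\<lambda>f. if smooth_near M (\<alpha> 0) f then deriv (\<lambda>t. f (\<alpha> t)) 0 else 0)"

definition tangent_space :: "('a, 'e::euclidean_space) manifold_data \<Rightarrow> 'a \<Rightarrow> 'a tvec set" where
  "tangent_space M p =
     {velocity M \<alpha> | \<alpha> \<epsilon>. \<epsilon> > 0 \<and> smooth_map (open_submanifold real_line {-\<epsilon><..<\<epsilon>}) M \<alpha> \<and> \<alpha> 0 = p}"

definition differential ::
  "('b, 'd::euclidean_space) manifold_data \<Rightarrow> ('a \<Rightarrow> 'b) \<Rightarrow> 'a \<Rightarrow> 'a tvec \<Rightarrow> 'b tvec" where
  "differential N F p v = (\<lambda>f. if smooth_near N (F p) f then v (f \<circ> F) else 0)"

text \<open>The value 0 at points outside the manifold only makes vector fields unique as functions.\<close>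

definition vector_fields :: "('a, 'e::euclidean_space) manifold_data \<Rightarrow> 'a vfield set" where
  "vector_fields M =
     {X. (\<forall>p\<in>topspace (mtop M). X p \<in> tangent_space M p) \<and>
         (\<forall>p. p \<notin> topspace (mtop M) \<longrightarrow> X p = (\<lambda>_. 0)) \<and>
         (\<forall>W f. smooth_fun_on M W f \<longrightarrow> smooth_fun_on M W (\<lambda>p. X p f))}"

definition vadd :: "'a vfield \<Rightarrow> 'a vfield \<Rightarrow> 'a vfield" where
  "vadd X Y = (\<lambda>p f. X p f + Y p f)"

definition vdiff :: "'a vfield \<Rightarrow> 'a vfield \<Rightarrow> 'a vfield" where
  "vdiff X Y = (\<lambda>p f. X p f - Y p f)"

definition vscale :: "('a \<Rightarrow> real) \<Rightarrow> 'a vfield \<Rightarrow> 'a vfield" where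
  "vscale h X = (\<lambda>p f. h p * X p f)"

definition lie_bracket ::
  "('a, 'e::euclidean_space) manifold_data \<Rightarrow> 'a vfield \<Rightarrow> 'a vfield \<Rightarrow> 'a vfield" where
  "lie_bracket M X Y =
     (\<lambda>p f. if smooth_near M p f then X p (\<lambda>q. Y q f) - Y p (\<lambda>q. X q f) else 0)"


section \<open>Riemannian metrics and sectional curvature\<close>

type_synonym 'a metric_tensor = "'a \<Rightarrow> 'a tvec \<Rightarrow> 'a tvec \<Rightarrow> real"

definition riemannian_metric :: "('a, 'e::euclidean_space) manifold_data \<Rightarrow> 'a metric_tensor \<Rightarrow> bool" where
  "riemannian_metric M g \<longleftrightarrow>
     (\<forall>p\<in>topspace (mtop M).
        (\<forall>u\<in>tangent_space M p. \<forall>v\<in>tangent_space M p. g p u v = g p v u) \<and>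
        (\<forall>u\<in>tangent_space M p. \<forall>v\<in>tangent_space M p. \<forall>w\<in>tangent_space M p. \<forall>a b.
           g p (\<lambda>f. a * u f + b * v f) w = a * g p u w + b * g p v w) \<and>
        (\<forall>u\<in>tangent_space M p. u \<noteq> (\<lambda>_. 0) \<longrightarrow> g p u u > 0)) \<and>
     (\<forall>X\<in>vector_fields M. \<forall>Y\<in>vector_fields M.
        smooth_fun_on M (topspace (mtop M)) (\<lambda>p. g p (X p) (Y p)))"

type_synonym 'a connection = "'a vfield \<Rightarrow> 'a vfield \<Rightarrow> 'a vfield"

definition affine_connection :: "('a, 'e::euclidean_space) manifold_data \<Rightarrow> 'a connection \<Rightarrow> bool" where
  "affine_connection M D \<longleftrightarrow>
     (\<forall>X\<in>vector_fields M. \<forall>Y\<in>vector_fields M. D X Y \<in> vector_fields M) \<and>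
     (\<forall>X\<in>vector_fields M. \<forall>Y\<in>vector_fields M. \<forall>Z\<in>vector_fields M.
        D (vadd X Y) Z = vadd (D X Z) (D Y Z) \<and>
        D X (vadd Y Z) = vadd (D X Y) (D X Z)) \<and>
     (\<forall>h. smooth_fun_on M (topspace (mtop M)) h \<longrightarrow>
        (\<forall>X\<in>vector_fields M. \<forall>Y\<in>vector_fields M.
           D (vscale h X) Y = vscale h (D X Y) \<and>
           D X (vscale h Y) = vadd (vscale (\<lambda>p. X p h) Y) (vscale h (D X Y))))"

definition is_levi_civita ::
  "('a, 'e::euclidean_space) manifold_data \<Rightarrow> 'a metric_tensor \<Rightarrow> 'a connection \<Rightarrow> bool" where
  "is_levi_civita M g D \<longleftrightarrow>
     affine_connection M D \<and>
     (\<forall>X\<in>vector_fields M. \<forall>Y\<in>vector_fields M. vdiff (D X Y) (D Y X) = lie_bracket M X Y) \<and>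
     (\<forall>X\<in>vector_fields M. \<forall>Y\<in>vector_fields M. \<forall>Z\<in>vector_fields M. \<forall>p\<in>topspace (mtop M).
        X p (\<lambda>q. g q (Y q) (Z q)) = g p (D X Y p) (Z p) + g p (Y p) (D X Z p))"

text \<open>By the fundamental theorem of Riemannian geometry the choice is unique on smooth vector fields;
  the arguments outside \<open>vector_fields M\<close> are never used.\<close>

definition levi_civita ::
  "('a, 'e::euclidean_space) manifold_data \<Rightarrow> 'a metric_tensor \<Rightarrow> 'a connection" where
  "levi_civita M g = (SOME D. is_levi_civita M g D)"

definition riemann_curvature ::
  "('a, 'e::euclidean_space) manifold_data \<Rightarrow> 'a metric_tensor \<Rightarrow>
    'a vfield \<Rightarrow> 'a vfield \<Rightarrow> 'a vfield \<Rightarrow> 'a vfield" where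
  "riemann_curvature M g X Y Z =
     (let D = levi_civita M g
      in vdiff (vdiff (D X (D Y Z)) (D Y (D X Z))) (D (lie_bracket M X Y) Z))"

text \<open>The sectional curvature at \<open>p\<close> of the plane spanned by \<open>X p\<close> and \<open>Y p\<close>.  The numerator is
  tensorial, so it depends on the values of the fields at \<open>p\<close> only, and every pair of
  tangent vectors at \<open>p\<close> extends to smooth vector fields.\<close>

definition sectional_curvature ::
  "('a, 'e::euclidean_space) manifold_data \<Rightarrow> 'a metric_tensor \<Rightarrow> 'a \<Rightarrow> 'a vfield \<Rightarrow> 'a vfield \<Rightarrow> real" where
  "sectional_curvature M g p X Y =
     g p (riemann_curvature M g X Y Y p) (X p) /
     (g p (X p) (X p) * g p (Y p) (Y p) - (g p (X p) (Y p))\<^sup>2)"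

definition lin_indep2 :: "'a tvec \<Rightarrow> 'a tvec \<Rightarrow> bool" where
  "lin_indep2 u v \<longleftrightarrow> (\<forall>a b. (\<lambda>f. a * u f + b * v f) = (\<lambda>_. 0) \<longrightarrow> a = 0 \<and> b = 0)"

definition flat :: "('a, 'e::euclidean_space) manifold_data \<Rightarrow> 'a metric_tensor \<Rightarrow> bool" where
  "flat M g \<longleftrightarrow>
     (\<forall>p\<in>topspace (mtop M). \<forall>X\<in>vector_fields M. \<forall>Y\<in>vector_fields M.
        lin_indep2 (X p) (Y p) \<longrightarrow> sectional_curvature M g p X Y = 0)"


section \<open>Metric Lie groups\<close>

definition lie_group :: "('a, 'b) monoid_scheme \<Rightarrow> ('a, 'e::euclidean_space) manifold_data \<Rightarrow> bool" where
  "lie_group G M \<longleftrightarrow>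
     group G \<and> smooth_manifold M \<and> topspace (mtop M) = carrier G \<and>
     smooth_map (product_manifold M M) M (\<lambda>(x, y). x \<otimes>\<^bsub>G\<^esub> y) \<and>
     smooth_map M M (\<lambda>x. inv\<^bsub>G\<^esub> x)"

definition left_translate ::
  "('a, 'b) monoid_scheme \<Rightarrow> ('a, 'e::euclidean_space) manifold_data \<Rightarrow> 'a \<Rightarrow> 'a \<Rightarrow> 'a tvec \<Rightarrow> 'a tvec" where
  "left_translate G M a = differential M (\<lambda>x. a \<otimes>\<^bsub>G\<^esub> x)"

definition lie_algebra ::
  "('a, 'b) monoid_scheme \<Rightarrow> ('a, 'e::euclidean_space) manifold_data \<Rightarrow> 'a vfield set" where
  "lie_algebra G M =
     {X \<in> vector_fields M.
        \<forall>a\<in>carrier G. \<forall>x\<in>carrier G. left_translate G M a x (X x) = X (a \<otimes>\<^bsub>G\<^esub> x)}"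

definition metric_lie_group ::
  "('a, 'b) monoid_scheme \<Rightarrow> ('a, 'e::euclidean_space) manifold_data \<Rightarrow> 'a metric_tensor \<Rightarrow> bool" where
  "metric_lie_group G M g \<longleftrightarrow>
     lie_group G M \<and> riemannian_metric M g \<and>
     (\<forall>a\<in>carrier G. \<forall>x\<in>carrier G. \<forall>u\<in>tangent_space M x. \<forall>v\<in>tangent_space M x.
        g (a \<otimes>\<^bsub>G\<^esub> x) (left_translate G M a x u) (left_translate G M a x v) = g x u v)"

definition lie_inner :: "('a, 'b) monoid_scheme \<Rightarrow> 'a metric_tensor \<Rightarrow> 'a vfield \<Rightarrow> 'a vfield \<Rightarrow> real" where
  "lie_inner G g X Y = g \<one>\<^bsub>G\<^esub> (X \<one>\<^bsub>G\<^esub>) (Y \<one>\<^bsub>G\<^esub>)"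

definition cyclic ::
  "('a, 'b) monoid_scheme \<Rightarrow> ('a, 'e::euclidean_space) manifold_data \<Rightarrow> 'a metric_tensor \<Rightarrow> bool" where
  "cyclic G M g \<longleftrightarrow>
     (\<forall>X\<in>lie_algebra G M. \<forall>Y\<in>lie_algebra G M. \<forall>Z\<in>lie_algebra G M.
        lie_inner G g (lie_bracket M X Y) Z + lie_inner G g (lie_bracket M Y Z) X +
        lie_inner G g (lie_bracket M Z X) Y = 0)"

end

theory Submission
  imports Defs
begin

text \<open>Let \<open>E\<^sub>i\<close> be an orthonormal frame of left-invariant fields, let
  \<open>c i j k = \<langle>[E\<^sub>i, E\<^sub>j], E\<^sub>k\<rangle>\<close>, and let \<open>\<Gamma> i j k = \<langle>\<nabla> E\<^sub>i E\<^sub>j, E\<^sub>k\<rangle>\<close>.  Inner products of left-invariant fields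
  are constant, so the Koszul formula expresses \<open>\<Gamma>\<close> linearly through \<open>c\<close> (\<open>nabla_E\<close>), and the curvature in
  the frame is a quadratic polynomial in the \<open>c i j k\<close> (\<open>curvature_E\<close>).

  Flat implies abelian.  For a cyclic metric the Koszul formula collapses to \<open>\<Gamma> i j k = c k j i\<close>.  The
  sum of the sectional curvatures over all pairs of frame vectors, the scalar curvature, is then
  \<open>- \<parallel>H\<parallel>\<^sup>2 - \<parallel>c\<parallel>\<^sup>2 / 2\<close>, where \<open>H k = (\<Sum>i. c k i i)\<close> is the trace of \<open>ad E\<^sub>k\<close>: the cyclic identity reduces each
  contraction of \<open>c\<close> with a permuted copy of itself to a multiple of \<open>\<parallel>c\<parallel>\<^sup>2\<close>.  If it vanishes, all
  structure constants are 0 (\<open>scalar_curvature_vanishing\<close>).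
  The Lie algebra is then abelian, and it remains to show that \<open>G\<close> is (\<open>connected_abelian\<close>).  The
  bracket is the derivative of the adjoint representation, so
  \<open>Ad\<close> has derivative 0 and, \<open>G\<close> being connected, \<open>Ad a\<close> is the identity for every \<open>a\<close>
  (\<open>Ad_trivial\<close>).  Hence \<open>x \<mapsto> a x a\<^sup>-\<^sup>1 x\<^sup>-\<^sup>1\<close> has derivative 0 and is constant with value 1.

  Abelian implies flat (\<open>comm_group_imp_flat\<close>).  For commuting factors the mixed second derivatives
  that make up the bracket of two left-invariant fields agree, so \<open>c = 0\<close> and the frame is parallel.
  Covariant differentiation then acts on the coefficients of a field by directional derivatives, and
  the curvature vanishes by the definition of the bracket.

  Both directions need the Levi-Civita connection to exist, because it enters as a choice.  The frame
  is global, so the connection can be written down in terms of \<open>\<Gamma>\<close> and checked directly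
  (\<open>levi_civita\<close>).

  Smoothness is handled through \<open>plot\<close>s, the smooth maps from open subsets of Euclidean spaces into
  the manifold.  Charts provide enough of them to detect smoothness, they can be multiplied and
  inverted pointwise in the group, and composing with them turns every statement about derivatives
  into one about ordinary Frechet derivatives.\<close>

section \<open>Smooth maps on open subsets of Euclidean spaces\<close>

abbreviation fd :: "('a::real_normed_vector \<Rightarrow> 'b::real_normed_vector) \<Rightarrow> 'a \<Rightarrow> 'a \<Rightarrow> 'b" where
  "fd F x \<equiv> frechet_derivative F (at x)"

lemma fd_cong:
  assumes "open S" "x \<in> S" "\<And>y. y \<in> S \<Longrightarrow> F y = G y"
  shows "fd F x = fd G x"
proof -
  have "(F has_derivative D) (at x) \<longleftrightarrow> (G has_derivative D) (at x)" for D
    using has_derivative_transform_within_open[of F D x UNIV S G]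
      has_derivative_transform_within_open[of G D x UNIV S F] assms by auto
  then show ?thesis by (simp add: frechet_derivative_def)
qed

lemma fd_eqI: "(F has_derivative D) (at x) \<Longrightarrow> fd F x = D"
  using frechet_derivative_at by metis

lemma has_fd: "F differentiable (at x) \<Longrightarrow> (F has_derivative fd F x) (at x)"
  using frechet_derivative_works by blast

lemma differentiable_cong_open:
  assumes "open S" "x \<in> S" "\<And>y. y \<in> S \<Longrightarrow> F y = G y" "F differentiable (at x)"
  shows "G differentiable (at x)"
  using assms has_derivative_transform_within_open[of F _ x UNIV S G]
  unfolding differentiable_def by blast

lemma Ck_on_subset: "Ck_on k F S \<Longrightarrow> T \<subseteq> S \<Longrightarrow> Ck_on k F T"
proof (induction k arbitrary: F)
  case 0
  then show ?case by (auto intro: continuous_on_subset)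
qed auto

lemma Ck_on_Suc_imp: "Ck_on (Suc k) F S \<Longrightarrow> Ck_on k F S"
proof (induction k arbitrary: F)
  case 0
  then show ?case
    by (auto intro!: continuous_at_imp_continuous_on differentiable_imp_continuous_within)
next
  case (Suc k)
  then show ?case by (metis Ck_on.simps(2))
qed

lemma Ck_on_imp_continuous_on: "Ck_on k F S \<Longrightarrow> continuous_on S F"
  by (induction k) (auto dest: Ck_on_Suc_imp simp del: Ck_on.simps(2))

lemma Ck_on_cong:
  assumes "open S" "\<And>y. y \<in> S \<Longrightarrow> F y = G y" "Ck_on k F S"
  shows "Ck_on k G S"
  using assms(2,3)
proof (induction k arbitrary: F G)
  case 0
  then show ?case using continuous_on_cong[OF refl, of S F G] by simp
next
  case (Suc k)
  have "Ck_on k (\<lambda>x. fd G x v) S" for v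
    using Suc.IH[of "\<lambda>x. fd F x v" "\<lambda>x. fd G x v"] Suc.prems fd_cong[OF assms(1) _ Suc.prems(1)]
    by auto
  moreover have "G differentiable (at x)" if "x \<in> S" for x
    using differentiable_cong_open[OF assms(1) that Suc.prems(1)] Suc.prems(2) that by auto
  ultimately show ?case by simp
qed

lemma Ck_on_local:
  assumes "\<And>x. x \<in> S \<Longrightarrow> \<exists>U. open U \<and> x \<in> U \<and> Ck_on k F U"
  shows "Ck_on k F S"
  using assms
proof (induction k arbitrary: F)
  case 0
  then show ?case
    by (metis Ck_on.simps(1) continuous_at_imp_continuous_on continuous_on_eq_continuous_at)
next
  case (Suc k)
  have "Ck_on k (\<lambda>x. fd F x v) S" for v
    by (rule Suc.IH) (use Suc.prems in fastforce)
  moreover have "F differentiable (at x)" if "x \<in> S" for x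
    using Suc.prems[OF that] by auto
  ultimately show ?case by simp
qed

lemma Ck_on_const: "Ck_on k (\<lambda>x. c) S"
  by (induction k arbitrary: c) auto

lemma Ck_on_add: "Ck_on k F S \<Longrightarrow> Ck_on k G S \<Longrightarrow> open S \<Longrightarrow> Ck_on k (\<lambda>x. F x + G x) S"
proof (induction k arbitrary: F G)
  case 0
  then show ?case by (simp add: continuous_on_add continuous_on_scaleR continuous_on_Pair)
next
  case (Suc k)
  have eq: "fd F x v + fd G x v = fd (\<lambda>x. F x + G x) x v" if "x \<in> S" for x v
    using fd_eqI[OF has_derivative_add[OF has_fd[of F x] has_fd[of G x]]] that Suc.prems by simp
  have "Ck_on k (\<lambda>x. fd (\<lambda>x. F x + G x) x v) S" for v
    by (rule Ck_on_cong[OF \<open>open S\<close> eq]) (use Suc in auto)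
  then show ?case using Suc.prems by simp
qed

lemma Ck_on_linear:
  assumes "bounded_linear L"
  shows "Ck_on k F S \<Longrightarrow> open S \<Longrightarrow> Ck_on k (\<lambda>x. L (F x)) S"
proof (induction k arbitrary: F)
  case 0
  then show ?case using bounded_linear.continuous_on[OF assms] by auto
next
  case (Suc k)
  have D: "((\<lambda>x. L (F x)) has_derivative (\<lambda>v. L (fd F x v))) (at x)" if "x \<in> S" for x
    using bounded_linear.has_derivative[OF assms has_fd[of F x]] that Suc.prems by simp
  have "Ck_on k (\<lambda>x. fd (\<lambda>x. L (F x)) x v) S" for v
    by (rule Ck_on_cong[OF \<open>open S\<close>, of "\<lambda>x. L (fd F x v)"]) (use Suc fd_eqI[OF D] in auto)
  then show ?case using D by (auto simp: differentiable_def)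
qed

lemma Ck_on_scaleR:
  "Ck_on k f S \<Longrightarrow> Ck_on k F S \<Longrightarrow> open S \<Longrightarrow> Ck_on k (\<lambda>x. f x *\<^sub>R F x) S"
proof (induction k arbitrary: f F)
  case 0
  then show ?case by (simp add: continuous_on_add continuous_on_scaleR continuous_on_Pair)
next
  case (Suc k)
  have low: "Ck_on k f S" "Ck_on k F S" using Suc.prems(1,2) by (simp_all only: Ck_on_Suc_imp)
  have D: "((\<lambda>x. f x *\<^sub>R F x) has_derivative (\<lambda>v. f x *\<^sub>R fd F x v + fd f x v *\<^sub>R F x)) (at x)"
    if "x \<in> S" for x
    using has_derivative_scaleR[OF has_fd[of f x] has_fd[of F x]] that Suc.prems by simp
  have "Ck_on k (\<lambda>x. fd (\<lambda>x. f x *\<^sub>R F x) x v) S" for v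
    by (rule Ck_on_cong[OF \<open>open S\<close>, of "\<lambda>x. f x *\<^sub>R fd F x v + fd f x v *\<^sub>R F x"])
      (use Suc fd_eqI[OF D] low in \<open>auto intro!: Ck_on_add\<close>)
  then show ?case using D by (auto simp: differentiable_def)
qed

lemma Ck_on_Pair:
  "Ck_on k F S \<Longrightarrow> Ck_on k G S \<Longrightarrow> open S \<Longrightarrow> Ck_on k (\<lambda>x. (F x, G x)) S"
proof (induction k arbitrary: F G)
  case 0
  then show ?case by (simp add: continuous_on_add continuous_on_scaleR continuous_on_Pair)
next
  case (Suc k)
  have D: "((\<lambda>x. (F x, G x)) has_derivative (\<lambda>v. (fd F x v, fd G x v))) (at x)" if "x \<in> S" for x
    using has_derivative_Pair[OF has_fd[of F x] has_fd[of G x]] that Suc.prems by simp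
  have "Ck_on k (\<lambda>x. fd (\<lambda>x. (F x, G x)) x v) S" for v
    by (rule Ck_on_cong[OF \<open>open S\<close>, of "\<lambda>x. (fd F x v, fd G x v)"])
      (use Suc fd_eqI[OF D] in auto)
  then show ?case using D by (auto simp: differentiable_def)
qed

lemma Ck_on_sum:
  assumes "\<And>i. i \<in> I \<Longrightarrow> Ck_on k (F i) S" "open S"
  shows "Ck_on k (\<lambda>x. \<Sum>i\<in>I. F i x) S"
  using assms by (induction I rule: infinite_finite_induct) (auto intro: Ck_on_const Ck_on_add)

text \<open>With the inner derivative expanded in the standard basis, the chain rule becomes a sum of
  products of a scalar function with a directional derivative in a fixed direction.  Those are the
  derivatives that \<open>Ck_on\<close> controls, and so the next induction can use \<open>Ck_on_scaleR\<close>.\<close>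

lemma linear_expand:
  assumes "linear L"
  shows "L v = (\<Sum>b\<in>Basis. (v \<bullet> b) *\<^sub>R L (b::'a::euclidean_space))"
  using linear_sum[OF assms, of "\<lambda>b. (v \<bullet> b) *\<^sub>R b" Basis] linear_scale[OF assms]
  by (simp add: euclidean_representation)

lemma Ck_on_compose:
  fixes F :: "'b::euclidean_space \<Rightarrow> 'c::euclidean_space" and G :: "'a::euclidean_space \<Rightarrow> 'b"
  shows "Ck_on k F T \<Longrightarrow> Ck_on k G S \<Longrightarrow> G ` S \<subseteq> T \<Longrightarrow> open S \<Longrightarrow> Ck_on k (\<lambda>x. F (G x)) S"
proof (induction k arbitrary: F)
  case 0
  then show ?case by (auto intro: continuous_on_compose2)
next
  case (Suc k)
  have D: "((\<lambda>x. F (G x)) has_derivative (\<lambda>v. fd F (G x) (fd G x v))) (at x)" if "x \<in> S" for x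
    using has_derivative_compose[OF has_fd[of G x] has_fd[of F "G x"]] that Suc.prems
    by (auto simp: image_subset_iff)
  have lin: "linear (fd F (G x))" if "x \<in> S" for x
    by (rule linear_frechet_derivative) (use that Suc.prems in auto)
  have "Ck_on k (\<lambda>x. fd (\<lambda>x. F (G x)) x v) S" for v
  proof (rule Ck_on_cong[OF \<open>open S\<close>, of "\<lambda>x. \<Sum>b\<in>Basis. (fd G x v \<bullet> b) *\<^sub>R fd F (G x) b"])
    show "(\<Sum>b\<in>Basis. (fd G x v \<bullet> b) *\<^sub>R fd F (G x) b) = fd (\<lambda>x. F (G x)) x v" if "x \<in> S" for x
      using linear_expand[OF lin[OF that], of "fd G x v"] by (simp add: fd_eqI[OF D[OF that]])
    have "Ck_on k (\<lambda>x. fd F (G x) b) S" for b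
      using Suc.IH[of "\<lambda>y. fd F y b"] Suc.prems Ck_on_Suc_imp[OF Suc.prems(2)] by simp
    moreover have "Ck_on k (\<lambda>x. fd G x v \<bullet> b) S" for b
      using Ck_on_linear[OF bounded_linear_inner_left, of k "\<lambda>x. fd G x v" S b] Suc.prems by auto
    ultimately show "Ck_on k (\<lambda>x. \<Sum>b\<in>Basis. (fd G x v \<bullet> b) *\<^sub>R fd F (G x) b) S"
      using Suc.prems by (intro Ck_on_sum Ck_on_scaleR) auto
  qed
  then show ?case using D by (auto simp: differentiable_def)
qed

text \<open>On an open set the derivatives of \<open>F\<close> at its points depend only on the values of \<open>F\<close> there; openness is
  part of the definition so that it need not be carried along.\<close>

definition Cinf :: "'a::euclidean_space set \<Rightarrow> ('a \<Rightarrow> 'b::euclidean_space) \<Rightarrow> bool" where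
  "Cinf S F \<longleftrightarrow> open S \<and> (\<forall>k. Ck_on k F S)"

lemma Cinf_open: "Cinf S F \<Longrightarrow> open S"
  by (simp add: Cinf_def)

lemma Cinf_subset: "Cinf S F \<Longrightarrow> open T \<Longrightarrow> T \<subseteq> S \<Longrightarrow> Cinf T F"
  by (auto simp: Cinf_def intro: Ck_on_subset)

lemma Cinf_cong: "Cinf S F \<Longrightarrow> (\<And>y. y \<in> S \<Longrightarrow> F y = G y) \<Longrightarrow> Cinf S G"
  unfolding Cinf_def using Ck_on_cong[of S F G] by blast

lemma Cinf_local:
  assumes "\<And>x. x \<in> S \<Longrightarrow> \<exists>U. x \<in> U \<and> U \<subseteq> S \<and> Cinf U F"
  shows "Cinf S F"
proof -
  have "open S" using assms unfolding Cinf_def by (subst open_subopen) blast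
  moreover have "Ck_on k F S" for k
    using assms unfolding Cinf_def by (intro Ck_on_local) blast
  ultimately show ?thesis by (simp add: Cinf_def)
qed

lemma Cinf_continuous_on: "Cinf S F \<Longrightarrow> continuous_on S F"
  unfolding Cinf_def using Ck_on_imp_continuous_on by blast

lemma Cinf_differentiable: "Cinf S F \<Longrightarrow> x \<in> S \<Longrightarrow> F differentiable (at x)"
  unfolding Cinf_def by (metis Ck_on.simps(2))

lemma Cinf_has_derivative: "Cinf S F \<Longrightarrow> x \<in> S \<Longrightarrow> (F has_derivative fd F x) (at x)"
  using Cinf_differentiable frechet_derivative_works by blast

lemma Cinf_linear_fd: "Cinf S F \<Longrightarrow> x \<in> S \<Longrightarrow> linear (fd F x)"
  by (metis Cinf_differentiable linear_frechet_derivative)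

lemma Cinf_fd: "Cinf S F \<Longrightarrow> Cinf S (\<lambda>x. fd F x v)"
  unfolding Cinf_def by (metis Ck_on.simps(2))

lemma Cinf_const: "open S \<Longrightarrow> Cinf S (\<lambda>x. c)"
  by (simp add: Cinf_def Ck_on_const)

lemma Ck_on_ident: "Ck_on k (\<lambda>x. x) S"
  by (cases k) (auto intro: Ck_on_const)

lemma Cinf_ident: "open S \<Longrightarrow> Cinf S (\<lambda>x. x)"
  by (simp add: Cinf_def Ck_on_ident)

lemma Cinf_add: "Cinf S F \<Longrightarrow> Cinf S G \<Longrightarrow> Cinf S (\<lambda>x. F x + G x)"
  by (simp add: Cinf_def Ck_on_add)

lemma Cinf_scaleR: "Cinf S f \<Longrightarrow> Cinf S F \<Longrightarrow> Cinf S (\<lambda>x. f x *\<^sub>R F x)"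
  by (simp add: Cinf_def Ck_on_scaleR)

lemma Cinf_mult: "Cinf S f \<Longrightarrow> Cinf S (F::_\<Rightarrow>real) \<Longrightarrow> Cinf S (\<lambda>x. f x * F x)"
  using Cinf_scaleR[of S f F] by simp

lemma Cinf_sum: "open S \<Longrightarrow> (\<And>i. i \<in> I \<Longrightarrow> Cinf S (F i)) \<Longrightarrow> Cinf S (\<lambda>x. \<Sum>i\<in>I. F i x)"
  by (auto simp: Cinf_def intro: Ck_on_sum)

lemma Cinf_linear: "bounded_linear L \<Longrightarrow> Cinf S F \<Longrightarrow> Cinf S (\<lambda>x. L (F x))"
  by (simp add: Cinf_def Ck_on_linear)

lemma Cinf_Pair: "Cinf S F \<Longrightarrow> Cinf S G \<Longrightarrow> Cinf S (\<lambda>x. (F x, G x))"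
  by (simp add: Cinf_def Ck_on_Pair)

lemma Cinf_compose: "Cinf T F \<Longrightarrow> Cinf S G \<Longrightarrow> G ` S \<subseteq> T \<Longrightarrow> Cinf S (\<lambda>x. F (G x))"
  unfolding Cinf_def using Ck_on_compose by blast

lemma fd_compose:
  assumes "Cinf T F" "Cinf S G" "G x \<in> T" "x \<in> S"
  shows "fd (\<lambda>x. F (G x)) x v = fd F (G x) (fd G x v)"
  using fd_eqI[OF has_derivative_compose[OF Cinf_has_derivative[OF assms(2,4)]
      Cinf_has_derivative[OF assms(1,3)]]] by simp


section \<open>Symmetry of second derivatives\<close>

text \<open>The mean value theorem is applied twice to the second difference of \<open>F\<close> over the parallelogram with
  sides \<open>h u\<close> and \<open>h v\<close>, first in the direction \<open>u\<close> and then in the direction \<open>v\<close>.\<close>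

lemma second_difference_eq:
  fixes F :: "'a::euclidean_space \<Rightarrow> real"
  assumes F: "Cinf S F" and h: "h > 0"
    and sub: "\<And>s t. 0 \<le> s \<Longrightarrow> s \<le> h \<Longrightarrow> 0 \<le> t \<Longrightarrow> t \<le> h \<Longrightarrow> x + s *\<^sub>R u + t *\<^sub>R v \<in> S"
  shows "\<exists>s t. 0 < s \<and> s < h \<and> 0 < t \<and> t < h \<and>
    F (x + h *\<^sub>R u + h *\<^sub>R v) - F (x + h *\<^sub>R u) - F (x + h *\<^sub>R v) + F x =
    h * (h * fd (\<lambda>y. fd F y u) (x + s *\<^sub>R u + t *\<^sub>R v) v)"
proof -
  have Du: "((\<lambda>s. F (x + s *\<^sub>R u + t *\<^sub>R v)) has_real_derivative fd F (x + s *\<^sub>R u + t *\<^sub>R v) u) (at s)"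
    if "0 \<le> s" "s \<le> h" "0 \<le> t" "t \<le> h" for s t
  proof -
    have "((\<lambda>s. x + s *\<^sub>R u + t *\<^sub>R v) has_derivative (\<lambda>r. r *\<^sub>R u)) (at s)"
      by (auto intro!: derivative_eq_intros)
    from has_derivative_compose[OF this Cinf_has_derivative[OF F sub[OF that]]]
    show ?thesis
      using linear_scale[OF Cinf_linear_fd[OF F sub[OF that]]]
      by (simp add: has_field_derivative_def mult.commute[of _ "fd F (x + s *\<^sub>R u + t *\<^sub>R v) u"] mult_commute_abs)
  qed
  have F': "Cinf S (\<lambda>y. fd F y u)" using F by (rule Cinf_fd)
  have Dv: "((\<lambda>t. fd F (x + s *\<^sub>R u + t *\<^sub>R v) u) has_real_derivative
      fd (\<lambda>y. fd F y u) (x + s *\<^sub>R u + t *\<^sub>R v) v) (at t)"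
    if "0 \<le> s" "s \<le> h" "0 \<le> t" "t \<le> h" for s t
  proof -
    have "((\<lambda>t. x + s *\<^sub>R u + t *\<^sub>R v) has_derivative (\<lambda>r. r *\<^sub>R v)) (at t)"
      by (auto intro!: derivative_eq_intros)
    from has_derivative_compose[OF this Cinf_has_derivative[OF F' sub[OF that]]]
    show ?thesis
      using linear_scale[OF Cinf_linear_fd[OF F' sub[OF that]]]
      by (simp add: has_field_derivative_def mult_commute_abs)
  qed
  have "\<exists>s>0. s < h \<and> (F (x + h *\<^sub>R u + h *\<^sub>R v) - F (x + h *\<^sub>R u + 0 *\<^sub>R v)) -
      (F (x + 0 *\<^sub>R u + h *\<^sub>R v) - F (x + 0 *\<^sub>R u + 0 *\<^sub>R v)) =
      (h - 0) * (fd F (x + s *\<^sub>R u + h *\<^sub>R v) u - fd F (x + s *\<^sub>R u + 0 *\<^sub>R v) u)"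
    by (rule MVT2[OF h, of "\<lambda>s. F (x + s *\<^sub>R u + h *\<^sub>R v) - F (x + s *\<^sub>R u + 0 *\<^sub>R v)"])
      (intro DERIV_diff Du; use h in simp)
  then obtain s where s: "0 < s" "s < h"
    and es: "F (x + h *\<^sub>R u + h *\<^sub>R v) - F (x + h *\<^sub>R u) - F (x + h *\<^sub>R v) + F x =
      h * (fd F (x + s *\<^sub>R u + h *\<^sub>R v) u - fd F (x + s *\<^sub>R u + 0 *\<^sub>R v) u)" by auto
  have "\<exists>t>0. t < h \<and> fd F (x + s *\<^sub>R u + h *\<^sub>R v) u - fd F (x + s *\<^sub>R u + 0 *\<^sub>R v) u =
      (h - 0) * fd (\<lambda>y. fd F y u) (x + s *\<^sub>R u + t *\<^sub>R v) v"
    by (rule MVT2[OF h]) (rule Dv; use s in simp)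
  then show ?thesis using s es by auto
qed

text \<open>The second difference is symmetric in \<open>u\<close> and \<open>v\<close>.  Hence each of the two second derivatives, taken at a
  point near \<open>x\<close>, equals the same quotient, and both are continuous.\<close>

lemma symmetric_second_derivative:
  fixes F :: "'a::euclidean_space \<Rightarrow> real"
  assumes F: "Cinf S F" and x: "x \<in> S"
  shows "fd (\<lambda>y. fd F y u) x v = fd (\<lambda>y. fd F y v) x u"
proof (rule ccontr)
  let ?A = "\<lambda>y. fd (\<lambda>y. fd F y u) y v" and ?B = "\<lambda>y. fd (\<lambda>y. fd F y v) y u"
  assume ne: "?A x \<noteq> ?B x"
  define e where "e = \<bar>?A x - ?B x\<bar> / 2"
  have e: "e > 0" using ne by (simp add: e_def)
  have cont: "isCont ?A x" "isCont ?B x"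
    using Cinf_continuous_on[OF Cinf_fd[OF Cinf_fd[OF F]]] x Cinf_open[OF F]
    by (metis continuous_on_eq_continuous_at)+
  obtain d1 where d1: "d1 > 0" "\<And>y. dist y x < d1 \<Longrightarrow> dist (?A y) (?A x) < e"
    using cont(1) e unfolding continuous_at_eps_delta by blast
  obtain d2 where d2: "d2 > 0" "\<And>y. dist y x < d2 \<Longrightarrow> dist (?B y) (?B x) < e"
    using cont(2) e unfolding continuous_at_eps_delta by blast
  obtain d3 where d3: "d3 > 0" "\<And>y. dist y x < d3 \<Longrightarrow> y \<in> S"
    using Cinf_open[OF F] x unfolding open_dist by blast
  define d where "d = min d1 (min d2 d3)"
  \<comment> \<open>This choice keeps the parallelogram inside the ball of radius \<open>d\<close>, also when \<open>u\<close> and \<open>v\<close> vanish.\<close>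
  define h where "h = d / (norm u + norm v + 1) / 2"
  have pos: "norm u + norm v + 1 > 0" by (simp add: add_nonneg_pos)
  have d: "d > 0" using d1 d2 d3 by (simp add: d_def)
  have h: "h > 0" using d pos by (simp add: h_def)
  have small: "dist (x + s *\<^sub>R u + t *\<^sub>R v) x < d" if "0 \<le> s" "s \<le> h" "0 \<le> t" "t \<le> h" for s t
  proof -
    have "dist (x + s *\<^sub>R u + t *\<^sub>R v) x \<le> s * norm u + t * norm v"
      using that norm_triangle_ineq[of "s *\<^sub>R u" "t *\<^sub>R v"] by (simp add: dist_norm)
    also have "\<dots> \<le> h * norm u + h * norm v"
      using that by (intro add_mono mult_right_mono) auto
    also have "\<dots> \<le> h * (norm u + norm v + 1)" using h by (simp add: algebra_simps)
    also have "\<dots> = d / 2" using pos unfolding h_def by (simp add: divide_simps del: distrib_left_numeral)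
    also have "\<dots> < d" using d by simp
    finally show ?thesis .
  qed
  have inS: "x + s *\<^sub>R u + t *\<^sub>R v \<in> S" if "0 \<le> s" "s \<le> h" "0 \<le> t" "t \<le> h" for s t
    using small[OF that] d3 by (simp add: d_def)
  have inS': "x + s *\<^sub>R v + t *\<^sub>R u \<in> S" if "0 \<le> s" "s \<le> h" "0 \<le> t" "t \<le> h" for s t
    using inS[of t s] that by (simp add: add_ac)
  obtain s t where st: "0 < s" "s < h" "0 < t" "t < h"
    "F (x + h *\<^sub>R u + h *\<^sub>R v) - F (x + h *\<^sub>R u) - F (x + h *\<^sub>R v) + F x =
    h * (h * ?A (x + s *\<^sub>R u + t *\<^sub>R v))"
    using second_difference_eq[OF F h inS] by auto
  obtain s' t' where st': "0 < s'" "s' < h" "0 < t'" "t' < h"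
    "F (x + h *\<^sub>R v + h *\<^sub>R u) - F (x + h *\<^sub>R v) - F (x + h *\<^sub>R u) + F x =
    h * (h * ?B (x + s' *\<^sub>R v + t' *\<^sub>R u))"
    using second_difference_eq[OF F h inS'] by auto
  have "h * (h * ?A (x + s *\<^sub>R u + t *\<^sub>R v)) = h * (h * ?B (x + s' *\<^sub>R v + t' *\<^sub>R u))"
    using st(5) st'(5) unfolding add.assoc[of x] add.commute[of "h *\<^sub>R v" "h *\<^sub>R u"] by linarith
  then have "?A (x + s *\<^sub>R u + t *\<^sub>R v) = ?B (x + t' *\<^sub>R u + s' *\<^sub>R v)"
    using h by (simp add: add_ac)
  moreover have "dist (?A (x + s *\<^sub>R u + t *\<^sub>R v)) (?A x) < e"
    using d1(2) small[of s t] st by (simp add: d_def)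
  moreover have "dist (?B (x + t' *\<^sub>R u + s' *\<^sub>R v)) (?B x) < e"
    using d2(2) small[of t' s'] st' by (simp add: d_def)
  moreover have "\<bar>b - c\<bar> \<le> \<bar>a - b\<bar> + \<bar>a - c\<bar>" for a b c :: real by arith
  ultimately show False unfolding e_def dist_real_def by (smt (verit) field_sum_of_halves)
qed

text \<open>This is the second derivative \<open>X (Y f)\<close> in coordinates, where \<open>A\<close> holds the components of \<open>Y\<close>: the first
  summand is symmetric in the two fields and drops out of the bracket.\<close>

lemma fd_directional:
  fixes F :: "'b::euclidean_space \<Rightarrow> real" and A \<zeta> :: "'a::euclidean_space \<Rightarrow> 'b"
  assumes F: "Cinf T F" and \<zeta>: "Cinf S \<zeta>" and A: "Cinf S A" and x: "x \<in> S" "\<zeta> ` S \<subseteq> T"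
  shows "fd (\<lambda>y. fd F (\<zeta> y) (A y)) x w =
    fd (\<lambda>z. fd F z (A x)) (\<zeta> x) (fd \<zeta> x w) + fd F (\<zeta> x) (fd A x w)"
proof -
  have \<zeta>T: "\<zeta> y \<in> T" if "y \<in> S" for y using x(2) that by auto
  have exp: "fd F z a = (\<Sum>b\<in>Basis. (a \<bullet> b) * fd F z b)" if "z \<in> T" for z a
    unfolding real_scaleR_def[symmetric] by (rule linear_expand[OF Cinf_linear_fd[OF F that]])
  have "fd (\<lambda>y. fd F (\<zeta> y) (A y)) x = fd (\<lambda>y. \<Sum>b\<in>Basis. (A y \<bullet> b) * fd F (\<zeta> y) b) x"
    by (rule fd_cong[OF Cinf_open[OF A] x(1)]) (rule exp[OF \<zeta>T])
  also have "\<dots> = (\<lambda>w. \<Sum>b\<in>Basis. (A x \<bullet> b) * fd (\<lambda>z. fd F z b) (\<zeta> x) (fd \<zeta> x w) +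
      (fd A x w \<bullet> b) * fd F (\<zeta> x) b)"
  proof (rule fd_eqI, rule has_derivative_sum)
    fix b :: 'b
    have 1: "((\<lambda>y. A y \<bullet> b) has_derivative (\<lambda>w. fd A x w \<bullet> b)) (at x)"
      by (rule has_derivative_inner_left[OF Cinf_has_derivative[OF A x(1)]])
    have 2: "((\<lambda>y. fd F (\<zeta> y) b) has_derivative (\<lambda>w. fd (\<lambda>z. fd F z b) (\<zeta> x) (fd \<zeta> x w))) (at x)"
      by (rule has_derivative_compose[OF Cinf_has_derivative[OF \<zeta> x(1)]
            Cinf_has_derivative[OF Cinf_fd[OF F] \<zeta>T[OF x(1)]]])
    show "((\<lambda>y. (A y \<bullet> b) * fd F (\<zeta> y) b) has_derivative
        (\<lambda>w. (A x \<bullet> b) * fd (\<lambda>z. fd F z b) (\<zeta> x) (fd \<zeta> x w) + (fd A x w \<bullet> b) * fd F (\<zeta> x) b)) (at x)"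
      by (rule has_derivative_mult[OF 1 2])
  qed
  finally have 1: "fd (\<lambda>y. fd F (\<zeta> y) (A y)) x w =
      (\<Sum>b\<in>Basis. (A x \<bullet> b) * fd (\<lambda>z. fd F z b) (\<zeta> x) (fd \<zeta> x w)) + fd F (\<zeta> x) (fd A x w)"
    unfolding exp[OF \<zeta>T[OF x(1)], of "fd A x w"] by (simp only: sum.distrib)
  have "fd (\<lambda>z. fd F z (A x)) (\<zeta> x) = fd (\<lambda>z. \<Sum>b\<in>Basis. (A x \<bullet> b) * fd F z b) (\<zeta> x)"
    by (rule fd_cong[OF Cinf_open[OF F] \<zeta>T[OF x(1)]]) (rule exp)
  also have "\<dots> = (\<lambda>v. \<Sum>b\<in>Basis. (A x \<bullet> b) * fd (\<lambda>z. fd F z b) (\<zeta> x) v)"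
    by (rule fd_eqI, rule has_derivative_sum)
      (rule has_derivative_mult_right[OF Cinf_has_derivative[OF Cinf_fd[OF F] \<zeta>T[OF x(1)]]])
  finally show ?thesis using 1 by simp
qed

lemma fd_fst:
  assumes "Cinf S H" "(x, y) \<in> S"
  shows "fd (\<lambda>x. H (x, y)) x u = fd H (x, y) (u, 0)"
proof -
  have "((\<lambda>x. (x, y)) has_derivative (\<lambda>u. (u, 0))) (at x)"
    by (auto intro!: derivative_eq_intros)
  from fd_eqI[OF has_derivative_compose[OF this Cinf_has_derivative[OF assms]]] show ?thesis by simp
qed

lemma fd_snd:
  assumes "Cinf S H" "(x, y) \<in> S"
  shows "fd (\<lambda>y. H (x, y)) y v = fd H (x, y) (0, v)"
proof -
  have "((\<lambda>y. (x, y)) has_derivative (\<lambda>u. (0, u))) (at y)"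
    by (auto intro!: derivative_eq_intros)
  from fd_eqI[OF has_derivative_compose[OF this Cinf_has_derivative[OF assms]]] show ?thesis by simp
qed

lemma open_slice_fst: "open S \<Longrightarrow> open {x. (x, y) \<in> S}"
  using open_vimage[of S "\<lambda>x. (x, y)"] by (simp add: vimage_def continuous_on_Pair)

lemma open_slice_snd: "open S \<Longrightarrow> open {y. (x, y) \<in> S}"
  using open_vimage[of S "\<lambda>y. (x, y)"] by (simp add: vimage_def continuous_on_Pair)

lemma Cinf_slice_fst: "Cinf S H \<Longrightarrow> Cinf {x. (x, y) \<in> S} (\<lambda>x. H (x, y))"
  by (rule Cinf_compose[of S H]) (auto intro!: Cinf_Pair Cinf_ident Cinf_const open_slice_fst dest: Cinf_open)

lemma Cinf_partial_snd:
  assumes "Cinf S H"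
  shows "Cinf {x. (x, y) \<in> S} (\<lambda>x. fd (\<lambda>y. H (x, y)) y v)"
  by (rule Cinf_cong[OF Cinf_slice_fst[OF Cinf_fd[OF assms]]]) (use fd_snd[OF assms] in auto)

lemma mixed_partials:
  fixes H :: "'a::euclidean_space \<times> 'b::euclidean_space \<Rightarrow> real"
  assumes H: "Cinf S H" and xy: "(x, y) \<in> S"
  shows "fd (\<lambda>x. fd (\<lambda>y. H (x, y)) y v) x u = fd (\<lambda>y. fd (\<lambda>x. H (x, y)) x u) y v"
proof -
  have "fd (\<lambda>x. fd (\<lambda>y. H (x, y)) y v) x u = fd (\<lambda>x. fd H (x, y) (0, v)) x u"
    using fd_cong[OF open_slice_fst[OF Cinf_open[OF H]], of x y]
    by (metis (no_types, lifting) fd_snd[OF H] mem_Collect_eq xy)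
  also have "\<dots> = fd (\<lambda>z. fd H z (0, v)) (x, y) (u, 0)"
    by (rule fd_fst[OF Cinf_fd[OF H] xy])
  also have "\<dots> = fd (\<lambda>z. fd H z (u, 0)) (x, y) (0, v)"
    by (rule symmetric_second_derivative[OF H xy])
  also have "\<dots> = fd (\<lambda>y. fd H (x, y) (u, 0)) y v"
    by (rule fd_snd[OF Cinf_fd[OF H] xy, symmetric])
  also have "\<dots> = fd (\<lambda>y. fd (\<lambda>x. H (x, y)) x u) y v"
    using fd_cong[OF open_slice_snd[OF Cinf_open[OF H]], of y x]
    by (metis (no_types, lifting) fd_fst[OF H] mem_Collect_eq xy)
  finally show ?thesis .
qed

text \<open>The product rule for an arbitrary smooth operation \<open>H\<close> in two arguments.\<close>

lemma fd_diagonal: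
  fixes H :: "'a::euclidean_space \<times> 'a \<Rightarrow> 'b::euclidean_space"
  assumes H: "Cinf S H" and x: "(x, x) \<in> S"
  shows "fd (\<lambda>y. H (y, y)) x w = fd (\<lambda>y. H (y, x)) x w + fd (\<lambda>y. H (x, y)) x w"
proof -
  have "((\<lambda>x. (x, x)) has_derivative (\<lambda>u. (u, u))) (at x)"
    by (auto intro!: derivative_eq_intros)
  from fd_eqI[OF has_derivative_compose[OF this Cinf_has_derivative[OF assms]]]
  have "fd (\<lambda>y. H (y, y)) x w = fd H (x, x) ((w, 0) + (0, w))" by simp
  then show ?thesis
    unfolding linear_add[OF Cinf_linear_fd[OF H x]] fd_fst[OF H x] fd_snd[OF H x] .
qed

lemma mixed_partials_curried:
  fixes H :: "'a::euclidean_space \<Rightarrow> 'b::euclidean_space \<Rightarrow> real"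
  assumes "Cinf S (\<lambda>z. H (fst z) (snd z))" "(x, y) \<in> S"
  shows "fd (\<lambda>x. fd (\<lambda>y. H x y) y v) x u = fd (\<lambda>y. fd (\<lambda>x. H x y) x u) y v"
  using mixed_partials[OF assms, of v u] by simp

lemma fd_diagonal_curried:
  fixes H :: "'a::euclidean_space \<Rightarrow> 'a \<Rightarrow> 'b::euclidean_space"
  assumes "Cinf S (\<lambda>z. H (fst z) (snd z))" "(x, x) \<in> S"
  shows "fd (\<lambda>y. H y y) x w = fd (\<lambda>y. H y x) x w + fd (\<lambda>y. H x y) x w"
  using fd_diagonal[OF assms, of w] by simp

lemma Cinf_partial_snd_curried:
  assumes "Cinf S (\<lambda>z. H (fst z) (snd z))"
  shows "Cinf {x. (x, y) \<in> S} (\<lambda>x. fd (\<lambda>y. H x y) y v)"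
  using Cinf_partial_snd[OF assms, of y v] by simp


section \<open>Smooth maps from Euclidean domains into a manifold\<close>

lemma Cinf_open_preimage: "Cinf S h \<Longrightarrow> open T \<Longrightarrow> open (S \<inter> h -` T)"
  by (rule continuous_open_preimage[OF Cinf_continuous_on Cinf_open])

text \<open>These are the plots of the diffeology of \<open>M\<close>.  Continuity is expressed by preimages of open sets
  because the smoothness condition speaks about those preimages.\<close>

definition plot :: "('a, 'e::euclidean_space) manifold_data \<Rightarrow> 'd::euclidean_space set \<Rightarrow> ('d \<Rightarrow> 'a) \<Rightarrow> bool" where
  "plot M D \<xi> \<longleftrightarrow> open D \<and> \<xi> ` D \<subseteq> topspace (mtop M) \<and>
     (\<forall>W. openin (mtop M) W \<longrightarrow> open (D \<inter> \<xi> -` W)) \<and>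
     (\<forall>(W, \<psi>)\<in>charts M. Cinf (D \<inter> \<xi> -` W) (\<lambda>x. \<psi> (\<xi> x)))"

text \<open>The part of \<open>smooth_manifold\<close> on which the action of smooth maps on plots rests (\<open>smooth_map_plot\<close>).
  Products and open submanifolds inherit it.\<close>

definition chart_cover :: "('a, 'e::euclidean_space) manifold_data \<Rightarrow> bool" where
  "chart_cover M \<longleftrightarrow> (\<forall>(U, \<phi>)\<in>charts M. openin (mtop M) U \<and> inj_on \<phi> U) \<and>
     topspace (mtop M) \<subseteq> (\<Union>(U, \<phi>)\<in>charts M. U)"

lemma chart_coverE:
  assumes "chart_cover M" "p \<in> topspace (mtop M)"
  obtains U \<phi> where "(U, \<phi>) \<in> charts M" "p \<in> U" "inj_on \<phi> U" "openin (mtop M) U"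
proof -
  have "p \<in> (\<Union>(U, \<phi>)\<in>charts M. U)"
    using assms unfolding chart_cover_def by (elim conjE subsetD)
  then obtain c where c: "c \<in> charts M" "p \<in> fst c" by (auto simp: case_prod_beta)
  moreover have "\<forall>(U, \<phi>)\<in>charts M. openin (mtop M) U \<and> inj_on \<phi> U"
    using assms(1) by (simp add: chart_cover_def)
  ultimately show thesis using that[of "fst c" "snd c"] by (auto simp: case_prod_beta)
qed

lemma plot_open: "plot M D \<xi> \<Longrightarrow> open D"
  by (simp add: plot_def)

lemma plot_in_topspace: "plot M D \<xi> \<Longrightarrow> x \<in> D \<Longrightarrow> \<xi> x \<in> topspace (mtop M)"
  by (auto simp: plot_def)

lemma plot_open_preimage: "plot M D \<xi> \<Longrightarrow> openin (mtop M) W \<Longrightarrow> open (D \<inter> \<xi> -` W)"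
  by (simp add: plot_def)

lemma plot_Cinf: "plot M D \<xi> \<Longrightarrow> (W, \<psi>) \<in> charts M \<Longrightarrow> Cinf (D \<inter> \<xi> -` W) (\<lambda>x. \<psi> (\<xi> x))"
  by (auto simp: plot_def)

lemma plot_compose:
  assumes \<xi>: "plot M D \<xi>" and h: "Cinf S h" "h ` S \<subseteq> D"
  shows "plot M S (\<lambda>x. \<xi> (h x))"
proof -
  have pre: "open (S \<inter> h -` T)" if "open T" for T
    by (rule Cinf_open_preimage[OF h(1) that])
  have eq: "S \<inter> (\<lambda>x. \<xi> (h x)) -` W = S \<inter> h -` (D \<inter> \<xi> -` W)" for W
    using h(2) by auto
  have "Cinf (S \<inter> (\<lambda>x. \<xi> (h x)) -` W) (\<lambda>x. \<psi> (\<xi> (h x)))" if "(W, \<psi>) \<in> charts M" for W \<psi>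
    unfolding eq
    by (rule Cinf_compose[OF plot_Cinf[OF \<xi> that]
          Cinf_subset[OF h(1) pre[OF Cinf_open[OF plot_Cinf[OF \<xi> that]]]]]) auto
  moreover have "open (S \<inter> (\<lambda>x. \<xi> (h x)) -` W)" if "openin (mtop M) W" for W
    unfolding eq by (rule pre[OF plot_open_preimage[OF \<xi> that]])
  ultimately show ?thesis
    using Cinf_open[OF h(1)] h(2) plot_in_topspace[OF \<xi>] by (auto simp: plot_def)
qed

lemma plot_subset: "plot M D \<xi> \<Longrightarrow> open S \<Longrightarrow> S \<subseteq> D \<Longrightarrow> plot M S \<xi>"
  using plot_compose[of M D \<xi> S "\<lambda>x. x"] Cinf_ident by auto

lemma plot_const:
  fixes D :: "'c::euclidean_space set" and M :: "('a, 'e::euclidean_space) manifold_data"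
  assumes "p \<in> topspace (mtop M)" "open D"
  shows "plot M D (\<lambda>x. p)"
proof -
  have "D \<inter> (\<lambda>x. p) -` W = (if p \<in> W then D else {})" for W by auto
  moreover have "Cinf (if p \<in> W then D else {}) (\<lambda>x. c)" for W and c :: 'e
    by (rule Cinf_const) (use assms in auto)
  from this[of UNIV] this[of "{}"] have "Cinf D (\<lambda>x. c)" "Cinf {} (\<lambda>x::'c. c)" for c :: 'e
    by auto
  ultimately show ?thesis using assms unfolding plot_def by (auto simp: case_prod_beta split: if_splits)
qed

lemma plot_fst: "plot M S \<eta> \<Longrightarrow> open D \<Longrightarrow> plot M (S \<times> D) (\<lambda>z. \<eta> (fst z))"
  by (rule plot_compose[OF _ Cinf_linear[OF bounded_linear_fst Cinf_ident]])
    (auto intro: open_Times plot_open)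

lemma plot_snd: "plot M D \<xi> \<Longrightarrow> open S \<Longrightarrow> plot M (S \<times> D) (\<lambda>z. \<xi> (snd z))"
  by (rule plot_compose[OF _ Cinf_linear[OF bounded_linear_snd Cinf_ident]])
    (auto intro: open_Times plot_open)

lemma smooth_on_compose:
  assumes "smooth_on A f" "Cinf S h" "h ` S \<subseteq> A"
  shows "Cinf S (\<lambda>x. f (h x))"
proof (rule Cinf_local)
  fix x assume x: "x \<in> S"
  then have "h x \<in> A" using assms(3) by auto
  from assms(1)[unfolded smooth_on_def, rule_format, OF this]
  obtain U F where U: "open U" "h x \<in> U" "\<forall>k. Ck_on k F U" "\<forall>y\<in>A \<inter> U. F y = f y" by auto
  have o: "open (S \<inter> h -` U)"
    by (rule Cinf_open_preimage[OF assms(2) U(1)])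
  have "Cinf (S \<inter> h -` U) (\<lambda>x. F (h x))"
    by (rule Cinf_compose[OF _ Cinf_subset[OF assms(2) o], of U F]) (use U(1,3) in \<open>auto simp: Cinf_def\<close>)
  then have "Cinf (S \<inter> h -` U) (\<lambda>x. f (h x))"
    by (rule Cinf_cong) (use U(4) assms(3) in auto)
  then show "\<exists>U. x \<in> U \<and> U \<subseteq> S \<and> Cinf U (\<lambda>x. f (h x))"
    using x U(2) by (intro exI[of _ "S \<inter> h -` U"]) auto
qed

lemma Cinf_smooth_on: "Cinf S F \<Longrightarrow> A \<subseteq> S \<Longrightarrow> (\<And>x. x \<in> A \<Longrightarrow> F x = f x) \<Longrightarrow> smooth_on A f"
  unfolding smooth_on_def Cinf_def by blast

text \<open>Near a given point the plot factors through the coordinates of a chart of \<open>M\<close>, in which the map is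
  smooth by assumption.\<close>

lemma smooth_map_plot:
  assumes F: "smooth_map M N F" and M: "chart_cover M" and N: "chart_cover N" and \<xi>: "plot M D \<xi>"
  shows "plot N D (\<lambda>x. F (\<xi> x))"
proof -
  have cont: "continuous_map (mtop M) (mtop N) F" using F by (simp add: smooth_map_def)
  have pre: "open (D \<inter> (\<lambda>x. F (\<xi> x)) -` W)" if W: "openin (mtop N) W" for W
  proof -
    have "D \<inter> (\<lambda>x. F (\<xi> x)) -` W = D \<inter> \<xi> -` {p \<in> topspace (mtop M). F p \<in> W}"
      using plot_in_topspace[OF \<xi>] by auto
    then show ?thesis
      using plot_open_preimage[OF \<xi>] openin_continuous_map_preimage[OF cont W] by metis
  qed
  have "Cinf (D \<inter> (\<lambda>x. F (\<xi> x)) -` W) (\<lambda>x. \<psi> (F (\<xi> x)))" if W: "(W, \<psi>) \<in> charts N" for W \<psi>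
  proof (rule Cinf_local)
    fix x assume x: "x \<in> D \<inter> (\<lambda>x. F (\<xi> x)) -` W"
    have Wo: "openin (mtop N) W" using N W by (auto simp: chart_cover_def)
    obtain U \<phi> where U: "(U, \<phi>) \<in> charts M" "\<xi> x \<in> U" "inj_on \<phi> U" "openin (mtop M) U"
      using chart_coverE[OF M plot_in_topspace[OF \<xi>, of x]] x by blast
    let ?S = "(D \<inter> \<xi> -` U) \<inter> (D \<inter> (\<lambda>x. F (\<xi> x)) -` W)"
    have oS: "open ?S" by (rule open_Int[OF plot_open_preimage[OF \<xi> U(4)] pre[OF Wo]])
    have sm: "smooth_on (\<phi> ` (U \<inter> F -` W)) (\<psi> \<circ> F \<circ> inv_into U \<phi>)"
      using F U(1) W unfolding smooth_map_def by auto
    have "Cinf ?S (\<lambda>x. (\<psi> \<circ> F \<circ> inv_into U \<phi>) (\<phi> (\<xi> x)))"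
      by (rule smooth_on_compose[OF sm Cinf_subset[OF plot_Cinf[OF \<xi> U(1)] oS]]) auto
    then have "Cinf ?S (\<lambda>x. \<psi> (F (\<xi> x)))"
      by (rule Cinf_cong) (use U(3) in auto)
    then show "\<exists>U. x \<in> U \<and> U \<subseteq> D \<inter> (\<lambda>x. F (\<xi> x)) -` W \<and> Cinf U (\<lambda>x. \<psi> (F (\<xi> x)))"
      using x U(2) by (intro exI[of _ ?S]) auto
  qed
  then show ?thesis
    using plot_open[OF \<xi>] pre plot_in_topspace[OF \<xi>] cont
    by (auto simp: plot_def continuous_map_def)
qed

lemma chart_cover_real_line: "chart_cover real_line"
  by (simp add: chart_cover_def real_line_def)

lemma plot_real_line: "plot real_line D f \<longleftrightarrow> Cinf D f"
proof
  assume "plot real_line D f"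
  from plot_Cinf[OF this, of UNIV "\<lambda>x. x"] show "Cinf D f" by (simp add: real_line_def)
next
  assume f: "Cinf D f"
  have "open (D \<inter> f -` W)" if "open W" for W
    by (rule Cinf_open_preimage[OF f that])
  then show "plot real_line D f" using f Cinf_open[OF f] by (auto simp: plot_def real_line_def)
qed

lemma chart_cover_product:
  assumes "chart_cover M" "chart_cover N"
  shows "chart_cover (product_manifold M N)"
  unfolding chart_cover_def
proof (intro conjI ballI subsetI)
  fix c assume "c \<in> charts (product_manifold M N)"
  then obtain U \<phi> W \<psi> where c: "c = (U \<times> W, map_prod \<phi> \<psi>)" "(U, \<phi>) \<in> charts M" "(W, \<psi>) \<in> charts N"
    by (auto simp: product_manifold_def)
  have "openin (mtop M) U" "inj_on \<phi> U" "openin (mtop N) W" "inj_on \<psi> W"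
    using assms c(2,3) by (auto simp: chart_cover_def)
  then show "case c of (U, \<phi>) \<Rightarrow> openin (mtop (product_manifold M N)) U \<and> inj_on \<phi> U"
    unfolding c(1) by (simp add: product_manifold_def openin_prod_Times_iff map_prod_inj_on)
next
  fix z assume "z \<in> topspace (mtop (product_manifold M N))"
  then obtain p q where z: "z = (p, q)" "p \<in> topspace (mtop M)" "q \<in> topspace (mtop N)"
    by (auto simp: product_manifold_def)
  obtain U \<phi> where U: "(U, \<phi>) \<in> charts M" "p \<in> U" using assms(1) z(2) by (auto simp: chart_cover_def)
  obtain W \<psi> where W: "(W, \<psi>) \<in> charts N" "q \<in> W" using assms(2) z(3) by (auto simp: chart_cover_def)
  have UW: "(U \<times> W, map_prod \<phi> \<psi>) \<in> charts (product_manifold M N)"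
    using U(1) W(1) by (auto simp: product_manifold_def)
  show "z \<in> (\<Union>(U, \<phi>)\<in>charts (product_manifold M N). U)"
    using UN_I[OF UW, of z "\<lambda>(U, \<phi>). U"] U(2) W(2) z(1) by simp
qed

lemma chart_cover_open_submanifold:
  assumes "chart_cover M" "openin (mtop M) W"
  shows "chart_cover (open_submanifold M W)"
  unfolding chart_cover_def
proof (intro conjI ballI subsetI)
  fix c assume "c \<in> charts (open_submanifold M W)"
  then obtain U \<phi> where c: "c = (U \<inter> W, \<phi>)" "(U, \<phi>) \<in> charts M"
    by (auto simp: open_submanifold_def)
  then show "case c of (U, \<phi>) \<Rightarrow> openin (mtop (open_submanifold M W)) U \<and> inj_on \<phi> U"
    using assms by (auto simp: open_submanifold_def chart_cover_def openin_subtopology intro: inj_on_subset)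
next
  fix p assume p: "p \<in> topspace (mtop (open_submanifold M W))"
  then obtain U \<phi> where "(U, \<phi>) \<in> charts M" "p \<in> U"
    using assms(1) by (auto simp: chart_cover_def open_submanifold_def)
  then have U: "(U \<inter> W, \<phi>) \<in> charts (open_submanifold M W)" "p \<in> U"
    by (auto simp: open_submanifold_def)
  show "p \<in> (\<Union>(U, \<phi>)\<in>charts (open_submanifold M W). U)"
    using UN_I[OF U(1), of p "\<lambda>(U, \<phi>). U"] U(2) p by (simp add: open_submanifold_def)
qed

lemma plot_product:
  assumes \<xi>: "plot M D \<xi>" and \<eta>: "plot N D \<eta>"
  shows "plot (product_manifold M N) D (\<lambda>x. (\<xi> x, \<eta> x))"
proof -
  have "open (D \<inter> (\<lambda>x. (\<xi> x, \<eta> x)) -` W)" if W: "openin (prod_topology (mtop M) (mtop N)) W" for W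
  proof (subst open_subopen, intro ballI)
    fix x assume x: "x \<in> D \<inter> (\<lambda>x. (\<xi> x, \<eta> x)) -` W"
    then have "(\<xi> x, \<eta> x) \<in> W" by simp
    then obtain U V where UV: "openin (mtop M) U" "openin (mtop N) V" "\<xi> x \<in> U" "\<eta> x \<in> V" "U \<times> V \<subseteq> W"
      using W[unfolded openin_prod_topology_alt, rule_format, of "\<xi> x" "\<eta> x"] by auto
    let ?T = "(D \<inter> \<xi> -` U) \<inter> (D \<inter> \<eta> -` V)"
    have "open ?T" by (rule open_Int[OF plot_open_preimage[OF \<xi> UV(1)] plot_open_preimage[OF \<eta> UV(2)]])
    then show "\<exists>T. open T \<and> x \<in> T \<and> T \<subseteq> D \<inter> (\<lambda>x. (\<xi> x, \<eta> x)) -` W"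
      using x UV by (intro exI[of _ ?T]) auto
  qed
  moreover have "Cinf (D \<inter> (\<lambda>x. (\<xi> x, \<eta> x)) -` (U \<times> W)) (\<lambda>x. map_prod \<phi> \<psi> (\<xi> x, \<eta> x))"
    if "(U, \<phi>) \<in> charts M" "(W, \<psi>) \<in> charts N" for U \<phi> W \<psi>
  proof -
    have eq: "D \<inter> (\<lambda>x. (\<xi> x, \<eta> x)) -` (U \<times> W) = (D \<inter> \<xi> -` U) \<inter> (D \<inter> \<eta> -` W)" by auto
    have o: "open ((D \<inter> \<xi> -` U) \<inter> (D \<inter> \<eta> -` W))"
      by (rule open_Int[OF Cinf_open[OF plot_Cinf[OF \<xi> that(1)]] Cinf_open[OF plot_Cinf[OF \<eta> that(2)]]])
    show ?thesis unfolding eq map_prod_simp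
      by (rule Cinf_Pair[OF Cinf_subset[OF plot_Cinf[OF \<xi> that(1)] o] Cinf_subset[OF plot_Cinf[OF \<eta> that(2)] o]]) auto
  qed
  ultimately show ?thesis
    using plot_open[OF \<xi>] plot_in_topspace[OF \<xi>] plot_in_topspace[OF \<eta>]
    unfolding plot_def product_manifold_def by auto
qed

lemma plot_open_submanifold:
  assumes \<xi>: "plot M D \<xi>" and W: "openin (mtop M) W"
  shows "plot (open_submanifold M W) (D \<inter> \<xi> -` W) \<xi>"
proof -
  let ?D = "D \<inter> \<xi> -` W"
  have "plot M ?D \<xi>" by (rule plot_subset[OF \<xi> plot_open_preimage[OF \<xi> W]]) auto
  moreover have "?D \<inter> \<xi> -` (V \<inter> W) = ?D \<inter> \<xi> -` V" for V by auto
  ultimately show ?thesis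
    unfolding plot_def open_submanifold_def
    by (auto simp: openin_subtopology)
qed

lemma smooth_curve_plot:
  assumes "smooth_map (open_submanifold real_line I) M \<alpha>" "open I" "chart_cover M"
  shows "plot M I \<alpha>"
proof -
  have I: "openin (mtop real_line) I" using assms(2) by (simp add: real_line_def)
  have "plot (open_submanifold real_line I) I (\<lambda>x. x)"
    using plot_open_submanifold[of real_line I "\<lambda>x. x" I] I plot_real_line Cinf_ident[OF assms(2)] by auto
  from smooth_map_plot[OF assms(1) chart_cover_open_submanifold[OF chart_cover_real_line I] assms(3) this]
  show ?thesis .
qed

lemma plot_smooth_curve:
  assumes "plot M I \<alpha>"
  shows "smooth_map (open_submanifold real_line I) M \<alpha>"
proof -
  have "openin (top_of_set I) {x \<in> I. \<alpha> x \<in> W}" if "openin (mtop M) W" for W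
  proof -
    have "{x \<in> I. \<alpha> x \<in> W} = I \<inter> \<alpha> -` W" by auto
    then show ?thesis using plot_open_preimage[OF assms that] by (auto intro: open_subset)
  qed
  moreover have "smooth_on ((\<lambda>x. x) ` (I \<inter> \<alpha> -` W)) (\<psi> \<circ> \<alpha> \<circ> inv_into I (\<lambda>x. x))"
    if "(W, \<psi>) \<in> charts M" for W \<psi>
    by (rule Cinf_smooth_on[OF plot_Cinf[OF assms that]])
      (auto simp: inv_into_f_f[of "\<lambda>x. x", OF inj_on_id2])
  ultimately show ?thesis
    using plot_in_topspace[OF assms]
    by (auto simp: smooth_map_def open_submanifold_def real_line_def continuous_map_def)
qed


section \<open>Smooth functions on a manifold\<close>

locale manifold =
  fixes M :: "('a, 'e::euclidean_space) manifold_data"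
  assumes smooth_manifold: "smooth_manifold M"
begin

lemma chart_homeomorphism:
  assumes "(U, \<phi>) \<in> charts M"
  shows "openin (mtop M) U" "openin (top_of_set (model M)) (\<phi> ` U)"
    "homeomorphic_map (subtopology (mtop M) U) (top_of_set (\<phi> ` U)) \<phi>"
proof -
  have "\<forall>(U, \<phi>)\<in>charts M. openin (mtop M) U \<and> openin (top_of_set (model M)) (\<phi> ` U) \<and>
      homeomorphic_map (subtopology (mtop M) U) (top_of_set (\<phi> ` U)) \<phi>"
    using smooth_manifold by (simp add: smooth_manifold_def)
  from bspec[OF this assms] show "openin (mtop M) U" "openin (top_of_set (model M)) (\<phi> ` U)"
    "homeomorphic_map (subtopology (mtop M) U) (top_of_set (\<phi> ` U)) \<phi>" by simp_all
qed

lemma chart_inj: "(U, \<phi>) \<in> charts M \<Longrightarrow> inj_on \<phi> U"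
  using homeomorphic_imp_injective_map[OF chart_homeomorphism(3)]
    topspace_subtopology_subset[OF openin_subset[OF chart_homeomorphism(1)]]
  by metis

lemma chart_cover: "chart_cover M"
  unfolding chart_cover_def
proof (intro conjI ballI)
  show "case c of (U, \<phi>) \<Rightarrow> openin (mtop M) U \<and> inj_on \<phi> U" if "c \<in> charts M" for c
    using that chart_homeomorphism(1) chart_inj by (cases c) simp
  show "topspace (mtop M) \<subseteq> (\<Union>(U, \<phi>)\<in>charts M. U)"
    using smooth_manifold by (simp add: smooth_manifold_def)
qed

lemma smooth_transition:
  assumes "(U, \<phi>) \<in> charts M" "(W, \<psi>) \<in> charts M"
  shows "smooth_on (\<phi> ` (U \<inter> W)) (\<psi> \<circ> inv_into U \<phi>)"
proof -
  have "\<forall>(U, \<phi>)\<in>charts M. \<forall>(W, \<psi>)\<in>charts M. smooth_on (\<phi> ` (U \<inter> W)) (\<psi> \<circ> inv_into U \<phi>)"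
    using smooth_manifold by (simp add: smooth_manifold_def)
  from bspec[OF this assms(1)]
  have "\<forall>(W, \<psi>)\<in>charts M. smooth_on (\<phi> ` (U \<inter> W)) (\<psi> \<circ> inv_into U \<phi>)" by simp
  from bspec[OF this assms(2)] show ?thesis by simp
qed

text \<open>The image of a chart is open in the model space only.  Composing the inverse of the chart with a
  linear projection onto the model space gives a parametrisation that is defined on an open subset
  of the ambient space, where derivatives are available.\<close>

lemma chart_plot:
  assumes U: "(U, \<phi>) \<in> charts M"
  obtains D :: "'e set" and \<xi> where
    "openin (mtop M) U" "plot M D \<xi>" "\<xi> ` D \<subseteq> U" "inj_on \<phi> U"
    "\<And>q. q \<in> U \<Longrightarrow> \<phi> q \<in> D \<and> \<xi> (\<phi> q) = q"
    "\<And>S. open S \<Longrightarrow> openin (mtop M) {q \<in> U. \<phi> q \<in> S}"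
proof -
  have Uo: "inj_on \<phi> U" "openin (mtop M) U"
    by (rule chart_inj[OF U], rule chart_homeomorphism(1)[OF U])
  have V: "subspace (model M)" using smooth_manifold by (simp add: smooth_manifold_def)
  have \<phi>: "openin (top_of_set (model M)) (\<phi> ` U)"
    "homeomorphic_map (subtopology (mtop M) U) (top_of_set (\<phi> ` U)) \<phi>"
    by (rule chart_homeomorphism(2)[OF U], rule chart_homeomorphism(3)[OF U])
  obtain P :: "'e \<Rightarrow> 'e" where P: "range P \<subseteq> model M" "linear P" "\<And>v. v \<in> model M \<Longrightarrow> P v = v"
    using linear_exists_left_inverse_on[OF linear_id V] by (auto simp: inj_on_def)
  have PC: "Cinf UNIV P" using Cinf_linear[OF linear_conv_bounded_linear[THEN iffD1, OF P(2)] Cinf_ident] by auto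
  have Vs: "\<phi> ` U \<subseteq> model M" using openin_imp_subset[OF \<phi>(1)] .
  obtain A where A: "open A" "\<phi> ` U = model M \<inter> A" using \<phi>(1) by (auto simp: openin_open)
  have cont\<phi>: "continuous_map (subtopology (mtop M) U) euclidean \<phi>"
    using homeomorphic_imp_continuous_map[OF \<phi>(2)] continuous_map_in_subtopology by blast
  have tsU: "topspace (subtopology (mtop M) U) = U"
    using topspace_subtopology_subset[OF openin_subset[OF Uo(2)]] .
  have pre: "openin (mtop M) {q \<in> U. \<phi> q \<in> S}" if "open S" for S
  proof -
    have "{q \<in> U. \<phi> q \<in> S} = {q \<in> topspace (subtopology (mtop M) U). \<phi> q \<in> S}" by (simp only: tsU)
    then show ?thesis
      using openin_continuous_map_preimage[OF cont\<phi>, of S] that openin_open_subtopology[OF Uo(2)] by simp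
  qed
  define D where "D = P -` (\<phi> ` U)"
  define \<xi> where "\<xi> = (\<lambda>x. inv_into U \<phi> (P x))"
  have Pm: "P x \<in> model M" for x using P(1) by auto
  have D: "D = P -` A" unfolding D_def A(2) using Pm by auto
  have preP: "open (P -` T)" if "open T" for T
    by (rule open_vimage[OF that Cinf_continuous_on[OF PC]])
  have oD: "open D" unfolding D by (rule preP[OF A(1)])
  have \<xi>U: "\<xi> ` D \<subseteq> U"
  proof
    fix q assume "q \<in> \<xi> ` D"
    then obtain x where x: "q = inv_into U \<phi> (P x)" "P x \<in> \<phi> ` U" by (auto simp: D_def \<xi>_def)
    show "q \<in> U" unfolding x(1) by (rule inv_into_into[OF x(2)])
  qed
  have pl: "plot M D \<xi>"
    unfolding plot_def
  proof (intro conjI ballI allI impI)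
    show "open D" by (rule oD)
    show "\<xi> ` D \<subseteq> topspace (mtop M)"
      using openin_subset[OF Uo(2)] \<xi>U by blast
    have vim: "D \<inter> \<xi> -` W = P -` (\<phi> ` (U \<inter> W))" for W
    proof (intro equalityI subsetI)
      fix x assume "x \<in> D \<inter> \<xi> -` W"
      then have x: "P x \<in> \<phi> ` U" "\<xi> x \<in> U \<inter> W" using \<xi>U by (auto simp: D_def)
      then have "\<phi> (\<xi> x) = P x" unfolding \<xi>_def using f_inv_into_f[OF x(1)] by simp
      then show "x \<in> P -` (\<phi> ` (U \<inter> W))" using x(2) by (metis imageI vimageI2)
    next
      fix x assume "x \<in> P -` (\<phi> ` (U \<inter> W))"
      then obtain q where q: "q \<in> U" "q \<in> W" "P x = \<phi> q" by auto
      then show "x \<in> D \<inter> \<xi> -` W" using inv_into_f_f[OF Uo(1) q(1)] by (simp add: D_def \<xi>_def)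
    qed
    show op: "open (D \<inter> \<xi> -` W)" if W: "openin (mtop M) W" for W
    proof -
      have "openin (subtopology (mtop M) U) (U \<inter> W)"
        using W by (auto simp: openin_subtopology)
      then have "openin (top_of_set (\<phi> ` U)) (\<phi> ` (U \<inter> W))"
        using homeomorphic_map_openness[OF \<phi>(2), of "U \<inter> W"] tsU by auto
      then obtain B where B: "open B" "\<phi> ` (U \<inter> W) = \<phi> ` U \<inter> B" unfolding openin_open by auto
      have "D \<inter> \<xi> -` W = D \<inter> P -` B" unfolding vim B(2) by (auto simp: D_def)
      then show ?thesis using oD preP[OF B(1)] by auto
    qed
    fix c assume "c \<in> charts M"
    then obtain W \<psi> where W: "c = (W, \<psi>)" "(W, \<psi>) \<in> charts M" by (cases c) auto
    have Wo: "openin (mtop M) W" by (rule chart_homeomorphism(1)[OF W(2)])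
    have sm: "smooth_on (\<phi> ` (U \<inter> W)) (\<psi> \<circ> inv_into U \<phi>)"
      by (rule smooth_transition[OF U W(2)])
    have "Cinf (D \<inter> \<xi> -` W) (\<lambda>x. (\<psi> \<circ> inv_into U \<phi>) (P x))"
      by (rule smooth_on_compose[OF sm Cinf_subset[OF PC op[OF Wo]]]) (auto simp: vim)
    then show "case c of (W, \<psi>) \<Rightarrow> Cinf (D \<inter> \<xi> -` W) (\<lambda>x. \<psi> (\<xi> x))"
      by (simp add: W(1) \<xi>_def)
  qed
  show thesis
  proof (rule that[of D \<xi>])
    show "openin (mtop M) U" "plot M D \<xi>" "inj_on \<phi> U" using Uo pl by simp_all
    show "openin (mtop M) {q \<in> U. \<phi> q \<in> S}" if "open S" for S by (rule pre[OF that])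
    show "\<xi> ` D \<subseteq> U" by (rule \<xi>U)
    show "\<phi> q \<in> D \<and> \<xi> (\<phi> q) = q" if "q \<in> U" for q
      using inv_into_f_f[OF Uo(1) that] subsetD[OF Vs imageI[OF that]] P(3)[of "\<phi> q"] that
      by (simp add: D_def \<xi>_def)
  qed
qed

lemma chart_at:
  assumes "p \<in> topspace (mtop M)"
  obtains U \<phi> and D :: "'e set" and \<xi> where
    "(U, \<phi>) \<in> charts M" "p \<in> U" "openin (mtop M) U" "plot M D \<xi>" "\<xi> ` D \<subseteq> U" "inj_on \<phi> U"
    "\<And>q. q \<in> U \<Longrightarrow> \<phi> q \<in> D \<and> \<xi> (\<phi> q) = q"
    "\<And>S. open S \<Longrightarrow> openin (mtop M) {q \<in> U. \<phi> q \<in> S}"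
proof -
  obtain U \<phi> where U: "(U, \<phi>) \<in> charts M" "p \<in> U"
    by (rule chart_coverE[OF chart_cover assms]) (rule that)
  show thesis by (rule chart_plot[OF U(1)]) (rule that[OF U])
qed

lemma smooth_fun_on_plot:
  assumes "smooth_fun_on M W f" "plot M D \<xi>"
  shows "Cinf (D \<inter> \<xi> -` W) (\<lambda>x. f (\<xi> x))"
proof -
  have W: "openin (mtop M) W" and f: "smooth_map (open_submanifold M W) real_line f"
    using assms(1) by (auto simp: smooth_fun_on_def)
  from smooth_map_plot[OF f chart_cover_open_submanifold[OF chart_cover W] chart_cover_real_line
      plot_open_submanifold[OF assms(2) W]]
  show ?thesis by (simp add: plot_real_line)
qed

text \<open>Functions can be tested on plots whose domain lies in the ambient Euclidean space \<open>'e\<close>, because the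
  parametrisations of \<open>chart_plot\<close> are of this kind.\<close>

lemma smooth_fun_on_iff:
  "smooth_fun_on M W f \<longleftrightarrow> openin (mtop M) W \<and>
     (\<forall>D (\<xi>::'e \<Rightarrow> 'a). plot M D \<xi> \<longrightarrow> Cinf (D \<inter> \<xi> -` W) (\<lambda>x. f (\<xi> x)))" (is "?L \<longleftrightarrow> ?R")
proof
  assume ?L
  then show ?R using smooth_fun_on_plot by (auto simp: smooth_fun_on_def)
next
  assume ?R
  then have W: "openin (mtop M) W"
    and f: "\<And>D (\<xi>::'e \<Rightarrow> 'a). plot M D \<xi> \<Longrightarrow> Cinf (D \<inter> \<xi> -` W) (\<lambda>x. f (\<xi> x))" by auto
  have "openin (subtopology (mtop M) W) {p \<in> topspace (mtop M). p \<in> W \<and> f p \<in> B}" if B: "open B" for B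
  proof -
    have "openin (mtop M) {p \<in> W. f p \<in> B}"
    proof (subst openin_subopen, intro ballI)
      fix p assume p: "p \<in> {p \<in> W. f p \<in> B}"
      then have pM: "p \<in> topspace (mtop M)" using openin_subset[OF W] by auto
      obtain U \<phi> and D :: "'e set" and \<xi> where c: "p \<in> U" "openin (mtop M) U" "plot M D \<xi>"
        "\<And>q. q \<in> U \<Longrightarrow> \<phi> q \<in> D \<and> \<xi> (\<phi> q) = q"
        "\<And>S. open S \<Longrightarrow> openin (mtop M) {q \<in> U. \<phi> q \<in> S}"
        by (rule chart_at[OF pM]) (rule that)
      have "open ((D \<inter> \<xi> -` W) \<inter> (\<lambda>x. f (\<xi> x)) -` B)"
        by (rule Cinf_open_preimage[OF f[OF c(3)] B])
      from c(5)[OF this] c(1,4) p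
      show "\<exists>T. openin (mtop M) T \<and> p \<in> T \<and> T \<subseteq> {p \<in> W. f p \<in> B}"
        by (intro exI[of _ "{q \<in> U. \<phi> q \<in> D \<inter> \<xi> -` W \<inter> (\<lambda>x. f (\<xi> x)) -` B}"]) auto
    qed
    moreover have "{p \<in> topspace (mtop M). p \<in> W \<and> f p \<in> B} = {p \<in> W. f p \<in> B}"
      using openin_subset[OF W] by auto
    ultimately show ?thesis by (simp add: openin_open_subtopology[OF W])
  qed
  moreover have "smooth_on (\<phi> ` (U \<inter> W)) (f \<circ> inv_into (U \<inter> W) \<phi>)" if U: "(U, \<phi>) \<in> charts M" for U \<phi>
  proof -
    obtain D :: "'e set" and \<xi> where c: "plot M D \<xi>" "inj_on \<phi> U" "\<And>q. q \<in> U \<Longrightarrow> \<phi> q \<in> D \<and> \<xi> (\<phi> q) = q"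
      by (rule chart_plot[OF U]) (rule that)
    have inj: "inj_on \<phi> (U \<inter> W)" using c(2) by (rule inj_on_subset) auto
    show ?thesis
    proof (rule Cinf_smooth_on[OF f[OF c(1)]])
      show "\<phi> ` (U \<inter> W) \<subseteq> D \<inter> \<xi> -` W" using c(3) by auto
      fix x assume "x \<in> \<phi> ` (U \<inter> W)"
      then obtain q where q: "q \<in> U \<inter> W" "x = \<phi> q" by auto
      then show "f (\<xi> x) = (f \<circ> inv_into (U \<inter> W) \<phi>) x"
        using c(3)[of q] inv_into_f_f[OF inj q(1)] by simp
    qed
  qed
  moreover have "charts (open_submanifold M W) = {(U \<inter> W, \<phi>) | U \<phi>. (U, \<phi>) \<in> charts M}"
    "mtop (open_submanifold M W) = subtopology (mtop M) W"
    by (simp_all add: open_submanifold_def)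
  ultimately show ?L
    using W openin_subset[OF W]
    by (auto simp: smooth_fun_on_def smooth_map_def real_line_def continuous_map_def
        topspace_subtopology_subset comp_def)
qed

end


text \<open>The image of the vector \<open>w\<close> at \<open>x\<close> under the differential of \<open>\<xi>\<close>, acting as a derivation.  The value 0 at
  other functions matches the convention for velocities.\<close>

definition push ::
  "('a, 'e::euclidean_space) manifold_data \<Rightarrow> ('d::euclidean_space \<Rightarrow> 'a) \<Rightarrow> 'd \<Rightarrow> 'd \<Rightarrow> 'a tvec" where
  "push M \<xi> x w = (\<lambda>f. if smooth_near M (\<xi> x) f then fd (\<lambda>y. f (\<xi> y)) x w else 0)"

context manifold
begin

lemma smooth_fun_onI:
  assumes "openin (mtop M) W"
    "\<And>D (\<xi>::'e \<Rightarrow> 'a). plot M D \<xi> \<Longrightarrow> Cinf (D \<inter> \<xi> -` W) (\<lambda>x. f (\<xi> x))"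
  shows "smooth_fun_on M W f"
  unfolding smooth_fun_on_iff using assms(1) by (intro conjI allI impI assms(2))

lemma smooth_fun_on_openin: "smooth_fun_on M W f \<Longrightarrow> openin (mtop M) W"
  by (simp add: smooth_fun_on_def)

lemma smooth_fun_on_subset:
  assumes "smooth_fun_on M W f" "openin (mtop M) V" "V \<subseteq> W"
  shows "smooth_fun_on M V f"
proof (rule smooth_fun_onI[OF assms(2)])
  fix D and \<xi> :: "'e \<Rightarrow> 'a" assume \<xi>: "plot M D \<xi>"
  show "Cinf (D \<inter> \<xi> -` V) (\<lambda>x. f (\<xi> x))"
    by (rule Cinf_subset[OF smooth_fun_on_plot[OF assms(1) \<xi>] plot_open_preimage[OF \<xi> assms(2)]])
      (use assms(3) in auto)
qed

lemma smooth_fun_on_cong: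
  assumes "smooth_fun_on M W f" "\<And>p. p \<in> W \<Longrightarrow> f p = g p"
  shows "smooth_fun_on M W g"
proof (rule smooth_fun_onI[OF smooth_fun_on_openin[OF assms(1)]])
  fix D and \<xi> :: "'e \<Rightarrow> 'a" assume \<xi>: "plot M D \<xi>"
  show "Cinf (D \<inter> \<xi> -` W) (\<lambda>x. g (\<xi> x))"
    by (rule Cinf_cong[OF smooth_fun_on_plot[OF assms(1) \<xi>]]) (use assms(2) in auto)
qed

lemma smooth_fun_on_const: "openin (mtop M) W \<Longrightarrow> smooth_fun_on M W (\<lambda>p. c)"
  by (rule smooth_fun_onI, assumption, rule Cinf_const, rule plot_open_preimage)

lemma smooth_fun_on_add:
  assumes "smooth_fun_on M W f" "smooth_fun_on M W g"
  shows "smooth_fun_on M W (\<lambda>p. f p + g p)"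
  by (rule smooth_fun_onI[OF smooth_fun_on_openin[OF assms(1)]])
    (rule Cinf_add[OF smooth_fun_on_plot[OF assms(1)] smooth_fun_on_plot[OF assms(2)]])

lemma smooth_fun_on_mult:
  assumes "smooth_fun_on M W f" "smooth_fun_on M W g"
  shows "smooth_fun_on M W (\<lambda>p. f p * g p)"
  by (rule smooth_fun_onI[OF smooth_fun_on_openin[OF assms(1)]])
    (rule Cinf_mult[OF smooth_fun_on_plot[OF assms(1)] smooth_fun_on_plot[OF assms(2)]])

lemma smooth_fun_on_diff:
  assumes "smooth_fun_on M W f" "smooth_fun_on M W g"
  shows "smooth_fun_on M W (\<lambda>p. f p - g p)"
  using smooth_fun_on_add[OF assms(1) smooth_fun_on_mult[OF
        smooth_fun_on_const[OF smooth_fun_on_openin[OF assms(1)], of "-1"] assms(2)]] by simp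

lemma smooth_fun_on_sum:
  assumes "openin (mtop M) W" "\<And>i. i \<in> I \<Longrightarrow> smooth_fun_on M W (f i)"
  shows "smooth_fun_on M W (\<lambda>p. \<Sum>i\<in>I. f i p)"
  using assms(2)
proof (induction I rule: infinite_finite_induct)
  case (insert i I)
  have "smooth_fun_on M W (\<lambda>p. f i p + (\<Sum>i\<in>I. f i p))"
    by (rule smooth_fun_on_add[OF insert.prems[OF insertI1] insert.IH[OF insert.prems[OF insertI2]]])
  then show ?case using insert(1,2) by simp
qed (simp_all add: smooth_fun_on_const assms(1))

lemma smooth_near_common:
  assumes "smooth_near M p f" "smooth_near M p g"
  obtains W where "p \<in> W" "smooth_fun_on M W f" "smooth_fun_on M W g"
proof -
  obtain V W where V: "p \<in> V" "smooth_fun_on M V f" and W: "p \<in> W" "smooth_fun_on M W g"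
    using assms unfolding smooth_near_def by auto
  have o: "openin (mtop M) (V \<inter> W)"
    by (rule openin_Int[OF smooth_fun_on_openin[OF V(2)] smooth_fun_on_openin[OF W(2)]])
  show thesis
    by (rule that[of "V \<inter> W"]) (use V W smooth_fun_on_subset[OF _ o] in auto)
qed

lemma smooth_near_cong:
  assumes "openin (mtop M) W" "p \<in> W" "\<And>q. q \<in> W \<Longrightarrow> f q = g q" "smooth_near M p f"
  shows "smooth_near M p g"
proof -
  obtain V where V: "p \<in> V" "smooth_fun_on M V f" using assms(4) unfolding smooth_near_def by auto
  have o: "openin (mtop M) (V \<inter> W)"
    by (rule openin_Int[OF smooth_fun_on_openin[OF V(2)] assms(1)])
  have "smooth_fun_on M (V \<inter> W) f" by (rule smooth_fun_on_subset[OF V(2) o]) auto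
  then have "smooth_fun_on M (V \<inter> W) g" by (rule smooth_fun_on_cong) (use assms(3) in auto)
  then show ?thesis using V(1) assms(2) unfolding smooth_near_def by auto
qed

lemma smooth_near_add:
  assumes "smooth_near M p f" "smooth_near M p g"
  shows "smooth_near M p (\<lambda>q. f q + g q)"
proof -
  obtain W where W: "p \<in> W" "smooth_fun_on M W f" "smooth_fun_on M W g"
    by (rule smooth_near_common[OF assms]) (rule that)
  show ?thesis using W(1) smooth_fun_on_add[OF W(2,3)] unfolding smooth_near_def by blast
qed

lemma smooth_near_mult:
  assumes "smooth_near M p f" "smooth_near M p g"
  shows "smooth_near M p (\<lambda>q. f q * g q)"
proof -
  obtain W where W: "p \<in> W" "smooth_fun_on M W f" "smooth_fun_on M W g"
    by (rule smooth_near_common[OF assms]) (rule that)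
  show ?thesis using W(1) smooth_fun_on_mult[OF W(2,3)] unfolding smooth_near_def by blast
qed

lemma smooth_near_const: "p \<in> topspace (mtop M) \<Longrightarrow> smooth_near M p (\<lambda>q. c)"
  unfolding smooth_near_def using smooth_fun_on_const[OF openin_topspace] by blast

lemma smooth_near_sum:
  assumes "p \<in> topspace (mtop M)" "\<And>i. i \<in> I \<Longrightarrow> smooth_near M p (f i)"
  shows "smooth_near M p (\<lambda>q. \<Sum>i\<in>I. f i q)"
  using assms(2)
proof (induction I rule: infinite_finite_induct)
  case (insert i I)
  have "smooth_near M p (\<lambda>q. f i q + (\<Sum>i\<in>I. f i q))"
    by (rule smooth_near_add[OF insert.prems[OF insertI1] insert.IH[OF insert.prems[OF insertI2]]])
  then show ?case using insert(1,2) by simp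
qed (simp_all add: smooth_near_const assms(1))


section \<open>Tangent vectors as derivatives along plots\<close>

lemma smooth_near_plot:
  assumes "plot M D \<xi>" "x \<in> D" "smooth_near M (\<xi> x) f"
  obtains S where "x \<in> S" "S \<subseteq> D" "Cinf S (\<lambda>y. f (\<xi> y))"
proof -
  obtain W where W: "\<xi> x \<in> W" "smooth_fun_on M W f" using assms(3) unfolding smooth_near_def by auto
  show thesis
    by (rule that[of "D \<inter> \<xi> -` W"]) (use W(1) assms(2) smooth_fun_on_plot[OF W(2) assms(1)] in auto)
qed

lemma push_cong:
  assumes "open S" "x \<in> S" "\<And>y. y \<in> S \<Longrightarrow> \<xi> y = \<eta> y"
  shows "push M \<xi> x = push M \<eta> x"
proof -
  have "fd (\<lambda>y. f (\<xi> y)) x = fd (\<lambda>y. f (\<eta> y)) x" for f :: "'a \<Rightarrow> real"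
    by (rule fd_cong[OF assms(1,2)]) (simp add: assms(3))
  then show ?thesis using assms(3)[OF assms(2)] by (simp add: push_def fun_eq_iff)
qed

lemma push_compose:
  assumes \<xi>: "plot M D \<xi>" and h: "Cinf S h" "h x \<in> D" "x \<in> S"
  shows "push M (\<lambda>y. \<xi> (h y)) x w = push M \<xi> (h x) (fd h x w)"
proof
  fix f
  show "push M (\<lambda>y. \<xi> (h y)) x w f = push M \<xi> (h x) (fd h x w) f"
  proof (cases "smooth_near M (\<xi> (h x)) f")
    case True
    obtain T where T: "h x \<in> T" "Cinf T (\<lambda>y. f (\<xi> y))"
      by (rule smooth_near_plot[OF \<xi> h(2) True]) (rule that)
    show ?thesis using True fd_compose[OF T(2) h(1) T(1) h(3)] by (simp add: push_def)
  qed (simp add: push_def)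
qed

lemma push_linear:
  assumes \<xi>: "plot M D \<xi>" and x: "x \<in> D"
  shows "push M \<xi> x (a *\<^sub>R v + b *\<^sub>R w) = (\<lambda>f. a * push M \<xi> x v f + b * push M \<xi> x w f)"
proof
  fix f
  show "push M \<xi> x (a *\<^sub>R v + b *\<^sub>R w) f = a * push M \<xi> x v f + b * push M \<xi> x w f"
  proof (cases "smooth_near M (\<xi> x) f")
    case True
    obtain T where T: "x \<in> T" "Cinf T (\<lambda>y. f (\<xi> y))"
      by (rule smooth_near_plot[OF \<xi> x True]) (rule that)
    note lin = Cinf_linear_fd[OF T(2,1)]
    show ?thesis using True linear_add[OF lin] linear_scale[OF lin] by (simp add: push_def)
  qed (simp add: push_def)
qed

lemma velocity_eq_push:
  assumes \<alpha>: "plot M I \<alpha>" and I: "0 \<in> I"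
  shows "velocity M \<alpha> = push M \<alpha> 0 1"
proof
  fix f
  show "velocity M \<alpha> f = push M \<alpha> 0 1 f"
  proof (cases "smooth_near M (\<alpha> 0) f")
    case True
    obtain T where T: "0 \<in> T" "Cinf T (\<lambda>y. f (\<alpha> y))"
      by (rule smooth_near_plot[OF \<alpha> I True]) (rule that)
    have "fd (\<lambda>y. f (\<alpha> y)) 0 t = fd (\<lambda>y. f (\<alpha> y)) 0 1 * t" for t
      using linear_scale[OF Cinf_linear_fd[OF T(2,1)], of t 1] by simp
    then have eq: "fd (\<lambda>y. f (\<alpha> y)) 0 = (*) (fd (\<lambda>y. f (\<alpha> y)) 0 1)" by (rule ext)
    have "((\<lambda>y. f (\<alpha> y)) has_real_derivative fd (\<lambda>y. f (\<alpha> y)) 0 1) (at 0)"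
      unfolding has_field_derivative_def by (subst eq[symmetric], rule Cinf_has_derivative[OF T(2,1)])
    then show ?thesis using True DERIV_imp_deriv by (simp add: push_def velocity_def)
  qed (simp add: push_def velocity_def)
qed

text \<open>The vector is the velocity of the image of a straight line.\<close>

lemma push_in_tangent_space:
  assumes \<xi>: "plot M D \<xi>" and x: "x \<in> D"
  shows "push M \<xi> x w \<in> tangent_space M (\<xi> x)"
proof -
  define h where "h = (\<lambda>t::real. x + t *\<^sub>R w)"
  have h: "(h has_derivative (\<lambda>t. t *\<^sub>R w)) (at t)" for t
    unfolding h_def
    using has_derivative_add[OF has_derivative_const[of x "at t"]
        has_derivative_scaleR_left[OF has_derivative_ident[of "at t"], of w]] by simp
  have hC: "Cinf UNIV h"
    unfolding h_def
    by (rule Cinf_add[OF Cinf_const Cinf_linear[OF bounded_linear_scaleR_left Cinf_ident]]) auto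
  have "open (h -` D)" using Cinf_open_preimage[OF hC plot_open[OF \<xi>]] by simp
  moreover have "0 \<in> h -` D" using x by (simp add: h_def)
  ultimately obtain e where e: "e > 0" "ball 0 e \<subseteq> h -` D" by (rule openE)
  have I: "{-e<..<e} = ball 0 e" by (simp add: ball_eq_greaterThanLessThan)
  have hI: "Cinf {-e<..<e} h" by (rule Cinf_subset[OF hC]) auto
  have pl: "plot M {-e<..<e} (\<lambda>t. \<xi> (h t))"
    by (rule plot_compose[OF \<xi> hI]) (use e I in auto)
  have "velocity M (\<lambda>t. \<xi> (h t)) = push M (\<lambda>t. \<xi> (h t)) 0 1"
    by (rule velocity_eq_push[OF pl]) (use e in auto)
  also have "\<dots> = push M \<xi> (h 0) (fd h 0 1)"
    by (rule push_compose[OF \<xi> hC]) (use x in \<open>auto simp: h_def\<close>)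
  also have "\<dots> = push M \<xi> x w" using fd_eqI[OF h, of 0] by (simp add: h_def)
  finally have eq: "push M \<xi> x w = velocity M (\<lambda>t. \<xi> (h t))" by simp
  have "h 0 = x" by (simp add: h_def)
  then show ?thesis
    unfolding tangent_space_def eq using plot_smooth_curve[OF pl] e(1) by auto
qed

lemma tangent_spaceE:
  assumes "u \<in> tangent_space M p"
  obtains I and \<alpha> :: "real \<Rightarrow> 'a" where "plot M I \<alpha>" "0 \<in> I" "\<alpha> 0 = p" "u = push M \<alpha> 0 1"
proof -
  obtain \<alpha> e where a: "u = velocity M \<alpha>" "e > 0"
    "smooth_map (open_submanifold real_line {-e<..<e}) M \<alpha>" "\<alpha> 0 = p"
    using assms unfolding tangent_space_def by auto
  have pl: "plot M {-e<..<e} \<alpha>" by (rule smooth_curve_plot[OF a(3) _ chart_cover]) simp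
  show thesis
    by (rule that[OF pl _ a(4)]) (use a(1,2) velocity_eq_push[OF pl] in auto)
qed

lemma tangent_space_topspace:
  assumes u: "u \<in> tangent_space M p" shows "p \<in> topspace (mtop M)"
proof -
  obtain I and \<alpha> :: "real \<Rightarrow> 'a" where a: "plot M I \<alpha>" "0 \<in> I" "\<alpha> 0 = p"
    by (rule tangent_spaceE[OF u]) (rule that)
  show ?thesis using plot_in_topspace[OF a(1,2)] a(3) by simp
qed

text \<open>Together with \<open>push_in_tangent_space\<close> this makes the tangent space the image of \<open>'e\<close> under a linear map.
  Distinct \<open>w\<close> may give the same tangent vector, since directions transversal to the model space are
  projected away.\<close>

lemma tangent_space_chart:
  assumes u: "u \<in> tangent_space M p" and U: "(U, \<phi>) \<in> charts M" "p \<in> U"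
    and \<xi>: "plot M D \<xi>" "\<And>q. q \<in> U \<Longrightarrow> \<phi> q \<in> D \<and> \<xi> (\<phi> q) = q"
  shows "\<exists>w. u = push M \<xi> (\<phi> p) w"
proof -
  obtain I and \<alpha> :: "real \<Rightarrow> 'a" where a: "plot M I \<alpha>" "0 \<in> I" "\<alpha> 0 = p" "u = push M \<alpha> 0 1"
    by (rule tangent_spaceE[OF u]) (rule that)
  let ?J = "I \<inter> \<alpha> -` U"
  have C: "Cinf ?J (\<lambda>t. \<phi> (\<alpha> t))" by (rule plot_Cinf[OF a(1) U(1)])
  have "u = push M (\<lambda>t. \<xi> (\<phi> (\<alpha> t))) 0 1"
    unfolding a(4) by (rule fun_cong[OF push_cong[OF Cinf_open[OF C]]]) (use a U \<xi>(2) in auto)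
  also have "\<dots> = push M \<xi> (\<phi> (\<alpha> 0)) (fd (\<lambda>t. \<phi> (\<alpha> t)) 0 1)"
    by (rule push_compose[OF \<xi>(1) C]) (use a U \<xi>(2) in auto)
  finally show ?thesis using a(3) by auto
qed

lemma tangent_space_linear:
  assumes "u \<in> tangent_space M p" "v \<in> tangent_space M p"
  shows "(\<lambda>f. a * u f + b * v f) \<in> tangent_space M p"
proof -
  obtain U \<phi> and D :: "'e set" and \<xi> where c: "(U, \<phi>) \<in> charts M" "p \<in> U" "plot M D \<xi>"
    "\<And>q. q \<in> U \<Longrightarrow> \<phi> q \<in> D \<and> \<xi> (\<phi> q) = q"
    by (rule chart_at[OF tangent_space_topspace[OF assms(1)]]) (rule that)
  obtain w where w: "u = push M \<xi> (\<phi> p) w" using tangent_space_chart[OF assms(1) c] by auto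
  obtain w' where w': "v = push M \<xi> (\<phi> p) w'" using tangent_space_chart[OF assms(2) c] by auto
  have D: "\<phi> p \<in> D" and eq: "\<xi> (\<phi> p) = p" using c(4)[OF c(2)] by auto
  show ?thesis
    using push_in_tangent_space[OF c(3) D, of "a *\<^sub>R w + b *\<^sub>R w'"]
    unfolding push_linear[OF c(3) D] eq w w' .
qed

lemma tangent_nonsmooth:
  assumes u: "u \<in> tangent_space M p" and f: "\<not> smooth_near M p f" shows "u f = 0"
proof -
  obtain \<alpha> where a: "\<alpha> 0 = p" "u = push M \<alpha> 0 (1::real)"
    by (rule tangent_spaceE[OF u]) (rule that)
  show ?thesis unfolding a(2) push_def using a(1) f by simp
qed

lemma tangent_cong:
  assumes u: "u \<in> tangent_space M p" and W: "openin (mtop M) W" "p \<in> W"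
    and eq: "\<And>q. q \<in> W \<Longrightarrow> f q = g q"
  shows "u f = u g"
proof -
  obtain I and \<alpha> :: "real \<Rightarrow> 'a" where a: "plot M I \<alpha>" "0 \<in> I" "\<alpha> 0 = p" "u = push M \<alpha> 0 1"
    by (rule tangent_spaceE[OF u]) (rule that)
  have "fd (\<lambda>t. f (\<alpha> t)) 0 = fd (\<lambda>t. g (\<alpha> t)) 0"
    by (rule fd_cong[OF plot_open_preimage[OF a(1) W(1)]]) (use a W eq in auto)
  moreover have "smooth_near M p f \<longleftrightarrow> smooth_near M p g"
    using smooth_near_cong[OF W, of f g] smooth_near_cong[OF W, of g f] eq by auto
  ultimately show ?thesis using a by (simp add: push_def)
qed

lemma tangent_const:
  assumes u: "u \<in> tangent_space M p" shows "u (\<lambda>q. c) = 0"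
proof -
  obtain \<alpha> where a: "\<alpha> 0 = p" "u = push M \<alpha> 0 (1::real)"
    by (rule tangent_spaceE[OF u]) (rule that)
  show ?thesis unfolding a(2) push_def by simp
qed

lemma tangent_add:
  assumes u: "u \<in> tangent_space M p" and f: "smooth_near M p f" "smooth_near M p g"
  shows "u (\<lambda>q. f q + g q) = u f + u g"
proof -
  obtain I and \<alpha> :: "real \<Rightarrow> 'a" where a: "plot M I \<alpha>" "0 \<in> I" "\<alpha> 0 = p" "u = push M \<alpha> 0 1"
    by (rule tangent_spaceE[OF u]) (rule that)
  obtain S where S: "0 \<in> S" "Cinf S (\<lambda>t. f (\<alpha> t))"
    by (rule smooth_near_plot[OF a(1,2) f(1)[folded a(3)]]) (rule that)
  obtain T where T: "0 \<in> T" "Cinf T (\<lambda>t. g (\<alpha> t))"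
    by (rule smooth_near_plot[OF a(1,2) f(2)[folded a(3)]]) (rule that)
  show ?thesis
    using fd_eqI[OF has_derivative_add[OF Cinf_has_derivative[OF S(2,1)] Cinf_has_derivative[OF T(2,1)]]]
      smooth_near_add[OF f] f a by (simp add: push_def)
qed

lemma tangent_mult:
  assumes u: "u \<in> tangent_space M p" and f: "smooth_near M p f" "smooth_near M p g"
  shows "u (\<lambda>q. f q * g q) = u f * g p + f p * u g"
proof -
  obtain I and \<alpha> :: "real \<Rightarrow> 'a" where a: "plot M I \<alpha>" "0 \<in> I" "\<alpha> 0 = p" "u = push M \<alpha> 0 1"
    by (rule tangent_spaceE[OF u]) (rule that)
  obtain S where S: "0 \<in> S" "Cinf S (\<lambda>t. f (\<alpha> t))"
    by (rule smooth_near_plot[OF a(1,2) f(1)[folded a(3)]]) (rule that)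
  obtain T where T: "0 \<in> T" "Cinf T (\<lambda>t. g (\<alpha> t))"
    by (rule smooth_near_plot[OF a(1,2) f(2)[folded a(3)]]) (rule that)
  show ?thesis
    using fd_eqI[OF has_derivative_mult[OF Cinf_has_derivative[OF S(2,1)] Cinf_has_derivative[OF T(2,1)]]]
      smooth_near_mult[OF f] f a by (simp add: push_def)
qed

lemma tangent_sum:
  assumes u: "u \<in> tangent_space M p" and f: "\<And>i. i \<in> I \<Longrightarrow> smooth_near M p (f i)"
  shows "u (\<lambda>q. \<Sum>i\<in>I. f i q) = (\<Sum>i\<in>I. u (f i))"
  using f
proof (induction I rule: infinite_finite_induct)
  case (insert i I)
  have "u (\<lambda>q. f i q + (\<Sum>i\<in>I. f i q)) = u (f i) + u (\<lambda>q. \<Sum>i\<in>I. f i q)"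
    by (rule tangent_add[OF u _ smooth_near_sum[OF tangent_space_topspace[OF u]]]) (use insert in auto)
  then show ?case using insert by simp
qed (simp_all add: tangent_const[OF u])


text \<open>Smoothness of a self-map, in the form that follows for group operations from the closure
  properties of plots.\<close>

definition plot_map :: "('a \<Rightarrow> 'a) \<Rightarrow> bool" where
  "plot_map F \<longleftrightarrow> (\<forall>D (\<xi>::'e \<Rightarrow> 'a). plot M D \<xi> \<longrightarrow> plot M D (\<lambda>x. F (\<xi> x)))"

lemma plot_map_plot: "plot_map F \<Longrightarrow> plot M D (\<xi>::'e \<Rightarrow> 'a) \<Longrightarrow> plot M D (\<lambda>x. F (\<xi> x))"
  by (simp add: plot_map_def)

lemma plot_map_open_preimage:
  assumes F: "plot_map F" and W: "openin (mtop M) W"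
  shows "openin (mtop M) {q \<in> topspace (mtop M). F q \<in> W}"
proof (subst openin_subopen, intro ballI)
  fix p assume p: "p \<in> {q \<in> topspace (mtop M). F q \<in> W}"
  then have pM: "p \<in> topspace (mtop M)" by simp
  obtain U \<phi> and D :: "'e set" and \<xi> where c: "p \<in> U" "openin (mtop M) U" "plot M D \<xi>"
    "\<And>q. q \<in> U \<Longrightarrow> \<phi> q \<in> D \<and> \<xi> (\<phi> q) = q"
    "\<And>S. open S \<Longrightarrow> openin (mtop M) {q \<in> U. \<phi> q \<in> S}"
    by (rule chart_at[OF pM]) (rule that)
  let ?T = "{q \<in> U. \<phi> q \<in> D \<inter> (\<lambda>x. F (\<xi> x)) -` W}"
  have "openin (mtop M) ?T"
    by (rule c(5)[OF plot_open_preimage[OF plot_map_plot[OF F c(3)] W]])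
  moreover have "p \<in> ?T" using p c(1,4) by simp
  moreover have "?T \<subseteq> {q \<in> topspace (mtop M). F q \<in> W}"
    using c(4) openin_subset[OF c(2)] by auto
  ultimately show "\<exists>T. openin (mtop M) T \<and> p \<in> T \<and> T \<subseteq> {q \<in> topspace (mtop M). F q \<in> W}" by blast
qed

lemma smooth_fun_on_pullback:
  assumes F: "plot_map F" and f: "smooth_fun_on M W f"
  shows "smooth_fun_on M {q \<in> topspace (mtop M). F q \<in> W} (\<lambda>q. f (F q))"
proof (rule smooth_fun_onI[OF plot_map_open_preimage[OF F smooth_fun_on_openin[OF f]]])
  fix D and \<xi> :: "'e \<Rightarrow> 'a" assume \<xi>: "plot M D \<xi>"
  have "D \<inter> \<xi> -` {q \<in> topspace (mtop M). F q \<in> W} = D \<inter> (\<lambda>x. F (\<xi> x)) -` W"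
    using plot_in_topspace[OF \<xi>] by auto
  then show "Cinf (D \<inter> \<xi> -` {q \<in> topspace (mtop M). F q \<in> W}) (\<lambda>x. f (F (\<xi> x)))"
    using smooth_fun_on_plot[OF f plot_map_plot[OF F \<xi>]] by simp
qed

lemma smooth_near_pullback:
  assumes F: "plot_map F" and f: "smooth_near M (F p) f" and p: "p \<in> topspace (mtop M)"
  shows "smooth_near M p (\<lambda>q. f (F q))"
proof -
  obtain W where W: "F p \<in> W" "smooth_fun_on M W f" using f unfolding smooth_near_def by auto
  show ?thesis unfolding smooth_near_def
    by (rule exI[of _ "{q \<in> topspace (mtop M). F q \<in> W}"])
      (use smooth_fun_on_pullback[OF F W(2)] W(1) p in simp)
qed


section \<open>Functions with vanishing derivative\<close>

lemma locally_constant: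
  assumes f: "smooth_fun_on M W f" and zero: "\<And>q u. q \<in> W \<Longrightarrow> u \<in> tangent_space M q \<Longrightarrow> u f = 0"
    and p: "p \<in> W"
  shows "\<exists>V. openin (mtop M) V \<and> p \<in> V \<and> (\<forall>q\<in>V. f q = f p)"
proof -
  have pM: "p \<in> topspace (mtop M)" using openin_subset[OF smooth_fun_on_openin[OF f]] p by auto
  obtain U \<phi> and D :: "'e set" and \<xi> where c: "(U, \<phi>) \<in> charts M" "p \<in> U" "plot M D \<xi>"
    "\<And>q. q \<in> U \<Longrightarrow> \<phi> q \<in> D \<and> \<xi> (\<phi> q) = q"
    "\<And>S. open S \<Longrightarrow> openin (mtop M) {q \<in> U. \<phi> q \<in> S}"
    by (rule chart_at[OF pM]) (rule that)
  let ?S = "D \<inter> \<xi> -` W"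
  have C: "Cinf ?S (\<lambda>x. f (\<xi> x))" by (rule smooth_fun_on_plot[OF f c(3)])
  have "\<phi> p \<in> ?S" using c(4)[OF c(2)] p by simp
  then obtain e where e: "e > 0" "ball (\<phi> p) e \<subseteq> ?S" using Cinf_open[OF C] by (elim openE) auto
  have "((\<lambda>x. f (\<xi> x)) has_derivative (\<lambda>h. 0)) (at x within ball (\<phi> p) e)" if "x \<in> ball (\<phi> p) e" for x
  proof -
    have x: "x \<in> ?S" using e that by auto
    then have "push M \<xi> x w f = 0" for w
      using push_in_tangent_space[OF c(3), of x] zero[of "\<xi> x"] by auto
    moreover have "smooth_near M (\<xi> x) f" unfolding smooth_near_def using f x by auto
    ultimately have "fd (\<lambda>x. f (\<xi> x)) x w = 0" for w by (simp add: push_def)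
    then have "fd (\<lambda>x. f (\<xi> x)) x = (\<lambda>h. 0)" by auto
    then show ?thesis using Cinf_has_derivative[OF C x] has_derivative_at_withinI by metis
  qed
  then obtain k where k: "\<And>x. x \<in> ball (\<phi> p) e \<Longrightarrow> f (\<xi> x) = k"
    using has_derivative_zero_constant[OF convex_ball] by metis
  have "f q = f p" if "q \<in> {q \<in> U. \<phi> q \<in> ball (\<phi> p) e}" for q
    using k[of "\<phi> q"] k[of "\<phi> p"] c(4)[OF c(2)] c(4)[of q] that e(1) by simp
  moreover have "openin (mtop M) {q \<in> U. \<phi> q \<in> ball (\<phi> p) e}" by (rule c(5)[OF open_ball])
  moreover have "p \<in> {q \<in> U. \<phi> q \<in> ball (\<phi> p) e}" using c(2) e(1) by simp
  ultimately show ?thesis by blast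
qed

lemma smooth_fun_on_coordinate:
  assumes "(U, \<phi>) \<in> charts M"
  shows "smooth_fun_on M U (\<lambda>q. \<phi> q \<bullet> b)"
  by (rule smooth_fun_onI[OF chart_homeomorphism(1)[OF assms]])
    (rule Cinf_linear[OF bounded_linear_inner_left plot_Cinf[OF _ assms]])

lemma connected_locally_constant:
  assumes "connected_space X"
    and loc: "\<And>p. p \<in> topspace X \<Longrightarrow> \<exists>V. openin X V \<and> p \<in> V \<and> (\<forall>q\<in>V. F q = F p)"
    and "p \<in> topspace X" "q \<in> topspace X"
  shows "F p = F q"
proof -
  let ?A = "{r \<in> topspace X. F r = F p}" and ?B = "{r \<in> topspace X. F r \<noteq> F p}"
  have op: "openin X {r \<in> topspace X. P (F r)}" for P
  proof (subst openin_subopen, intro ballI)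
    fix r assume r: "r \<in> {r \<in> topspace X. P (F r)}"
    then obtain V where V: "openin X V" "r \<in> V" "\<forall>q\<in>V. F q = F r" using loc[of r] by blast
    have "V \<subseteq> {r \<in> topspace X. P (F r)}"
    proof
      fix q assume "q \<in> V"
      moreover have "F q = F r" by (rule bspec[OF V(3) \<open>q \<in> V\<close>])
      ultimately show "q \<in> {r \<in> topspace X. P (F r)}" using r openin_subset[OF V(1)] by auto
    qed
    then show "\<exists>T. openin X T \<and> r \<in> T \<and> T \<subseteq> {r \<in> topspace X. P (F r)}"
      using V(1,2) by blast
  qed
  have A: "openin X ?A" by (rule op)
  have B: "openin X ?B" by (rule op)
  have "topspace X - ?A = ?B" by auto
  then have "closedin X ?A" using B by (auto simp: closedin_def)
  then have "?A = {} \<or> ?A = topspace X"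
    using assms(1) A unfolding connected_space_clopen_in by blast
  moreover have "p \<in> ?A" using assms(3) by simp
  ultimately have "q \<in> ?A" using assms(4) by auto
  then show ?thesis by simp
qed

text \<open>Each coordinate of \<open>F\<close> near \<open>F p\<close> is a locally constant function, and the coordinates separate
  points.\<close>

lemma map_locally_constant:
  assumes F: "plot_map F"
    and zero: "\<And>q u f. u \<in> tangent_space M q \<Longrightarrow> smooth_near M (F q) f \<Longrightarrow> u (\<lambda>r. f (F r)) = 0"
    and p: "p \<in> topspace (mtop M)" "F p \<in> topspace (mtop M)"
  shows "\<exists>V. openin (mtop M) V \<and> p \<in> V \<and> (\<forall>q\<in>V. F q = F p)"
proof -
  obtain U \<phi> where c: "(U, \<phi>) \<in> charts M" "F p \<in> U" "inj_on \<phi> U" "openin (mtop M) U"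
    by (rule chart_coverE[OF chart_cover p(2)]) (rule that)
  let ?W = "{q \<in> topspace (mtop M). F q \<in> U}"
  have W: "openin (mtop M) ?W" by (rule plot_map_open_preimage[OF F c(4)])
  have "\<exists>V. openin (mtop M) V \<and> p \<in> V \<and> (\<forall>q\<in>V. \<phi> (F q) \<bullet> b = \<phi> (F p) \<bullet> b)" for b
  proof (rule locally_constant[of ?W])
    show "smooth_fun_on M ?W (\<lambda>q. \<phi> (F q) \<bullet> b)"
      by (rule smooth_fun_on_pullback[OF F smooth_fun_on_coordinate[OF c(1)]])
    show "u (\<lambda>q. \<phi> (F q) \<bullet> b) = 0" if "q \<in> ?W" "u \<in> tangent_space M q" for q u
      by (rule zero[OF that(2)])
        (use that smooth_fun_on_coordinate[OF c(1)] in \<open>auto simp: smooth_near_def\<close>)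
  qed (use p c in auto)
  then obtain V where V: "\<And>b. openin (mtop M) (V b) \<and> p \<in> V b \<and> (\<forall>q\<in>V b. \<phi> (F q) \<bullet> b = \<phi> (F p) \<bullet> b)"
    by metis
  have "openin (mtop M) ((\<Inter>b\<in>Basis. V b) \<inter> ?W)"
    by (rule openin_Int[OF openin_INT2 W]) (use V in auto)
  moreover have "F q = F p" if "q \<in> (\<Inter>b\<in>Basis. V b) \<inter> ?W" for q
  proof -
    have "\<phi> (F q) = \<phi> (F p)" by (rule euclidean_eqI) (use V that in blast)
    then show ?thesis using c(2,3) that by (auto simp: inj_on_def)
  qed
  moreover have "p \<in> (\<Inter>b\<in>Basis. V b) \<inter> ?W" using V c(2) p(1) by simp
  ultimately show ?thesis by blast
qed


section \<open>Vector fields and their Lie bracket\<close>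

lemma vector_field_tangent:
  "X \<in> vector_fields M \<Longrightarrow> p \<in> topspace (mtop M) \<Longrightarrow> X p \<in> tangent_space M p"
  by (simp add: vector_fields_def)

lemma vector_field_outside: "X \<in> vector_fields M \<Longrightarrow> p \<notin> topspace (mtop M) \<Longrightarrow> X p = (\<lambda>_. 0)"
  by (simp add: vector_fields_def)

lemma vector_field_smooth:
  "X \<in> vector_fields M \<Longrightarrow> smooth_fun_on M W f \<Longrightarrow> smooth_fun_on M W (\<lambda>p. X p f)"
  by (simp add: vector_fields_def)

lemma vector_fieldI:
  assumes "\<And>p. p \<in> topspace (mtop M) \<Longrightarrow> X p \<in> tangent_space M p"
    "\<And>p. p \<notin> topspace (mtop M) \<Longrightarrow> X p = (\<lambda>_. 0)"
    "\<And>W f. smooth_fun_on M W f \<Longrightarrow> smooth_fun_on M W (\<lambda>p. X p f)"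
  shows "X \<in> vector_fields M"
  using assms by (simp add: vector_fields_def)

lemma vector_field_smooth_near:
  "X \<in> vector_fields M \<Longrightarrow> smooth_near M p f \<Longrightarrow> smooth_near M p (\<lambda>q. X q f)"
  unfolding smooth_near_def using vector_field_smooth by blast

text \<open>In coordinates \<open>[X, Y] f\<close> is the derivative of \<open>f\<close> along \<open>dY(X) - dX(Y)\<close>, since the second
  derivatives of \<open>f\<close> cancel.\<close>

lemma lie_bracket_tangent:
  assumes X: "X \<in> vector_fields M" and Y: "Y \<in> vector_fields M" and p: "p \<in> topspace (mtop M)"
  shows "lie_bracket M X Y p \<in> tangent_space M p"
proof -
  obtain U \<phi> and D :: "'e set" and \<xi> where c: "(U, \<phi>) \<in> charts M" "p \<in> U" "plot M D \<xi>" "\<xi> ` D \<subseteq> U"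
    "\<And>q. q \<in> U \<Longrightarrow> \<phi> q \<in> D \<and> \<xi> (\<phi> q) = q"
    by (rule chart_at[OF p]) (rule that)
  have UM: "q \<in> topspace (mtop M)" if "q \<in> U" for q
    using openin_subset[OF chart_homeomorphism(1)[OF c(1)]] that by auto
  \<comment> \<open>\<open>\<zeta>\<close> is the projection onto the image of the chart, and \<open>A Z x\<close> is the coordinate vector of the
    field \<open>Z\<close> at the point \<open>\<xi> x\<close>.  A vector \<open>w\<close> representing \<open>Z\<close> in the parametrisation is not unique,
    but its projection is \<open>A Z x\<close>.\<close>
  define \<zeta> where "\<zeta> = (\<lambda>x. \<phi> (\<xi> x))"
  define A where "A = (\<lambda>Z x. \<Sum>b\<in>Basis. Z (\<xi> x) (\<lambda>q. \<phi> q \<bullet> b) *\<^sub>R b)"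
  define x0 where "x0 = \<phi> p"
  have x0: "x0 \<in> D" "\<xi> x0 = p" "\<zeta> x0 = x0" using c(5)[OF c(2)] by (auto simp: x0_def \<zeta>_def)
  have DU: "D \<inter> \<xi> -` U = D" using c(4) by auto
  have \<zeta>: "Cinf D \<zeta>" using plot_Cinf[OF c(3,1)] by (simp add: \<zeta>_def DU)
  have \<zeta>D: "\<zeta> x \<in> D" "\<xi> (\<zeta> x) = \<xi> x" if "x \<in> D" for x
    using c(5)[of "\<xi> x"] c(4) that by (auto simp: \<zeta>_def)
  have AC: "Cinf D (A Z)" if Z: "Z \<in> vector_fields M" for Z
    unfolding A_def
  proof (rule Cinf_sum[OF plot_open[OF c(3)]])
    fix b :: 'e
    have "Cinf D (\<lambda>x. Z (\<xi> x) (\<lambda>q. \<phi> q \<bullet> b))"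
      using smooth_fun_on_plot[OF vector_field_smooth[OF Z smooth_fun_on_coordinate[OF c(1)]] c(3)]
      by (simp add: DU)
    then show "Cinf D (\<lambda>x. Z (\<xi> x) (\<lambda>q. \<phi> q \<bullet> b) *\<^sub>R b)"
      by (rule Cinf_scaleR[OF _ Cinf_const[OF plot_open[OF c(3)]]])
  qed
  have comp: "Z (\<xi> x) (\<lambda>q. \<phi> q \<bullet> b) = fd \<zeta> (\<zeta> x) w \<bullet> b"
    if x: "x \<in> D" and w: "Z (\<xi> x) = push M \<xi> (\<zeta> x) w" for Z x w b
  proof -
    have "smooth_near M (\<xi> x) (\<lambda>q. \<phi> q \<bullet> b)"
      unfolding smooth_near_def using smooth_fun_on_coordinate[OF c(1)] c(4) x by blast
    then have "Z (\<xi> x) (\<lambda>q. \<phi> q \<bullet> b) = fd (\<lambda>y. \<zeta> y \<bullet> b) (\<zeta> x) w"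
      unfolding w using \<zeta>D[OF x] by (simp add: push_def \<zeta>_def)
    also have "\<dots> = fd \<zeta> (\<zeta> x) w \<bullet> b"
      using fd_eqI[OF has_derivative_inner_left[OF Cinf_has_derivative[OF \<zeta> \<zeta>D(1)[OF x]]]] by simp
    finally show ?thesis .
  qed
  have Aw: "A Z x = fd \<zeta> (\<zeta> x) w" if "x \<in> D" "Z (\<xi> x) = push M \<xi> (\<zeta> x) w" for Z x w
    unfolding A_def comp[where Z = Z and x = x and w = w, OF that] by (rule euclidean_representation)
  have ex: "\<exists>w. Z (\<xi> x) = push M \<xi> (\<zeta> x) w" if Z: "Z \<in> vector_fields M" and x: "x \<in> D" for Z x
    unfolding \<zeta>_def
    by (rule tangent_space_chart[OF vector_field_tangent[OF Z UM] c(1) _ c(3,5)]) (use c(4) x in auto)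
  have loc: "Z (\<xi> x) f = fd (\<lambda>y. f (\<xi> y)) (\<zeta> x) (A Z x)"
    if Z: "Z \<in> vector_fields M" and x: "x \<in> D" and f: "smooth_near M (\<xi> x) f" for Z x f
  proof -
    obtain w where w: "Z (\<xi> x) = push M \<xi> (\<zeta> x) w" using ex[OF Z x] by auto
    have f': "smooth_near M (\<xi> (\<zeta> x)) f" using f \<zeta>D(2)[OF x] by simp
    obtain T where T: "\<zeta> x \<in> T" "Cinf T (\<lambda>y. f (\<xi> y))"
      by (rule smooth_near_plot[OF c(3) \<zeta>D(1)[OF x] f']) (rule that)
    have zz: "\<zeta> (\<zeta> x) = \<zeta> x" using \<zeta>D(2)[OF x] by (simp add: \<zeta>_def)
    have "Z (\<xi> x) f = fd (\<lambda>y. f (\<xi> y)) (\<zeta> x) w" using f' by (simp add: w push_def)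
    also have "\<dots> = fd (\<lambda>y. f (\<xi> (\<zeta> y))) (\<zeta> x) w"
      by (rule fun_cong[OF fd_cong[OF plot_open[OF c(3)] \<zeta>D(1)[OF x]]]) (simp add: \<zeta>D(2))
    also have "\<dots> = fd (\<lambda>y. f (\<xi> y)) (\<zeta> (\<zeta> x)) (fd \<zeta> (\<zeta> x) w)"
      by (rule fd_compose[OF T(2) \<zeta>]) (use T(1) \<zeta>D(1)[OF x] zz in auto)
    finally show ?thesis using Aw[where Z = Z, OF x w] zz by simp
  qed
  have second: "Z p (\<lambda>q. Z' q f) = fd (\<lambda>z. fd (\<lambda>y. f (\<xi> y)) z (A Z' x0)) x0 (A Z x0) +
      fd (\<lambda>y. f (\<xi> y)) x0 (fd (A Z') x0 w)"
    if Z: "Z \<in> vector_fields M" and Z': "Z' \<in> vector_fields M" and f: "smooth_near M p f"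
      and w: "Z p = push M \<xi> x0 w" for Z Z' f w
  proof -
    obtain W where W: "p \<in> W" "smooth_fun_on M W f" using f unfolding smooth_near_def by auto
    let ?T = "D \<inter> \<xi> -` W"
    have T: "Cinf ?T (\<lambda>y. f (\<xi> y))" by (rule smooth_fun_on_plot[OF W(2) c(3)])
    have x0T: "x0 \<in> ?T" using x0 W by simp
    have \<zeta>T: "\<zeta> ` ?T \<subseteq> ?T" using \<zeta>D by auto
    have "Z p (\<lambda>q. Z' q f) = fd (\<lambda>x. Z' (\<xi> x) f) x0 w"
      unfolding w using vector_field_smooth_near[OF Z' f] x0(2) by (simp add: push_def)
    also have "\<dots> = fd (\<lambda>x. fd (\<lambda>y. f (\<xi> y)) (\<zeta> x) (A Z' x)) x0 w"
      by (rule fun_cong[OF fd_cong[OF Cinf_open[OF T] x0T]])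
        (rule loc[OF Z'], use W(2) in \<open>auto simp: smooth_near_def\<close>)
    also have "\<dots> = fd (\<lambda>z. fd (\<lambda>y. f (\<xi> y)) z (A Z' x0)) (\<zeta> x0) (fd \<zeta> x0 w) +
        fd (\<lambda>y. f (\<xi> y)) (\<zeta> x0) (fd (A Z') x0 w)"
      by (rule fd_directional[OF T Cinf_subset[OF \<zeta>] Cinf_subset[OF AC[OF Z']] x0T \<zeta>T])
        (auto intro: Cinf_open[OF T])
    also have "fd \<zeta> x0 w = A Z x0" using Aw[of x0 Z w] w x0 by simp
    finally show ?thesis by (simp add: x0(3))
  qed
  obtain wX where wX: "X p = push M \<xi> x0 wX" using ex[OF X x0(1)] unfolding x0 by auto
  obtain wY where wY: "Y p = push M \<xi> x0 wY" using ex[OF Y x0(1)] unfolding x0 by auto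
  have "lie_bracket M X Y p = push M \<xi> x0 (fd (A Y) x0 wX - fd (A X) x0 wY)"
  proof
    fix f
    show "lie_bracket M X Y p f = push M \<xi> x0 (fd (A Y) x0 wX - fd (A X) x0 wY) f"
    proof (cases "smooth_near M p f")
      case True
      obtain T where T: "x0 \<in> T" "Cinf T (\<lambda>y. f (\<xi> y))"
        by (rule smooth_near_plot[OF c(3) x0(1)]) (use True x0(2) that in auto)
      have "lie_bracket M X Y p f = fd (\<lambda>y. f (\<xi> y)) x0 (fd (A Y) x0 wX) - fd (\<lambda>y. f (\<xi> y)) x0 (fd (A X) x0 wY)"
        using True second[OF X Y True wX] second[OF Y X True wY]
          symmetric_second_derivative[OF T(2,1), of "A Y x0" "A X x0"]
        by (simp add: lie_bracket_def)
      then show ?thesis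
        using True x0(2) linear_diff[OF Cinf_linear_fd[OF T(2,1)]] by (simp add: push_def)
    qed (use x0(2) in \<open>simp add: lie_bracket_def push_def\<close>)
  qed
  then show ?thesis using push_in_tangent_space[OF c(3) x0(1)] x0(2) by simp
qed

lemma lie_bracket_vector_field:
  assumes X: "X \<in> vector_fields M" and Y: "Y \<in> vector_fields M"
  shows "lie_bracket M X Y \<in> vector_fields M"
proof (rule vector_fieldI)
  show "lie_bracket M X Y p \<in> tangent_space M p" if "p \<in> topspace (mtop M)" for p
    by (rule lie_bracket_tangent[OF X Y that])
  show "lie_bracket M X Y p = (\<lambda>_. 0)" if "p \<notin> topspace (mtop M)" for p
    using vector_field_outside[OF X that] vector_field_outside[OF Y that]
    by (simp add: lie_bracket_def fun_eq_iff)
  show "smooth_fun_on M W (\<lambda>p. lie_bracket M X Y p f)" if f: "smooth_fun_on M W f" for W f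
  proof (rule smooth_fun_on_cong[OF smooth_fun_on_diff])
    show "smooth_fun_on M W (\<lambda>p. X p (\<lambda>q. Y q f))" "smooth_fun_on M W (\<lambda>p. Y p (\<lambda>q. X q f))"
      by (rule vector_field_smooth[OF X vector_field_smooth[OF Y f]],
          rule vector_field_smooth[OF Y vector_field_smooth[OF X f]])
    show "X p (\<lambda>q. Y q f) - Y p (\<lambda>q. X q f) = lie_bracket M X Y p f" if "p \<in> W" for p
    proof -
      have "smooth_near M p f" unfolding smooth_near_def using that f by auto
      then show ?thesis by (simp add: lie_bracket_def)
    qed
  qed
qed

end


section \<open>Left-invariant vector fields\<close>

locale lie_grp =
  fixes G :: "'a monoid" (structure) and M :: "('a, 'e::euclidean_space) manifold_data"
  assumes lie_group: "lie_group G M"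

sublocale lie_grp \<subseteq> manifold M
  by standard (use lie_group in \<open>simp add: lie_group_def\<close>)

sublocale lie_grp \<subseteq> group G
  using lie_group by (simp add: lie_group_def)

context lie_grp
begin

lemma topspace_carrier: "topspace (mtop M) = carrier G"
  using lie_group by (simp add: lie_group_def)

lemma plot_in_carrier: "plot M D \<xi> \<Longrightarrow> x \<in> D \<Longrightarrow> \<xi> x \<in> carrier G"
  using plot_in_topspace topspace_carrier by metis

lemma plot_mult:
  assumes "plot M D \<xi>" "plot M D \<eta>"
  shows "plot M D (\<lambda>x. \<xi> x \<otimes> \<eta> x)"
proof -
  have "smooth_map (product_manifold M M) M (\<lambda>(x, y). x \<otimes> y)"
    using lie_group by (simp add: lie_group_def)
  from smooth_map_plot[OF this chart_cover_product[OF chart_cover chart_cover] chart_cover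
      plot_product[OF assms]]
  show ?thesis by simp
qed

lemma plot_inv:
  assumes "plot M D \<xi>"
  shows "plot M D (\<lambda>x. inv (\<xi> x))"
proof -
  have "smooth_map M M (\<lambda>x. inv x)" using lie_group by (simp add: lie_group_def)
  from smooth_map_plot[OF this chart_cover chart_cover assms] show ?thesis .
qed

lemma plot_const': "a \<in> carrier G \<Longrightarrow> open D \<Longrightarrow> plot M D (\<lambda>x. a)"
  by (rule plot_const) (simp_all add: topspace_carrier)

lemma plot_lmult: "a \<in> carrier G \<Longrightarrow> plot M D \<xi> \<Longrightarrow> plot M D (\<lambda>x. a \<otimes> \<xi> x)"
  by (rule plot_mult[OF plot_const' _]) (auto intro: plot_open)

lemma plot_rmult: "a \<in> carrier G \<Longrightarrow> plot M D \<xi> \<Longrightarrow> plot M D (\<lambda>x. \<xi> x \<otimes> a)"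
  by (rule plot_mult[OF _ plot_const']) (auto intro: plot_open)

lemma plot_map_left: "a \<in> carrier G \<Longrightarrow> plot_map (\<lambda>q. a \<otimes> q)"
  unfolding plot_map_def by (intro allI impI plot_lmult)

lemma smooth_near_left:
  "a \<in> carrier G \<Longrightarrow> x \<in> carrier G \<Longrightarrow> smooth_near M (a \<otimes> x) f \<Longrightarrow> smooth_near M x (\<lambda>q. f (a \<otimes> q))"
  by (rule smooth_near_pullback[OF plot_map_left]) (simp_all add: topspace_carrier)

lemma inv_cancel [simp]:
  "a \<in> carrier G \<Longrightarrow> b \<in> carrier G \<Longrightarrow> inv a \<otimes> (a \<otimes> b) = b"
  "a \<in> carrier G \<Longrightarrow> b \<in> carrier G \<Longrightarrow> a \<otimes> (inv a \<otimes> b) = b"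
  by (simp_all add: m_assoc[symmetric])

lemma left_translate_apply:
  "left_translate G M a x u f = (if smooth_near M (a \<otimes> x) f then u (\<lambda>q. f (a \<otimes> q)) else 0)"
  by (simp add: left_translate_def differential_def comp_def)

lemma lie_algebra_vector_field: "X \<in> lie_algebra G M \<Longrightarrow> X \<in> vector_fields M"
  by (simp add: lie_algebra_def)

lemma lie_algebra_translate:
  assumes "X \<in> lie_algebra G M" "a \<in> carrier G" "x \<in> carrier G" "smooth_near M (a \<otimes> x) f"
  shows "X (a \<otimes> x) f = X x (\<lambda>q. f (a \<otimes> q))"
proof -
  have "X (a \<otimes> x) = left_translate G M a x (X x)" using assms by (simp add: lie_algebra_def)
  then show ?thesis using assms(4) by (simp add: left_translate_apply)
qed

text \<open>Left translation commutes with the differentiation by each of the two fields.  The inner one has to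
  be translated on a whole neighbourhood before the outer one is applied.\<close>

lemma lie_bracket_lie_algebra:
  assumes X: "X \<in> lie_algebra G M" and Y: "Y \<in> lie_algebra G M"
  shows "lie_bracket M X Y \<in> lie_algebra G M"
proof -
  note XV = lie_algebra_vector_field[OF X] and YV = lie_algebra_vector_field[OF Y]
  have half: "X x (\<lambda>q. Y q (\<lambda>q. f (a \<otimes> q))) = X (a \<otimes> x) (\<lambda>q. Y q f)"
    if a: "a \<in> carrier G" and x: "x \<in> carrier G" and f: "smooth_near M (a \<otimes> x) f"
      and X: "X \<in> lie_algebra G M" and Y: "Y \<in> lie_algebra G M" for X Y a x f
  proof -
    obtain W where W: "a \<otimes> x \<in> W" "smooth_fun_on M W f" using f unfolding smooth_near_def by auto
    let ?V = "{q \<in> topspace (mtop M). a \<otimes> q \<in> W}"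
    have xM: "x \<in> topspace (mtop M)" using x by (simp add: topspace_carrier)
    have "X x (\<lambda>q. Y q (\<lambda>q. f (a \<otimes> q))) = X x (\<lambda>q. Y (a \<otimes> q) f)"
    proof (rule tangent_cong[OF vector_field_tangent[OF lie_algebra_vector_field[OF X] xM]])
      show "openin (mtop M) ?V"
        by (rule plot_map_open_preimage[OF plot_map_left[OF a] smooth_fun_on_openin[OF W(2)]])
      show "x \<in> ?V" using xM W(1) by simp
      fix q assume "q \<in> ?V"
      then have q: "q \<in> carrier G" "smooth_near M (a \<otimes> q) f"
        using W(2) by (auto simp: topspace_carrier smooth_near_def)
      show "Y q (\<lambda>q. f (a \<otimes> q)) = Y (a \<otimes> q) f"
        by (rule lie_algebra_translate[OF Y a q, symmetric])
    qed
    also have "\<dots> = X (a \<otimes> x) (\<lambda>q. Y q f)"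
      by (rule lie_algebra_translate[OF X a x, symmetric])
        (rule vector_field_smooth_near[OF lie_algebra_vector_field[OF Y] f])
    finally show ?thesis .
  qed
  have "left_translate G M a x (lie_bracket M X Y x) = lie_bracket M X Y (a \<otimes> x)"
    if a: "a \<in> carrier G" and x: "x \<in> carrier G" for a x
  proof
    fix f
    show "left_translate G M a x (lie_bracket M X Y x) f = lie_bracket M X Y (a \<otimes> x) f"
    proof (cases "smooth_near M (a \<otimes> x) f")
      case True
      show ?thesis
        using True smooth_near_left[OF a x True] half[OF a x True X Y] half[OF a x True Y X]
        by (simp add: left_translate_apply lie_bracket_def)
    qed (simp add: left_translate_apply lie_bracket_def)
  qed
  then show ?thesis using lie_bracket_vector_field[OF XV YV] by (simp add: lie_algebra_def)
qed

end

text \<open>With one parametrisation near the unit fixed, vectors of \<open>'e\<close> name the left-invariant fields.\<close>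

locale lie_grp_chart = lie_grp G M
  for G :: "'a monoid" (structure) and M :: "('a, 'e::euclidean_space) manifold_data" +
  fixes U :: "'a set" and \<phi> :: "'a \<Rightarrow> 'e" and D :: "'e set" and \<xi> :: "'e \<Rightarrow> 'a" and x0 :: 'e
  assumes chart: "(U, \<phi>) \<in> charts M" "\<one> \<in> U"
    and par: "plot M D \<xi>" "\<And>q. q \<in> U \<Longrightarrow> \<phi> q \<in> D \<and> \<xi> (\<phi> q) = q"
    and x0: "x0 = \<phi> \<one>"
begin

lemma x0_D: "x0 \<in> D" and \<xi>_x0 [simp]: "\<xi> x0 = \<one>"
  using par(2)[OF chart(2)] by (simp_all add: x0)

lemma \<xi>_carrier [simp]: "x \<in> D \<Longrightarrow> \<xi> x \<in> carrier G"
  by (rule plot_in_carrier[OF par(1)])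

lemma D_open: "open D"
  by (rule plot_open[OF par(1)])

text \<open>The left-invariant field whose value at the unit is the derivative of \<open>\<xi>\<close> in the direction \<open>w\<close>.\<close>

definition E :: "'e \<Rightarrow> 'a vfield" where
  "E w p = (if p \<in> carrier G then push M (\<lambda>x. p \<otimes> \<xi> x) x0 w else (\<lambda>_. 0))"

lemma E_apply:
  assumes "p \<in> carrier G" "smooth_near M p f"
  shows "E w p f = fd (\<lambda>x. f (p \<otimes> \<xi> x)) x0 w"
  using assms by (simp add: E_def push_def)

lemma E_linear: "E (a *\<^sub>R v + b *\<^sub>R w) p = (\<lambda>f. a * E v p f + b * E w p f)"
  by (simp add: E_def push_linear[OF plot_lmult[OF _ par(1)] x0_D])

lemma E_tangent: "p \<in> carrier G \<Longrightarrow> E w p \<in> tangent_space M p"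
  using push_in_tangent_space[OF plot_lmult[OF _ par(1)] x0_D, of p w] by (simp add: E_def)

text \<open>Translate a curve through \<open>p\<close> to the unit, write it there in the parametrisation \<open>\<xi>\<close>, and translate
  it back.\<close>

lemma tangent_E:
  assumes u: "u \<in> tangent_space M p"
  shows "\<exists>w. u = E w p"
proof -
  have p: "p \<in> carrier G" using tangent_space_topspace[OF u] by (simp add: topspace_carrier)
  obtain I and \<alpha> :: "real \<Rightarrow> 'a" where a: "plot M I \<alpha>" "0 \<in> I" "\<alpha> 0 = p" "u = push M \<alpha> 0 1"
    by (rule tangent_spaceE[OF u]) (rule that)
  have \<beta>: "plot M I (\<lambda>t. inv p \<otimes> \<alpha> t)" by (rule plot_lmult[OF inv_closed[OF p] a(1)])
  let ?J = "I \<inter> (\<lambda>t. inv p \<otimes> \<alpha> t) -` U"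
  have C: "Cinf ?J (\<lambda>t. \<phi> (inv p \<otimes> \<alpha> t))" by (rule plot_Cinf[OF \<beta> chart(1)])
  have 0: "0 \<in> ?J" using a(2,3) p chart(2) by simp
  have "u = push M (\<lambda>t. p \<otimes> \<xi> (\<phi> (inv p \<otimes> \<alpha> t))) 0 1"
    unfolding a(4)
  proof (rule fun_cong[OF push_cong[OF Cinf_open[OF C] 0]])
    fix t assume t: "t \<in> ?J"
    then have "\<alpha> t \<in> carrier G" using plot_in_carrier[OF a(1)] by auto
    moreover have "\<xi> (\<phi> (inv p \<otimes> \<alpha> t)) = inv p \<otimes> \<alpha> t" using par(2) t by auto
    ultimately show "\<alpha> t = p \<otimes> \<xi> (\<phi> (inv p \<otimes> \<alpha> t))" using p by simp
  qed
  also have "\<dots> = push M (\<lambda>x. p \<otimes> \<xi> x) (\<phi> (inv p \<otimes> \<alpha> 0)) (fd (\<lambda>t. \<phi> (inv p \<otimes> \<alpha> t)) 0 1)"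
    by (rule push_compose[OF plot_lmult[OF p par(1)] C _ 0]) (use 0 par(2) in auto)
  also have "\<phi> (inv p \<otimes> \<alpha> 0) = x0" using a(3) p by (simp add: x0)
  finally show ?thesis using p by (auto simp: E_def)
qed

text \<open>Smoothness holds because \<open>E w p f\<close> is a partial derivative of \<open>f (p \<otimes> \<xi> x)\<close>, which is smooth in both
  variables together.\<close>

lemma E_vector_field: "E w \<in> vector_fields M"
proof (rule vector_fieldI)
  show "E w p \<in> tangent_space M p" if "p \<in> topspace (mtop M)" for p
    by (rule E_tangent) (use that in \<open>simp add: topspace_carrier\<close>)
  show "E w p = (\<lambda>_. 0)" if "p \<notin> topspace (mtop M)" for p
    using that by (simp add: topspace_carrier E_def)
  fix W f assume f: "smooth_fun_on M W f"
  show "smooth_fun_on M W (\<lambda>p. E w p f)"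
  proof (rule smooth_fun_onI[OF smooth_fun_on_openin[OF f]])
    fix S and \<eta> :: "'e \<Rightarrow> 'a" assume \<eta>: "plot M S \<eta>"
    have K: "plot M (S \<times> D) (\<lambda>z. \<eta> (fst z) \<otimes> \<xi> (snd z))"
      by (rule plot_mult[OF plot_fst[OF \<eta> D_open] plot_snd[OF par(1) plot_open[OF \<eta>]]])
    let ?T = "(S \<times> D) \<inter> (\<lambda>z. \<eta> (fst z) \<otimes> \<xi> (snd z)) -` W"
    have T: "Cinf ?T (\<lambda>z. f (\<eta> (fst z) \<otimes> \<xi> (snd z)))" by (rule smooth_fun_on_plot[OF f K])
    have eq: "{y. (y, x0) \<in> ?T} = S \<inter> \<eta> -` W"
      using x0_D plot_in_carrier[OF \<eta>] by auto
    have "Cinf (S \<inter> \<eta> -` W) (\<lambda>y. fd (\<lambda>x. f (\<eta> y \<otimes> \<xi> x)) x0 w)"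
      using Cinf_partial_snd_curried[of ?T "\<lambda>y x. f (\<eta> y \<otimes> \<xi> x)" x0 w, OF T] unfolding eq .
    then show "Cinf (S \<inter> \<eta> -` W) (\<lambda>y. E w (\<eta> y) f)"
    proof (rule Cinf_cong)
      fix y assume y: "y \<in> S \<inter> \<eta> -` W"
      show "fd (\<lambda>x. f (\<eta> y \<otimes> \<xi> x)) x0 w = E w (\<eta> y) f"
        by (rule E_apply[symmetric]) (use y f plot_in_carrier[OF \<eta>] in \<open>auto simp: smooth_near_def\<close>)
    qed
  qed
qed

lemma left_translate_E:
  assumes a: "a \<in> carrier G" and x: "x \<in> carrier G"
  shows "left_translate G M a x (E w x) = E w (a \<otimes> x)"
proof
  fix f
  show "left_translate G M a x (E w x) f = E w (a \<otimes> x) f"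
  proof (cases "smooth_near M (a \<otimes> x) f")
    case True
    have "fd (\<lambda>y. f (a \<otimes> (x \<otimes> \<xi> y))) x0 w = fd (\<lambda>y. f (a \<otimes> x \<otimes> \<xi> y)) x0 w"
      by (rule fun_cong[OF fd_cong[OF D_open x0_D]]) (use a x in \<open>simp add: m_assoc\<close>)
    then show ?thesis
      using True a x smooth_near_left[OF a x True] by (simp add: left_translate_apply E_apply)
  next
    case False
    then show ?thesis
      using a x tangent_nonsmooth[OF E_tangent False] by (simp add: left_translate_apply)
  qed
qed

lemma E_lie_algebra: "E w \<in> lie_algebra G M"
  unfolding lie_algebra_def using E_vector_field left_translate_E by simp

lemma lie_algebra_E:
  assumes X: "X \<in> lie_algebra G M"
  shows "\<exists>w. X = E w"
proof -
  have "X \<one> \<in> tangent_space M \<one>"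
    by (rule vector_field_tangent[OF lie_algebra_vector_field[OF X]]) (simp add: topspace_carrier)
  then obtain w where w: "X \<one> = E w \<one>" using tangent_E by blast
  have "X p = E w p" for p
  proof (cases "p \<in> carrier G")
    case True
    have "left_translate G M p \<one> (X \<one>) = X (p \<otimes> \<one>)"
      using X True by (simp add: lie_algebra_def)
    then show ?thesis using left_translate_E[OF True one_closed, of w] True by (simp add: w)
  next
    case False
    then show ?thesis
      using vector_field_outside[OF lie_algebra_vector_field[OF X], of p]
      by (simp add: topspace_carrier E_def)
  qed
  then show ?thesis by auto
qed


section \<open>Commutativity of the group and of its Lie algebra\<close>

lemma E_E_apply:
  assumes p: "p \<in> carrier G" and f: "smooth_near M p f"
  shows "E u p (\<lambda>q. E v q f) = fd (\<lambda>x. fd (\<lambda>y. f (p \<otimes> \<xi> x \<otimes> \<xi> y)) x0 v) x0 u"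
proof -
  obtain W where W: "p \<in> W" "smooth_fun_on M W f" using f unfolding smooth_near_def by auto
  let ?S = "D \<inter> (\<lambda>x. p \<otimes> \<xi> x) -` W"
  have pl: "plot M D (\<lambda>x. p \<otimes> \<xi> x)" by (rule plot_lmult[OF p par(1)])
  have "E u p (\<lambda>q. E v q f) = fd (\<lambda>x. E v (p \<otimes> \<xi> x) f) x0 u"
    by (rule E_apply[OF p vector_field_smooth_near[OF E_vector_field f]])
  also have "\<dots> = fd (\<lambda>x. fd (\<lambda>y. f (p \<otimes> \<xi> x \<otimes> \<xi> y)) x0 v) x0 u"
  proof (rule fun_cong[OF fd_cong[OF plot_open_preimage[OF pl smooth_fun_on_openin[OF W(2)]]]])
    show "x0 \<in> ?S" using x0_D W(1) p by simp
    fix x assume x: "x \<in> ?S"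
    show "E v (p \<otimes> \<xi> x) f = fd (\<lambda>y. f (p \<otimes> \<xi> x \<otimes> \<xi> y)) x0 v"
      by (rule E_apply) (use x W(2) plot_in_carrier[OF pl] in \<open>auto simp: smooth_near_def\<close>)
  qed
  finally show ?thesis .
qed

text \<open>Both orders of differentiation lead to the second derivative of \<open>f (p \<otimes> \<xi> x \<otimes> \<xi> y)\<close>, with the roles of \<open>x\<close>
  and \<open>y\<close> exchanged.\<close>

lemma abelian_lie_bracket:
  assumes comm: "\<And>a b. a \<in> carrier G \<Longrightarrow> b \<in> carrier G \<Longrightarrow> a \<otimes> b = b \<otimes> a"
  shows "lie_bracket M (E u) (E v) = (\<lambda>p f. 0)"
proof (intro ext)
  fix p f
  show "lie_bracket M (E u) (E v) p f = 0"
  proof (cases "p \<in> carrier G \<and> smooth_near M p f")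
    case True
    then have p: "p \<in> carrier G" and f: "smooth_near M p f" by auto
    obtain W where W: "p \<in> W" "smooth_fun_on M W f" using f unfolding smooth_near_def by auto
    have K: "plot M (D \<times> D) (\<lambda>z. p \<otimes> \<xi> (fst z) \<otimes> \<xi> (snd z))"
      by (rule plot_mult[OF plot_lmult[OF p plot_fst[OF par(1) D_open]] plot_snd[OF par(1) D_open]])
    have "fd (\<lambda>x. fd (\<lambda>y. f (p \<otimes> \<xi> x \<otimes> \<xi> y)) x0 v) x0 u = fd (\<lambda>y. fd (\<lambda>x. f (p \<otimes> \<xi> x \<otimes> \<xi> y)) x0 u) x0 v"
      by (rule mixed_partials_curried[where H = "\<lambda>x y. f (p \<otimes> \<xi> x \<otimes> \<xi> y)", OF smooth_fun_on_plot[OF W(2) K]])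
        (use x0_D W(1) p in simp)
    also have "\<dots> = fd (\<lambda>y. fd (\<lambda>x. f (p \<otimes> \<xi> y \<otimes> \<xi> x)) x0 u) x0 v"
    proof (rule fun_cong[OF fd_cong[OF D_open x0_D]], rule fun_cong[OF fd_cong[OF D_open x0_D]])
      fix y x assume "y \<in> D" "x \<in> D"
      then show "f (p \<otimes> \<xi> x \<otimes> \<xi> y) = f (p \<otimes> \<xi> y \<otimes> \<xi> x)"
        using p comm[of "\<xi> x" "\<xi> y"] by (simp add: m_assoc)
    qed
    finally show ?thesis using f by (simp add: lie_bracket_def E_E_apply[OF p f])
  next
    case False
    then show ?thesis by (auto simp: lie_bracket_def E_def)
  qed
qed

text \<open>Differentiate the constant function \<open>z \<mapsto> f (q \<otimes> \<xi> z \<otimes> inv (\<xi> z))\<close> by the product rule.\<close>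

lemma fd_inverse:
  assumes q: "q \<in> carrier G" and f: "smooth_near M q f"
  shows "fd (\<lambda>z. f (q \<otimes> inv (\<xi> z))) x0 u = - E u q f"
proof -
  obtain W where W: "q \<in> W" "smooth_fun_on M W f" using f unfolding smooth_near_def by auto
  have K: "plot M (D \<times> D) (\<lambda>z. q \<otimes> \<xi> (fst z) \<otimes> inv (\<xi> (snd z)))"
    by (rule plot_mult[OF plot_lmult[OF q plot_fst[OF par(1) D_open]] plot_inv[OF plot_snd[OF par(1) D_open]]])
  have "fd (\<lambda>z. f (q \<otimes> \<xi> z \<otimes> inv (\<xi> z))) x0 u =
      fd (\<lambda>z. f (q \<otimes> \<xi> z \<otimes> inv (\<xi> x0))) x0 u + fd (\<lambda>z. f (q \<otimes> \<xi> x0 \<otimes> inv (\<xi> z))) x0 u"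
    by (rule fd_diagonal_curried[where H = "\<lambda>x y. f (q \<otimes> \<xi> x \<otimes> inv (\<xi> y))", OF smooth_fun_on_plot[OF W(2) K]])
      (use x0_D W(1) q in simp)
  moreover have "fd (\<lambda>z. f (q \<otimes> \<xi> z \<otimes> inv (\<xi> z))) x0 = fd (\<lambda>z. f q) x0"
    by (rule fd_cong[OF D_open x0_D]) (use q in \<open>simp add: m_assoc\<close>)
  moreover have "fd (\<lambda>z. f (q \<otimes> \<xi> z \<otimes> inv (\<xi> x0))) x0 = fd (\<lambda>z. f (q \<otimes> \<xi> z)) x0"
    by (rule fd_cong[OF D_open x0_D]) (use q in simp)
  ultimately show ?thesis using q f by (simp add: E_apply)
qed

text \<open>This is the infinitesimal form of \<open>d Ad = ad\<close>.  After exchanging the two derivatives, the product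
  rule in \<open>z\<close> yields \<open>E u \<one> (E v f) - E v \<one> (E u f)\<close>.\<close>

lemma conjugation_second_derivative:
  assumes br: "lie_bracket M (E u) (E v) = (\<lambda>p f. 0)" and f: "smooth_near M \<one> f"
  shows "fd (\<lambda>z. fd (\<lambda>y. f (\<xi> z \<otimes> \<xi> y \<otimes> inv (\<xi> z))) x0 v) x0 u = 0"
proof -
  obtain W where W: "\<one> \<in> W" "smooth_fun_on M W f" using f unfolding smooth_near_def by auto
  have fst: "plot M (D \<times> D) (\<lambda>z. \<xi> (fst z))" and snd: "plot M (D \<times> D) (\<lambda>z. \<xi> (snd z))"
    by (rule plot_fst[OF par(1) D_open], rule plot_snd[OF par(1) D_open])
  have K: "plot M (D \<times> D) (\<lambda>z. \<xi> (fst z) \<otimes> \<xi> (snd z) \<otimes> inv (\<xi> (fst z)))"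
    by (rule plot_mult[OF plot_mult[OF fst snd] plot_inv[OF fst]])
  have K1: "plot M (D \<times> D) (\<lambda>z. \<xi> (fst z) \<otimes> \<xi> (snd z))" by (rule plot_mult[OF fst snd])
  have K2: "plot M (D \<times> D) (\<lambda>z. \<xi> (snd z) \<otimes> \<xi> (fst z))" by (rule plot_mult[OF snd fst])
  let ?T1 = "(D \<times> D) \<inter> (\<lambda>z. \<xi> (fst z) \<otimes> \<xi> (snd z)) -` W"
  let ?T2 = "(D \<times> D) \<inter> (\<lambda>z. \<xi> (snd z) \<otimes> \<xi> (fst z)) -` W"
  note C1 = smooth_fun_on_plot[OF W(2) K1] and C2 = smooth_fun_on_plot[OF W(2) K2]
  have mem: "(x0, x0) \<in> ?T1" using x0_D W(1) by simp
  have "fd (\<lambda>z. fd (\<lambda>y. f (\<xi> z \<otimes> \<xi> y \<otimes> inv (\<xi> z))) x0 v) x0 u =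
      fd (\<lambda>y. fd (\<lambda>z. f (\<xi> z \<otimes> \<xi> y \<otimes> inv (\<xi> z))) x0 u) x0 v"
    by (rule mixed_partials_curried[where H = "\<lambda>z y. f (\<xi> z \<otimes> \<xi> y \<otimes> inv (\<xi> z))", OF smooth_fun_on_plot[OF W(2) K]])
      (use x0_D W(1) in simp)
  also have "\<dots> = fd (\<lambda>y. fd (\<lambda>z. f (\<xi> z \<otimes> \<xi> y)) x0 u - fd (\<lambda>z. f (\<xi> y \<otimes> \<xi> z)) x0 u) x0 v"
  proof (rule fun_cong[OF fd_cong[OF plot_open_preimage[OF par(1) smooth_fun_on_openin[OF W(2)]]]])
    show "x0 \<in> D \<inter> \<xi> -` W" using x0_D W(1) by simp
    fix y assume y: "y \<in> D \<inter> \<xi> -` W"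
    then have yc: "\<xi> y \<in> carrier G" and fy: "smooth_near M (\<xi> y) f"
      using W(2) by (auto simp: smooth_near_def)
    have Ky: "plot M (D \<times> D) (\<lambda>z. \<xi> (fst z) \<otimes> \<xi> y \<otimes> inv (\<xi> (snd z)))"
      by (rule plot_mult[OF plot_rmult[OF yc fst] plot_inv[OF snd]])
    have "fd (\<lambda>z. f (\<xi> z \<otimes> \<xi> y \<otimes> inv (\<xi> z))) x0 u =
        fd (\<lambda>z. f (\<xi> z \<otimes> \<xi> y \<otimes> inv (\<xi> x0))) x0 u + fd (\<lambda>z. f (\<xi> x0 \<otimes> \<xi> y \<otimes> inv (\<xi> z))) x0 u"
      by (rule fd_diagonal_curried[where H = "\<lambda>z z'. f (\<xi> z \<otimes> \<xi> y \<otimes> inv (\<xi> z'))", OF smooth_fun_on_plot[OF W(2) Ky]])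
        (use x0_D y yc in simp)
    also have "fd (\<lambda>z. f (\<xi> z \<otimes> \<xi> y \<otimes> inv (\<xi> x0))) x0 = fd (\<lambda>z. f (\<xi> z \<otimes> \<xi> y)) x0"
      by (rule fd_cong[OF D_open x0_D]) (use yc in simp)
    also have "fd (\<lambda>z. f (\<xi> x0 \<otimes> \<xi> y \<otimes> inv (\<xi> z))) x0 u = - fd (\<lambda>z. f (\<xi> y \<otimes> \<xi> z)) x0 u"
      using fd_inverse[OF yc fy, of u] E_apply[OF yc fy, of u] yc by simp
    finally show "fd (\<lambda>z. f (\<xi> z \<otimes> \<xi> y \<otimes> inv (\<xi> z))) x0 u =
        fd (\<lambda>z. f (\<xi> z \<otimes> \<xi> y)) x0 u - fd (\<lambda>z. f (\<xi> y \<otimes> \<xi> z)) x0 u" by simp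
  qed
  also have "\<dots> = fd (\<lambda>y. fd (\<lambda>z. f (\<xi> z \<otimes> \<xi> y)) x0 u) x0 v - fd (\<lambda>y. fd (\<lambda>z. f (\<xi> y \<otimes> \<xi> z)) x0 u) x0 v"
  proof -
    note A = Cinf_partial_snd_curried[where H = "\<lambda>y z. f (\<xi> z \<otimes> \<xi> y)", OF C2, of x0 u]
    note B = Cinf_partial_snd_curried[where H = "\<lambda>y z. f (\<xi> y \<otimes> \<xi> z)", OF C1, of x0 u]
    have "((\<lambda>y. fd (\<lambda>z. f (\<xi> z \<otimes> \<xi> y)) x0 u - fd (\<lambda>z. f (\<xi> y \<otimes> \<xi> z)) x0 u) has_derivative
        (\<lambda>v. fd (\<lambda>y. fd (\<lambda>z. f (\<xi> z \<otimes> \<xi> y)) x0 u) x0 v - fd (\<lambda>y. fd (\<lambda>z. f (\<xi> y \<otimes> \<xi> z)) x0 u) x0 v)) (at x0)"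
      by (rule has_derivative_diff[OF Cinf_has_derivative[OF A] Cinf_has_derivative[OF B]])
        (use x0_D W(1) in auto)
    from fd_eqI[OF this] show ?thesis by simp
  qed
  also have "fd (\<lambda>y. fd (\<lambda>z. f (\<xi> z \<otimes> \<xi> y)) x0 u) x0 v = fd (\<lambda>z. fd (\<lambda>y. f (\<xi> z \<otimes> \<xi> y)) x0 v) x0 u"
    by (rule mixed_partials_curried[where H = "\<lambda>z y. f (\<xi> z \<otimes> \<xi> y)", OF C1 mem, symmetric])
  also have "fd (\<lambda>z. fd (\<lambda>y. f (\<xi> z \<otimes> \<xi> y)) x0 v) x0 u = E u \<one> (\<lambda>q. E v q f)"
    unfolding E_E_apply[OF one_closed f]
    by (rule fun_cong[OF fd_cong[OF D_open x0_D]], rule fun_cong[OF fd_cong[OF D_open x0_D]]) simp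
  also have "fd (\<lambda>y. fd (\<lambda>z. f (\<xi> y \<otimes> \<xi> z)) x0 u) x0 v = E v \<one> (\<lambda>q. E u q f)"
    unfolding E_E_apply[OF one_closed f]
    by (rule fun_cong[OF fd_cong[OF D_open x0_D]], rule fun_cong[OF fd_cong[OF D_open x0_D]]) simp
  also have "E u \<one> (\<lambda>q. E v q f) - E v \<one> (\<lambda>q. E u q f) = lie_bracket M (E u) (E v) \<one> f"
    using f by (simp add: lie_bracket_def)
  finally show ?thesis by (simp add: br)
qed

text \<open>The left side is \<open>Ad a\<close> applied to \<open>E v \<one>\<close>.  As a function of \<open>a\<close> it has derivative 0 at every point:
  the case of the unit is \<open>conjugation_second_derivative\<close>, and \<open>Ad\<close> is multiplicative.\<close>

lemma Ad_trivial:
  assumes br: "\<And>u v. lie_bracket M (E u) (E v) = (\<lambda>p f. 0)"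
    and conn: "connected_space (mtop M)"
    and a: "a \<in> carrier G" and f: "smooth_near M \<one> f"
  shows "fd (\<lambda>y. f (a \<otimes> \<xi> y \<otimes> inv a)) x0 v = E v \<one> f"
proof -
  define \<kappa> where "\<kappa> = (\<lambda>a. fd (\<lambda>y. f (a \<otimes> \<xi> y \<otimes> inv a)) x0 v)"
  obtain W where W: "\<one> \<in> W" "smooth_fun_on M W f" using f unfolding smooth_near_def by auto
  have \<kappa>: "smooth_fun_on M (topspace (mtop M)) \<kappa>"
  proof (rule smooth_fun_onI[OF openin_topspace])
    fix S and \<eta> :: "'e \<Rightarrow> 'a" assume \<eta>: "plot M S \<eta>"
    note fst = plot_fst[OF \<eta> D_open] and snd = plot_snd[OF par(1) plot_open[OF \<eta>]]
    let ?T = "(S \<times> D) \<inter> (\<lambda>z. \<eta> (fst z) \<otimes> \<xi> (snd z) \<otimes> inv (\<eta> (fst z))) -` W"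
    have T: "Cinf ?T (\<lambda>z. f (\<eta> (fst z) \<otimes> \<xi> (snd z) \<otimes> inv (\<eta> (fst z))))"
      by (rule smooth_fun_on_plot[OF W(2) plot_mult[OF plot_mult[OF fst snd] plot_inv[OF fst]]])
    have eq: "{y. (y, x0) \<in> ?T} = S \<inter> \<eta> -` topspace (mtop M)"
      using x0_D W(1) plot_in_carrier[OF \<eta>] by (auto simp: topspace_carrier)
    show "Cinf (S \<inter> \<eta> -` topspace (mtop M)) (\<lambda>y. \<kappa> (\<eta> y))"
      using Cinf_partial_snd_curried[where H = "\<lambda>y x. f (\<eta> y \<otimes> \<xi> x \<otimes> inv (\<eta> y))", OF T, of x0 v]
      unfolding eq \<kappa>_def .
  qed
  have zero: "w \<kappa> = 0" if w: "w \<in> tangent_space M a" for w a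
  proof -
    have a: "a \<in> carrier G" using tangent_space_topspace[OF w] by (simp add: topspace_carrier)
    obtain u where u: "w = E u a" using tangent_E[OF w] by auto
    have "plot_map (\<lambda>q. a \<otimes> q \<otimes> inv a)"
      unfolding plot_map_def by (intro allI impI plot_rmult plot_lmult) (use a in simp_all)
    from smooth_near_pullback[OF this, of \<one> f]
    have fa: "smooth_near M \<one> (\<lambda>q. f (a \<otimes> q \<otimes> inv a))" using a f by (simp add: topspace_carrier)
    have "w \<kappa> = fd (\<lambda>z. \<kappa> (a \<otimes> \<xi> z)) x0 u"
      unfolding u by (rule E_apply[OF a]) (use \<kappa> a in \<open>auto simp: smooth_near_def topspace_carrier\<close>)
    also have "\<dots> = fd (\<lambda>z. fd (\<lambda>y. f (a \<otimes> (\<xi> z \<otimes> \<xi> y \<otimes> inv (\<xi> z)) \<otimes> inv a)) x0 v) x0 u"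
      unfolding \<kappa>_def
      by (rule fun_cong[OF fd_cong[OF D_open x0_D]], rule fun_cong[OF fd_cong[OF D_open x0_D]])
        (use a in \<open>simp add: m_assoc inv_mult_group\<close>)
    also have "\<dots> = 0" by (rule conjugation_second_derivative[OF br fa])
    finally show ?thesis .
  qed
  have "\<kappa> a = \<kappa> \<one>"
  proof (rule connected_locally_constant[where F = \<kappa>, OF conn])
    show "\<exists>V. openin (mtop M) V \<and> p \<in> V \<and> (\<forall>q\<in>V. \<kappa> q = \<kappa> p)" if p: "p \<in> topspace (mtop M)" for p
      by (rule locally_constant[OF \<kappa> _ p]) (rule zero)
  qed (use a in \<open>simp_all add: topspace_carrier\<close>)
  also have "\<kappa> \<one> = E v \<one> f"
    unfolding \<kappa>_def E_apply[OF one_closed f]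
    by (rule fun_cong[OF fd_cong[OF D_open x0_D]]) simp
  finally show ?thesis by (simp add: \<kappa>_def)
qed

text \<open>The map \<open>F x = a x a\<^sup>-\<^sup>1 x\<^sup>-\<^sup>1\<close> has derivative 0, because
  \<open>F (x y) = (a x a\<^sup>-\<^sup>1) (a y a\<^sup>-\<^sup>1) y\<^sup>-\<^sup>1 x\<^sup>-\<^sup>1\<close> and the derivative at \<open>y = \<one>\<close> of the conjugate cancels that of
  the inverse.\<close>

lemma connected_abelian:
  assumes br: "\<And>u v. lie_bracket M (E u) (E v) = (\<lambda>p f. 0)"
    and conn: "connected_space (mtop M)"
  shows "comm_group G"
proof (rule group_comm_groupI)
  fix a b assume a: "a \<in> carrier G" and b: "b \<in> carrier G"
  define F where "F = (\<lambda>x. a \<otimes> x \<otimes> inv a \<otimes> inv x)"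
  have F: "plot_map F"
    unfolding plot_map_def F_def
    by (intro allI impI, rule plot_mult[OF plot_rmult[OF inv_closed[OF a] plot_lmult[OF a]] plot_inv])
  have zero: "u (\<lambda>r. f (F r)) = 0" if u: "u \<in> tangent_space M x" and f: "smooth_near M (F x) f" for x u f
  proof -
    have xM: "x \<in> topspace (mtop M)" by (rule tangent_space_topspace[OF u])
    then have x: "x \<in> carrier G" by (simp add: topspace_carrier)
    obtain v where v: "u = E v x" using tangent_E[OF u] by auto
    define f' where "f' = (\<lambda>q. f (a \<otimes> x \<otimes> inv a \<otimes> q \<otimes> inv x))"
    have "plot_map (\<lambda>q. a \<otimes> x \<otimes> inv a \<otimes> q \<otimes> inv x)"
      unfolding plot_map_def by (intro allI impI plot_rmult plot_lmult) (use a x in simp_all)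
    from smooth_near_pullback[OF this, of \<one> f]
    have f': "smooth_near M \<one> f'" using a x f by (simp add: topspace_carrier f'_def F_def)
    obtain W where W: "\<one> \<in> W" "smooth_fun_on M W f'" using f' unfolding smooth_near_def by auto
    note fst = plot_fst[OF par(1) D_open] and snd = plot_snd[OF par(1) D_open]
    have K: "plot M (D \<times> D) (\<lambda>z. a \<otimes> \<xi> (fst z) \<otimes> inv a \<otimes> inv (\<xi> (snd z)))"
      by (rule plot_mult[OF plot_rmult[OF inv_closed[OF a] plot_lmult[OF a fst]] plot_inv[OF snd]])
    have "u (\<lambda>r. f (F r)) = fd (\<lambda>y. f (F (x \<otimes> \<xi> y))) x0 v"
      unfolding v by (rule E_apply[OF x smooth_near_pullback[OF F f xM]])
    also have "\<dots> = fd (\<lambda>y. f' (a \<otimes> \<xi> y \<otimes> inv a \<otimes> inv (\<xi> y))) x0 v"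
      by (rule fun_cong[OF fd_cong[OF D_open x0_D]])
        (use a x in \<open>simp add: f'_def F_def m_assoc inv_mult_group\<close>)
    also have "\<dots> = fd (\<lambda>y. f' (a \<otimes> \<xi> y \<otimes> inv a \<otimes> inv (\<xi> x0))) x0 v +
        fd (\<lambda>y. f' (a \<otimes> \<xi> x0 \<otimes> inv a \<otimes> inv (\<xi> y))) x0 v"
      by (rule fd_diagonal_curried[where H = "\<lambda>y z. f' (a \<otimes> \<xi> y \<otimes> inv a \<otimes> inv (\<xi> z))",
            OF smooth_fun_on_plot[OF W(2) K]]) (use x0_D W(1) a in simp)
    also have "fd (\<lambda>y. f' (a \<otimes> \<xi> y \<otimes> inv a \<otimes> inv (\<xi> x0))) x0 = fd (\<lambda>y. f' (a \<otimes> \<xi> y \<otimes> inv a)) x0"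
      by (rule fd_cong[OF D_open x0_D]) (use a in simp)
    also have "fd (\<lambda>y. f' (a \<otimes> \<xi> y \<otimes> inv a)) x0 v = E v \<one> f'" by (rule Ad_trivial[OF br conn a f'])
    also have "fd (\<lambda>y. f' (a \<otimes> \<xi> x0 \<otimes> inv a \<otimes> inv (\<xi> y))) x0 v = - E v \<one> f'"
      using fd_inverse[OF one_closed f', of v] a by simp
    finally show ?thesis by simp
  qed
  have "F b = F \<one>"
  proof (rule connected_locally_constant[where F = F, OF conn])
    show "\<exists>V. openin (mtop M) V \<and> p \<in> V \<and> (\<forall>q\<in>V. F q = F p)" if p: "p \<in> topspace (mtop M)" for p
    proof (rule map_locally_constant[where F = F, OF F _ p])
      show "u (\<lambda>r. f (F r)) = 0" if "u \<in> tangent_space M q" "smooth_near M (F q) f" for q u f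
        by (rule zero[OF that])
      show "F p \<in> topspace (mtop M)" using p a by (simp add: topspace_carrier F_def)
    qed
  qed (use b in \<open>simp_all add: topspace_carrier\<close>)
  then have 1: "a \<otimes> b \<otimes> inv a \<otimes> inv b = \<one>" using a by (simp add: F_def)
  have "a \<otimes> b = (a \<otimes> b \<otimes> inv a \<otimes> inv b) \<otimes> (b \<otimes> a)" using a b by (simp add: m_assoc)
  then show "a \<otimes> b = b \<otimes> a" using a b by (simp add: 1)
qed

end


section \<open>Orthonormalisation and sums of structure constants\<close>

text \<open>The form \<open>B\<close> will be the metric at the unit pulled back to \<open>'e\<close>, where several vectors may represent
  the same tangent vector, so it is only semidefinite.  Spanning is therefore expressed through \<open>B\<close>.\<close>

lemma gram_schmidt:
  fixes B :: "'e::real_vector \<Rightarrow> 'e \<Rightarrow> real"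
  assumes lin: "\<And>a b x y z. B (a *\<^sub>R x + b *\<^sub>R y) z = a * B x z + b * B y z"
    and sym: "\<And>x y. B x y = B y x" and pos: "\<And>x. B x x \<ge> 0"
    and null: "\<And>x y. B x x = 0 \<Longrightarrow> B x y = 0"
    and S: "finite S"
  shows "\<exists>N. finite N \<and> (\<forall>m\<in>N. \<forall>n\<in>N. B m n = (if m = n then 1 else 0)) \<and>
    (\<forall>s\<in>S. \<forall>y. B s y = (\<Sum>n\<in>N. B s n * B n y))"
  using S
proof induction
  case empty
  then show ?case by (intro exI[of _ "{}"]) simp
next
  case (insert s S)
  then obtain N where ex: "finite N \<and> (\<forall>m\<in>N. \<forall>n\<in>N. B m n = (if m = n then 1 else 0)) \<and>
    (\<forall>s\<in>S. \<forall>y. B s y = (\<Sum>n\<in>N. B s n * B n y))" by (elim exE)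
  have N: "finite N" "\<And>m n. m \<in> N \<Longrightarrow> n \<in> N \<Longrightarrow> B m n = (if m = n then 1 else 0)"
    "\<And>s y. s \<in> S \<Longrightarrow> B s y = (\<Sum>n\<in>N. B s n * B n y)" using ex by blast+
  have linB: "linear (\<lambda>x. B x z)" for z
    using lin[of 1 _ 1 _ z] lin[of _ _ 0 0 z] by (intro linearI) simp_all
  define r where "r = s - (\<Sum>n\<in>N. B s n *\<^sub>R n)"
  have Br: "B r y = B s y - (\<Sum>n\<in>N. B s n * B n y)" for y
    unfolding r_def by (simp add: linear_diff[OF linB] linear_sum[OF linB] linear_scale[OF linB])
  show ?case
  proof (cases "B r r = 0")
    case True
    then have "B s y = (\<Sum>n\<in>N. B s n * B n y)" for y using null[OF True, of y] Br[of y] by simp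
    then have "\<forall>x\<in>insert s S. \<forall>y. B x y = (\<Sum>n\<in>N. B x n * B n y)" using N(3) by blast
    then show ?thesis using ex by blast
  next
    case False
    \<comment> \<open>The residue \<open>r\<close> is orthogonal to \<open>N\<close> and, normalised, becomes the new basis vector.\<close>
    define t where "t = (1 / sqrt (B r r)) *\<^sub>R r"
    have rr: "B r r > 0" using False pos[of r] by simp
    have Bt: "B t y = B r y / sqrt (B r r)" for y
      unfolding t_def using linear_scale[OF linB] by simp
    have rn: "B r n = 0" if n: "n \<in> N" for n
    proof -
      have "(\<Sum>m\<in>N. B s m * B m n) = (\<Sum>m\<in>N. if m = n then B s m else 0)"
        by (rule sum.cong) (use N(2) n in auto)
      then show ?thesis using Br[of n] n N(1) by simp
    qed
    have tn: "B t n = 0" "B n t = 0" if "n \<in> N" for n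
      using Bt rn[OF that] sym by simp_all
    have "B r t = sqrt (B r r)" using sym[of r t] Bt[of r] rr by (simp add: real_div_sqrt)
    moreover have tt: "B t t = 1" using calculation Bt[of t] rr by simp
    moreover have "B s t = B r t" using Br[of t] tn(2) by simp
    ultimately have st: "B s t * B t y = B r y" for y using Bt[of y] rr by simp
    have tN: "t \<notin> N" using tn(1)[of t] tt by auto
    have new: "(\<Sum>n\<in>insert t N. B x n * B n y) = B x t * B t y + (\<Sum>n\<in>N. B x n * B n y)" for x y
      using N(1) tN by simp
    have exp: "B x y = (\<Sum>n\<in>insert t N. B x n * B n y)" if "x \<in> insert s S" for x y
    proof (cases "x = s")
      case True
      then show ?thesis using st[of y] Br[of y] unfolding new by simp
    next
      case False
      then have x: "x \<in> S" using that by simp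
      have "B x t = 0" using N(3)[OF x, of t] tn(2) by simp
      then show ?thesis unfolding new using N(3)[OF x, of y] by simp
    qed
    have orth: "B m n = (if m = n then 1 else 0)" if "m \<in> insert t N" "n \<in> insert t N" for m n
      using that N(2) tn tt tN by auto
    show ?thesis
      by (rule exI[of _ "insert t N"], intro conjI ballI allI)
        (rule finite.insertI[OF N(1)], rule orth, assumption, assumption, rule exp, assumption)
  qed
qed

lemma sum_cyclic_shift:
  "(\<Sum>a\<in>N. \<Sum>b\<in>N. \<Sum>c\<in>N. F b c a) = (\<Sum>a\<in>N. \<Sum>b\<in>N. \<Sum>c\<in>N. (F a b c :: real))"
proof -
  have "(\<Sum>a\<in>N. \<Sum>b\<in>N. \<Sum>c\<in>N. F b c a) = (\<Sum>b\<in>N. \<Sum>a\<in>N. \<Sum>c\<in>N. F b c a)"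
    by (rule sum.swap)
  also have "\<dots> = (\<Sum>b\<in>N. \<Sum>c\<in>N. \<Sum>a\<in>N. F b c a)"
    by (rule sum.cong[OF refl]) (rule sum.swap)
  finally show ?thesis .
qed

text \<open>In the sum of the assumption \<open>K\<close> over \<open>i\<close> and \<open>j\<close>, the first term gives \<open>- H\<close> with \<open>H \<ge> 0\<close>, the last
  one \<open>- C\<close> with \<open>C\<close> the sum of all squares, and the middle one \<open>C + P\<close>, where \<open>P\<close> contracts \<open>c\<close> with its
  cyclic shift.  Multiplying the cyclic identity by \<open>c i j k\<close> and summing gives \<open>C + 2 P = 0\<close>, so the
  total is \<open>- H - C / 2\<close>.\<close>

lemma scalar_curvature_vanishing:
  fixes c :: "'i \<Rightarrow> 'i \<Rightarrow> 'i \<Rightarrow> real"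
  assumes N: "finite N"
    and anti: "\<And>i j k. c j i k = - c i j k"
    and cyc: "\<And>i j k. i \<in> N \<Longrightarrow> j \<in> N \<Longrightarrow> k \<in> N \<Longrightarrow> c i j k + c j k i + c k i j = 0"
    and K: "\<And>i j. i \<in> N \<Longrightarrow> j \<in> N \<Longrightarrow>
      (\<Sum>k\<in>N. - (c k j j * c k i i) + c k j i * c k i j - c i j k * c i j k) = 0"
    and ijk: "i \<in> N" "j \<in> N" "k \<in> N"
  shows "c i j k = 0"
proof -
  define C where "C = (\<Sum>i\<in>N. \<Sum>j\<in>N. \<Sum>k\<in>N. c i j k * c i j k)"
  define P where "P = (\<Sum>i\<in>N. \<Sum>j\<in>N. \<Sum>k\<in>N. c i j k * c j k i)"
  define H where "H = (\<Sum>i\<in>N. \<Sum>j\<in>N. \<Sum>k\<in>N. c k j j * c k i i)"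
  have "(\<Sum>i\<in>N. \<Sum>j\<in>N. \<Sum>k\<in>N. c k i j * c i j k) = (\<Sum>i\<in>N. \<Sum>j\<in>N. \<Sum>k\<in>N. c j k i * c k i j)"
    by (rule sum_cyclic_shift[of "\<lambda>i j k. c j k i * c k i j"])
  also have "\<dots> = P"
    unfolding P_def by (rule sum_cyclic_shift[of "\<lambda>i j k. c i j k * c j k i"])
  finally have "(\<Sum>i\<in>N. \<Sum>j\<in>N. \<Sum>k\<in>N. c k i j * c i j k) = P" .
  then have P': "(\<Sum>i\<in>N. \<Sum>j\<in>N. \<Sum>k\<in>N. c i j k * c k i j) = P" by (simp add: mult.commute)
  have "(\<Sum>i\<in>N. \<Sum>j\<in>N. \<Sum>k\<in>N. c i j k * (c i j k + c j k i + c k i j)) = 0"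
    by (intro sum.neutral ballI) (simp add: cyc)
  then have CP: "C + P + P = 0"
    unfolding distrib_left sum.distrib P' C_def[symmetric] P_def[symmetric] .
  have Q: "c k j i * c k i j = c j k i * c j k i + c j k i * c i j k" if "i \<in> N" "j \<in> N" "k \<in> N" for i j k
  proof -
    have 1: "c k i j = - c i j k - c j k i" using cyc[OF that] by simp
    have 2: "c k j i = - c j k i" by (rule anti)
    show ?thesis unfolding 1 2 by (simp add: algebra_simps)
  qed
  have "(\<Sum>i\<in>N. \<Sum>j\<in>N. \<Sum>k\<in>N. c k j i * c k i j) =
      (\<Sum>i\<in>N. \<Sum>j\<in>N. \<Sum>k\<in>N. c j k i * c j k i + c j k i * c i j k)"
    by (intro sum.cong refl Q)
  also have "\<dots> = C + P"
    unfolding sum.distrib C_def P_def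
    using sum_cyclic_shift[of "\<lambda>i j k. c i j k * c i j k" N] by (simp add: mult.commute)
  finally have Q': "(\<Sum>i\<in>N. \<Sum>j\<in>N. \<Sum>k\<in>N. c k j i * c k i j) = C + P" .
  have "(\<Sum>i\<in>N. \<Sum>j\<in>N. \<Sum>k\<in>N. - (c k j j * c k i i) + c k j i * c k i j - c i j k * c i j k) = 0"
    by (intro sum.neutral ballI K)
  then have "- H + (C + P) - C = 0"
    unfolding sum.distrib sum_subtractf sum_negf Q' H_def C_def .
  moreover have "H = (\<Sum>k\<in>N. (\<Sum>i\<in>N. c k i i) * (\<Sum>i\<in>N. c k i i))"
  proof -
    have "H = (\<Sum>i\<in>N. \<Sum>k\<in>N. \<Sum>j\<in>N. c k i i * c k j j)"
      unfolding H_def by (rule sum_cyclic_shift[of "\<lambda>i k j. c k i i * c k j j"])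
    also have "\<dots> = (\<Sum>k\<in>N. \<Sum>i\<in>N. \<Sum>j\<in>N. c k i i * c k j j)" by (rule sum.swap)
    finally have "H = (\<Sum>k\<in>N. \<Sum>i\<in>N. \<Sum>j\<in>N. c k i i * c k j j)" .
    then show ?thesis by (simp add: sum_product)
  qed
  then have "H \<ge> 0" by (simp add: sum_nonneg)
  moreover have "C \<ge> 0" unfolding C_def by (intro sum_nonneg) simp
  ultimately have "C = 0" using CP by linarith
  then have "\<forall>i\<in>N. (\<Sum>j\<in>N. \<Sum>k\<in>N. c i j k * c i j k) = 0"
    unfolding C_def by (subst (asm) sum_nonneg_eq_0_iff[OF N]) (auto intro!: sum_nonneg)
  then have "\<forall>j\<in>N. (\<Sum>k\<in>N. c i j k * c i j k) = 0"
    using ijk(1) by (subst (asm) sum_nonneg_eq_0_iff[OF N]) (auto intro!: sum_nonneg)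
  then have "\<forall>k\<in>N. c i j k * c i j k = 0"
    using ijk(2) by (subst (asm) sum_nonneg_eq_0_iff[OF N]) auto
  then show ?thesis using ijk(3) by simp
qed

text \<open>Relabelling the second double sum exposes the torsion \<open>\<Gamma> i j k - \<Gamma> j i k\<close> of the coefficients.\<close>

lemma torsion_sum:
  fixes x y e :: "'i \<Rightarrow> real" and \<Gamma> :: "'i \<Rightarrow> 'i \<Rightarrow> 'i \<Rightarrow> real"
  shows "(\<Sum>k\<in>N. ((\<Sum>i\<in>N. \<Sum>j\<in>N. x i * y j * \<Gamma> i j k) - (\<Sum>i\<in>N. \<Sum>j\<in>N. y i * x j * \<Gamma> i j k)) * e k) =
    (\<Sum>i\<in>N. \<Sum>j\<in>N. x i * y j * (\<Sum>k\<in>N. (\<Gamma> i j k - \<Gamma> j i k) * e k))"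
proof -
  have "(\<Sum>i\<in>N. \<Sum>j\<in>N. y i * x j * \<Gamma> i j k) = (\<Sum>i\<in>N. \<Sum>j\<in>N. x i * y j * \<Gamma> j i k)" for k
    by (subst sum.swap) (simp add: mult.commute)
  then have "(\<Sum>k\<in>N. ((\<Sum>i\<in>N. \<Sum>j\<in>N. x i * y j * \<Gamma> i j k) - (\<Sum>i\<in>N. \<Sum>j\<in>N. y i * x j * \<Gamma> i j k)) * e k) =
      (\<Sum>k\<in>N. (\<Sum>i\<in>N. \<Sum>j\<in>N. x i * y j * ((\<Gamma> i j k - \<Gamma> j i k) * e k)))"
    by (simp only: sum_subtractf[symmetric] sum_distrib_right) (intro sum.cong refl, simp add: algebra_simps)
  also have "\<dots> = (\<Sum>i\<in>N. \<Sum>j\<in>N. \<Sum>k\<in>N. x i * y j * ((\<Gamma> i j k - \<Gamma> j i k) * e k))"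
    by (rule sum_cyclic_shift[of "\<lambda>i j k. x i * y j * ((\<Gamma> i j k - \<Gamma> j i k) * e k)"])
  finally show ?thesis by (simp add: sum_distrib_left)
qed

text \<open>The coefficients of a metric connection in an orthonormal frame are skew in the last two indices, and
  so they do not contribute to the derivative of an inner product.\<close>

lemma skew_sum:
  fixes x y z :: "'i \<Rightarrow> real" and \<Gamma> :: "'i \<Rightarrow> 'i \<Rightarrow> 'i \<Rightarrow> real"
  assumes skew: "\<And>i j k. \<Gamma> i k j = - \<Gamma> i j k"
  shows "(\<Sum>k\<in>N. (\<Sum>i\<in>N. \<Sum>j\<in>N. x i * y j * \<Gamma> i j k) * z k) +
    (\<Sum>k\<in>N. y k * (\<Sum>i\<in>N. \<Sum>j\<in>N. x i * z j * \<Gamma> i j k)) = 0"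
proof -
  have "(\<Sum>k\<in>N. y k * (\<Sum>i\<in>N. \<Sum>j\<in>N. x i * z j * \<Gamma> i j k)) =
      (\<Sum>k\<in>N. \<Sum>i\<in>N. \<Sum>j\<in>N. x i * y k * \<Gamma> i j k * z j)"
    by (simp add: sum_distrib_left mult_ac)
  also have "\<dots> = (\<Sum>i\<in>N. \<Sum>k\<in>N. \<Sum>j\<in>N. x i * y k * \<Gamma> i j k * z j)" by (rule sum.swap)
  also have "\<dots> = (\<Sum>i\<in>N. \<Sum>k\<in>N. \<Sum>j\<in>N. - (x i * y k * \<Gamma> i k j * z j))"
  proof (intro sum.cong refl)
    fix i k j
    show "x i * y k * \<Gamma> i j k * z j = - (x i * y k * \<Gamma> i k j * z j)" using skew[of i j k] by simp
  qed
  finally have 1: "(\<Sum>k\<in>N. y k * (\<Sum>i\<in>N. \<Sum>j\<in>N. x i * z j * \<Gamma> i j k)) =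
      - (\<Sum>i\<in>N. \<Sum>k\<in>N. \<Sum>j\<in>N. x i * y k * \<Gamma> i k j * z j)" by (simp add: sum_negf)
  have "(\<Sum>k\<in>N. (\<Sum>i\<in>N. \<Sum>j\<in>N. x i * y j * \<Gamma> i j k) * z k) =
      (\<Sum>k\<in>N. \<Sum>i\<in>N. \<Sum>j\<in>N. x i * y j * \<Gamma> i j k * z k)"
    by (simp add: sum_distrib_right)
  also have "\<dots> = (\<Sum>i\<in>N. \<Sum>j\<in>N. \<Sum>k\<in>N. x i * y j * \<Gamma> i j k * z k)"
    by (rule sum_cyclic_shift[of "\<lambda>i j k. x i * y j * \<Gamma> i j k * z k"])
  finally show ?thesis using 1 by simp
qed


section \<open>Orthonormal frames of left-invariant fields\<close>

locale metric_lie_grp = lie_grp_chart G M U \<phi> D \<xi> x0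
  for G :: "'a monoid" (structure) and M :: "('a, 'e::euclidean_space) manifold_data"
    and U \<phi> D \<xi> x0 +
  fixes g :: "'a metric_tensor"
  assumes metric: "metric_lie_group G M g"
begin

lemma riemannian: "riemannian_metric M g"
  using metric by (simp add: metric_lie_group_def)

lemma g_sym:
  assumes "u \<in> tangent_space M p" "v \<in> tangent_space M p"
  shows "g p u v = g p v u"
  using riemannian assms tangent_space_topspace[OF assms(1)] by (simp add: riemannian_metric_def)

lemma g_linear:
  assumes "u \<in> tangent_space M p" "v \<in> tangent_space M p" "w \<in> tangent_space M p"
  shows "g p (\<lambda>f. a * u f + b * v f) w = a * g p u w + b * g p v w"
  using riemannian assms tangent_space_topspace[OF assms(1)] by (simp add: riemannian_metric_def)

lemma g_pos:
  assumes "u \<in> tangent_space M p" "u \<noteq> (\<lambda>_. 0)"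
  shows "g p u u > 0"
  using riemannian assms tangent_space_topspace[OF assms(1)] by (simp add: riemannian_metric_def)

lemma g_smooth:
  "X \<in> vector_fields M \<Longrightarrow> Y \<in> vector_fields M \<Longrightarrow>
    smooth_fun_on M (topspace (mtop M)) (\<lambda>p. g p (X p) (Y p))"
  using riemannian by (simp add: riemannian_metric_def)

lemma tangent_space_zero:
  assumes "p \<in> carrier G" shows "(\<lambda>_. 0) \<in> tangent_space M p"
  using tangent_space_linear[OF E_tangent[OF assms] E_tangent[OF assms], of 0 0 0 0] by simp

lemma g_zero:
  assumes "v \<in> tangent_space M p" shows "g p (\<lambda>_. 0) v = 0"
  using g_linear[OF assms assms assms, of 0 0] by simp

lemma tangent_space_sum:
  assumes p: "p \<in> carrier G" and u: "\<And>i. i \<in> I \<Longrightarrow> u i \<in> tangent_space M p"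
  shows "(\<lambda>f. \<Sum>i\<in>I. a i * u i f) \<in> tangent_space M p"
  using u
proof (induction I rule: infinite_finite_induct)
  case (insert i I)
  have "(\<lambda>f. a i * u i f + 1 * (\<Sum>i\<in>I. a i * u i f)) \<in> tangent_space M p"
    by (rule tangent_space_linear[OF insert.prems[OF insertI1] insert.IH[OF insert.prems[OF insertI2]]])
  then show ?case using insert(1,2) by simp
qed (simp_all add: tangent_space_zero[OF p])

lemma g_sum:
  assumes v: "v \<in> tangent_space M p" and u: "\<And>i. i \<in> I \<Longrightarrow> u i \<in> tangent_space M p"
  shows "g p (\<lambda>f. \<Sum>i\<in>I. a i * u i f) v = (\<Sum>i\<in>I. a i * g p (u i) v)"
  using u
proof (induction I rule: infinite_finite_induct)
  case (insert i I)
  have p: "p \<in> carrier G" using tangent_space_topspace[OF v] by (simp add: topspace_carrier)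
  have I: "(\<lambda>f. \<Sum>i\<in>I. a i * u i f) \<in> tangent_space M p"
    by (rule tangent_space_sum[OF p insert.prems[OF insertI2]])
  have "g p (\<lambda>f. a i * u i f + 1 * (\<Sum>i\<in>I. a i * u i f)) v =
      a i * g p (u i) v + 1 * g p (\<lambda>f. \<Sum>i\<in>I. a i * u i f) v"
    by (rule g_linear[OF insert.prems[OF insertI1] I v])
  then show ?case using insert by simp
qed (simp_all add: g_zero[OF v])

lemma g_E:
  assumes p: "p \<in> carrier G"
  shows "g p (E v p) (E w p) = g \<one> (E v \<one>) (E w \<one>)"
proof -
  have "g (a \<otimes> x) (left_translate G M a x u) (left_translate G M a x u') = g x u u'"
    if "a \<in> carrier G" "x \<in> carrier G" "u \<in> tangent_space M x" "u' \<in> tangent_space M x" for a x u u'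
    using metric that by (simp add: metric_lie_group_def)
  from this[OF p one_closed E_tangent[OF one_closed] E_tangent[OF one_closed]]
  have "g (p \<otimes> \<one>) (left_translate G M p \<one> (E v \<one>)) (left_translate G M p \<one> (E w \<one>)) =
      g \<one> (E v \<one>) (E w \<one>)" .
  then show ?thesis by (simp add: left_translate_E[OF p one_closed] p)
qed

lemma linear_E: "linear (\<lambda>w. E w p f)"
  using E_linear[of 1 _ 1 _ p] E_linear[of _ _ 0 0 p] by (intro linearI) (simp_all add: fun_eq_iff)

text \<open>Orthonormality at the unit propagates to every point by left invariance, and so does the expansion
  of the remaining left-invariant fields.\<close>

lemma orthonormal_frame_exists:
  "\<exists>N. finite N \<and> (\<forall>m\<in>N. \<forall>n\<in>N. g \<one> (E m \<one>) (E n \<one>) = (if m = n then 1 else 0)) \<and>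
    (\<forall>w p f. E w p f = (\<Sum>n\<in>N. g \<one> (E w \<one>) (E n \<one>) * E n p f))"
proof -
  define B where "B = (\<lambda>v w. g \<one> (E v \<one>) (E w \<one>))"
  note T = E_tangent[OF one_closed]
  have lin: "B (a *\<^sub>R x + b *\<^sub>R y) z = a * B x z + b * B y z" for a b x y z
    unfolding B_def E_linear by (rule g_linear[OF T T T])
  have pos: "B x x \<ge> 0" for x
    using g_pos[OF T, of x] g_zero[OF T, of x] unfolding B_def by (cases "E x \<one> = (\<lambda>_. 0)") auto
  have null: "B x y = 0" if "B x x = 0" for x y
    using g_pos[OF T, of x] g_zero[OF T, of y] that unfolding B_def by (cases "E x \<one> = (\<lambda>_. 0)") auto
  obtain N where N: "finite N" "\<forall>m\<in>N. \<forall>n\<in>N. B m n = (if m = n then 1 else 0)"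
    "\<forall>s\<in>Basis. \<forall>y. B s y = (\<Sum>n\<in>N. B s n * B n y)"
    using gram_schmidt[OF lin _ pos null finite_Basis] g_sym[OF T T] unfolding B_def by auto
  have linB: "linear (\<lambda>x. B x z)" for z
    using lin[of 1 _ 1 _ z] lin[of _ _ 0 0 z] by (intro linearI) simp_all
  have Bexp: "B w y = (\<Sum>n\<in>N. B w n * B n y)" for w y
  proof -
    have "linear (\<lambda>w. \<Sum>n\<in>N. B w n * B n y)"
      by (rule linear_compose_sum) (use linear_compose_scale_right[OF linB] in \<open>simp add: mult.commute\<close>)
    then have "(\<lambda>w. B w y) = (\<lambda>w. \<Sum>n\<in>N. B w n * B n y)"
      by (rule linear_eq_stdbasis[OF linB]) (rule N(3)[rule_format])
    then show ?thesis by (rule fun_cong)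
  qed
  have "E w p f = (\<Sum>n\<in>N. B w n * E n p f)" for w p f
  proof (cases "p \<in> carrier G")
    case True
    define r where "r = w - (\<Sum>n\<in>N. B w n *\<^sub>R n)"
    have "B r r = 0"
      using Bexp[of w r]
      by (subst r_def) (simp add: linear_diff[OF linB] linear_sum[OF linB] linear_scale[OF linB])
    then have "g p (E r p) (E r p) = 0" using g_E[OF True] by (simp add: B_def)
    then have "E r p = (\<lambda>_. 0)" using g_pos[OF E_tangent[OF True], of r] by (cases "E r p = (\<lambda>_. 0)") auto
    then have "E r p f = 0" by simp
    then show ?thesis
      unfolding r_def by (simp add: linear_diff[OF linear_E] linear_sum[OF linear_E] linear_scale[OF linear_E])
  qed (simp add: E_def)
  then show ?thesis using N(1,2) unfolding B_def by blast
qed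

end

locale lie_frame = metric_lie_grp G M U \<phi> D \<xi> x0 g
  for G :: "'a monoid" (structure) and M :: "('a, 'e::euclidean_space) manifold_data"
    and U \<phi> D \<xi> x0 g +
  fixes N :: "'e set"
  assumes finN: "finite N"
    and orth: "\<And>m n. m \<in> N \<Longrightarrow> n \<in> N \<Longrightarrow> g \<one> (E m \<one>) (E n \<one>) = (if m = n then 1 else 0)"
    and span: "\<And>w p f. E w p f = (\<Sum>n\<in>N. g \<one> (E w \<one>) (E n \<one>) * E n p f)"
begin

definition coord :: "'a vfield \<Rightarrow> 'e \<Rightarrow> 'a \<Rightarrow> real" where
  "coord X n p = g p (X p) (E n p)"

lemma tangent_expand:
  assumes u: "u \<in> tangent_space M p"
  shows "u f = (\<Sum>n\<in>N. g p u (E n p) * E n p f)"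
proof -
  have p: "p \<in> carrier G" using tangent_space_topspace[OF u] by (simp add: topspace_carrier)
  obtain w where w: "u = E w p" using tangent_E[OF u] by auto
  show ?thesis unfolding w g_E[OF p] by (rule span)
qed

lemma g_expand:
  assumes u: "u \<in> tangent_space M p" and v: "v \<in> tangent_space M p"
  shows "g p u v = (\<Sum>n\<in>N. g p u (E n p) * g p v (E n p))"
proof -
  have p: "p \<in> carrier G" using tangent_space_topspace[OF u] by (simp add: topspace_carrier)
  have "u = (\<lambda>f. \<Sum>n\<in>N. g p u (E n p) * E n p f)" using tangent_expand[OF u] by auto
  then have "g p u v = g p (\<lambda>f. \<Sum>n\<in>N. g p u (E n p) * E n p f) v" by simp
  also have "\<dots> = (\<Sum>n\<in>N. g p u (E n p) * g p (E n p) v)" by (rule g_sum[OF v E_tangent[OF p]])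
  finally show ?thesis using g_sym[OF v E_tangent[OF p]] by simp
qed

lemma vector_field_expand:
  assumes X: "X \<in> vector_fields M"
  shows "X p f = (\<Sum>n\<in>N. coord X n p * E n p f)"
proof (cases "p \<in> carrier G")
  case True
  then show ?thesis
    unfolding coord_def
    by (intro tangent_expand vector_field_tangent X) (simp add: topspace_carrier)
next
  case False
  then show ?thesis using vector_field_outside[OF X] by (simp add: topspace_carrier E_def)
qed

lemma coord_smooth: "X \<in> vector_fields M \<Longrightarrow> smooth_fun_on M (topspace (mtop M)) (coord X n)"
  unfolding coord_def[abs_def] by (rule g_smooth[OF _ E_vector_field])

lemma coord_smooth_near: "X \<in> vector_fields M \<Longrightarrow> p \<in> carrier G \<Longrightarrow> smooth_near M p (coord X n)"
  unfolding smooth_near_def using coord_smooth topspace_carrier by blast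

text \<open>The index set \<open>A\<close> is arbitrary to allow inductions over subsets of the frame.\<close>

lemma comb_vector_field:
  assumes h: "\<And>n. n \<in> A \<Longrightarrow> smooth_fun_on M (topspace (mtop M)) (h n)"
  shows "(\<lambda>p f. \<Sum>n\<in>A. h n p * E n p f) \<in> vector_fields M"
proof (rule vector_fieldI)
  show "(\<lambda>f. \<Sum>n\<in>A. h n p * E n p f) \<in> tangent_space M p" if "p \<in> topspace (mtop M)" for p
    using that by (intro tangent_space_sum E_tangent) (simp_all add: topspace_carrier)
  show "(\<lambda>f. \<Sum>n\<in>A. h n p * E n p f) = (\<lambda>_. 0)" if "p \<notin> topspace (mtop M)" for p
    using that by (simp add: topspace_carrier E_def)
  fix W f assume f: "smooth_fun_on M W f"
  note W = smooth_fun_on_openin[OF f]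
  show "smooth_fun_on M W (\<lambda>p. \<Sum>n\<in>A. h n p * E n p f)"
    by (rule smooth_fun_on_sum[OF W smooth_fun_on_mult[OF
            smooth_fun_on_subset[OF h W openin_subset[OF W]] vector_field_smooth[OF E_vector_field f]]])
qed

lemma coord_comb:
  assumes p: "p \<in> carrier G" and k: "k \<in> N"
  shows "coord (\<lambda>p f. \<Sum>n\<in>N. h n p * E n p f) k p = h k p"
proof -
  have "coord (\<lambda>p f. \<Sum>n\<in>N. h n p * E n p f) k p = (\<Sum>n\<in>N. h n p * g p (E n p) (E k p))"
    unfolding coord_def by (rule g_sum[OF E_tangent[OF p] E_tangent[OF p]])
  also have "\<dots> = (\<Sum>n\<in>N. if n = k then h n p else 0)"
    by (rule sum.cong) (use orth k in \<open>auto simp: g_E[OF p]\<close>)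
  finally show ?thesis using finN k by simp
qed


section \<open>Structure constants\<close>

definition c :: "'e \<Rightarrow> 'e \<Rightarrow> 'e \<Rightarrow> real" where
  "c i j k = g \<one> (lie_bracket M (E i) (E j) \<one>) (E k \<one>)"

lemma bracket_coord:
  assumes p: "p \<in> carrier G"
  shows "g p (lie_bracket M (E i) (E j) p) (E k p) = c i j k"
proof -
  obtain w where w: "lie_bracket M (E i) (E j) = E w"
    using lie_algebra_E[OF lie_bracket_lie_algebra[OF E_lie_algebra E_lie_algebra]] by auto
  show ?thesis unfolding c_def w by (rule g_E[OF p])
qed

lemma bracket_expand: "lie_bracket M (E i) (E j) p f = (\<Sum>k\<in>N. c i j k * E k p f)"
proof (cases "p \<in> carrier G")
  case True
  have "lie_bracket M (E i) (E j) p \<in> tangent_space M p"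
    by (rule lie_bracket_tangent[OF E_vector_field E_vector_field]) (simp add: topspace_carrier True)
  from tangent_expand[OF this] show ?thesis by (simp only: bracket_coord[OF True])
qed (simp add: lie_bracket_def E_def)

lemma c_anti: "c j i k = - c i j k"
proof -
  have T: "lie_bracket M (E i) (E j) \<one> \<in> tangent_space M \<one>"
    by (rule lie_bracket_tangent[OF E_vector_field E_vector_field]) (simp add: topspace_carrier)
  have "lie_bracket M (E j) (E i) \<one> = (\<lambda>f. (-1) * lie_bracket M (E i) (E j) \<one> f + 0 * lie_bracket M (E i) (E j) \<one> f)"
    by (auto simp: lie_bracket_def)
  then show ?thesis
    unfolding c_def using g_linear[OF T T E_tangent[OF one_closed], of "-1" 0 k] by simp
qed

text \<open>The fields \<open>E u\<close> and \<open>E v\<close> are combinations of the frame with constant coefficients.\<close>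

lemma bracket_zero:
  assumes c0: "\<And>i j k. i \<in> N \<Longrightarrow> j \<in> N \<Longrightarrow> k \<in> N \<Longrightarrow> c i j k = 0"
  shows "lie_bracket M (E u) (E v) = (\<lambda>p f. 0)"
proof (intro ext)
  fix p f
  define B where "B = (\<lambda>v w. g \<one> (E v \<one>) (E w \<one>))"
  show "lie_bracket M (E u) (E v) p f = 0"
  proof (cases "p \<in> carrier G \<and> smooth_near M p f")
    case True
    then have p: "p \<in> carrier G" and f: "smooth_near M p f" by auto
    have pM: "p \<in> topspace (mtop M)" using p by (simp add: topspace_carrier)
    have EE: "E u p (\<lambda>q. E v q f) = (\<Sum>m\<in>N. \<Sum>n\<in>N. B u m * B v n * E m p (\<lambda>q. E n q f))" for u v
    proof -
      have "E m p (\<lambda>q. E v q f) = (\<Sum>n\<in>N. B v n * E m p (\<lambda>q. E n q f))" for m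
      proof -
        have s: "smooth_near M p (\<lambda>q. E n q f)" for n by (rule vector_field_smooth_near[OF E_vector_field f])
        have "E m p (\<lambda>q. E v q f) = E m p (\<lambda>q. \<Sum>n\<in>N. B v n * E n q f)"
          by (rule arg_cong[where f = "E m p"], rule ext, unfold B_def, rule span)
        also have "\<dots> = (\<Sum>n\<in>N. E m p (\<lambda>q. B v n * E n q f))"
          by (rule tangent_sum[OF E_tangent[OF p] smooth_near_mult[OF smooth_near_const[OF pM] s]])
        also have "\<dots> = (\<Sum>n\<in>N. B v n * E m p (\<lambda>q. E n q f))"
          using tangent_mult[OF E_tangent[OF p] smooth_near_const[OF pM] s] tangent_const[OF E_tangent[OF p]]
          by simp
        finally show ?thesis .
      qed
      then show ?thesis
        using span[of u p "\<lambda>q. E v q f"] by (simp add: B_def sum_distrib_left mult.assoc)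
    qed
    have "E u p (\<lambda>q. E v q f) - E v p (\<lambda>q. E u q f) =
        (\<Sum>m\<in>N. \<Sum>n\<in>N. B u m * B v n * (E m p (\<lambda>q. E n q f) - E n p (\<lambda>q. E m q f)))"
      unfolding EE[of u v] EE[of v u] right_diff_distrib sum_subtractf
      by (subst (2) sum.swap) (simp add: mult.commute)
    also have "\<dots> = 0"
    proof (intro sum.neutral ballI)
      fix m n assume mn: "m \<in> N" "n \<in> N"
      have "E m p (\<lambda>q. E n q f) - E n p (\<lambda>q. E m q f) = lie_bracket M (E m) (E n) p f"
        using f by (simp add: lie_bracket_def)
      then show "B u m * B v n * (E m p (\<lambda>q. E n q f) - E n p (\<lambda>q. E m q f)) = 0"
        using bracket_expand[of m n p f] c0[OF mn] by simp
    qed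
    finally show ?thesis using f by (simp add: lie_bracket_def)
  qed (auto simp: lie_bracket_def E_def)
qed


section \<open>The Levi-Civita connection\<close>

text \<open>The Koszul formula for fields with constant inner products.\<close>

definition \<Gamma> :: "'e \<Rightarrow> 'e \<Rightarrow> 'e \<Rightarrow> real" where
  "\<Gamma> i j k = (c i j k - c j k i + c k i j) / 2"

lemma \<Gamma>_skew: "\<Gamma> i k j = - \<Gamma> i j k"
  unfolding \<Gamma>_def using c_anti[of k i j] c_anti[of j k i] c_anti[of i j k] by (simp add: field_simps)

lemma \<Gamma>_torsion: "\<Gamma> i j k - \<Gamma> j i k = c i j k"
  unfolding \<Gamma>_def using c_anti[of k i j] c_anti[of j k i] c_anti[of i j k] by (simp add: field_simps)

text \<open>The product rule, together with the coefficients \<open>\<Gamma>\<close> on the frame, leaves no other choice.\<close>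

definition conn :: "'a connection" where
  "conn X Y = (\<lambda>p f. \<Sum>k\<in>N. (X p (coord Y k) + (\<Sum>i\<in>N. \<Sum>j\<in>N. coord X i p * coord Y j p * \<Gamma> i j k)) * E k p f)"

lemma vadd_coord:
  assumes "X \<in> vector_fields M" "Y \<in> vector_fields M" "p \<in> carrier G"
  shows "coord (vadd X Y) n p = coord X n p + coord Y n p"
proof -
  have p: "p \<in> topspace (mtop M)" using assms(3) by (simp add: topspace_carrier)
  show ?thesis
    using g_linear[OF vector_field_tangent[OF assms(1) p] vector_field_tangent[OF assms(2) p]
        E_tangent[OF assms(3)], of 1 1 n]
    by (simp add: coord_def vadd_def)
qed

lemma g_vdiff:
  assumes "X p \<in> tangent_space M p" "Y p \<in> tangent_space M p" "v \<in> tangent_space M p"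
  shows "g p (vdiff X Y p) v = g p (X p) v - g p (Y p) v"
  using g_linear[OF assms, of 1 "-1"] by (simp add: vdiff_def)

lemma vscale_coord:
  assumes "X \<in> vector_fields M" "p \<in> carrier G"
  shows "coord (vscale h X) n p = h p * coord X n p"
proof -
  have p: "p \<in> topspace (mtop M)" using assms(2) by (simp add: topspace_carrier)
  show ?thesis
    using g_linear[OF vector_field_tangent[OF assms(1) p] vector_field_tangent[OF assms(1) p]
        E_tangent[OF assms(2)], of "h p" 0 n]
    by (simp add: coord_def vscale_def)
qed

lemma vf_cong:
  assumes X: "X \<in> vector_fields M" and p: "p \<in> carrier G"
    and eq: "\<And>q. q \<in> carrier G \<Longrightarrow> f q = h q"
  shows "X p f = X p h"
  by (rule tangent_cong[OF vector_field_tangent[OF X] openin_topspace])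
    (use p eq in \<open>simp_all add: topspace_carrier\<close>)

lemma conn_vector_field:
  assumes X: "X \<in> vector_fields M" and Y: "Y \<in> vector_fields M"
  shows "conn X Y \<in> vector_fields M"
  unfolding conn_def
proof (rule comb_vector_field)
  fix k
  have "smooth_fun_on M (topspace (mtop M)) (\<lambda>p. coord X i p * coord Y j p * \<Gamma> i j k)" for i j
    by (rule smooth_fun_on_mult[OF smooth_fun_on_mult[OF coord_smooth[OF X] coord_smooth[OF Y]]
          smooth_fun_on_const[OF openin_topspace]])
  then show "smooth_fun_on M (topspace (mtop M))
      (\<lambda>p. X p (coord Y k) + (\<Sum>i\<in>N. \<Sum>j\<in>N. coord X i p * coord Y j p * \<Gamma> i j k))"
    by (rule smooth_fun_on_add[OF vector_field_smooth[OF X coord_smooth[OF Y]]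
          smooth_fun_on_sum[OF openin_topspace smooth_fun_on_sum[OF openin_topspace]]])
qed

lemma conn_coord:
  assumes "p \<in> carrier G" "k \<in> N"
  shows "coord (conn X Y) k p = X p (coord Y k) + (\<Sum>i\<in>N. \<Sum>j\<in>N. coord X i p * coord Y j p * \<Gamma> i j k)"
  unfolding conn_def by (rule coord_comb[OF assms])

lemma conn_add1:
  assumes X: "X \<in> vector_fields M" and Y: "Y \<in> vector_fields M"
  shows "conn (vadd X Y) Z = vadd (conn X Z) (conn Y Z)"
proof (intro ext)
  fix p f
  show "conn (vadd X Y) Z p f = vadd (conn X Z) (conn Y Z) p f"
  proof (cases "p \<in> carrier G")
    case True
    have "vadd X Y p h = X p h + Y p h" for h by (simp add: vadd_def)
    then show ?thesis
      unfolding conn_def vadd_def[of "\<lambda>p f. sum _ _"] vadd_coord[OF X Y True]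
      by (simp add: vadd_def distrib_right sum.distrib)
  qed (simp add: conn_def vadd_def E_def)
qed

lemma conn_add2:
  assumes X: "X \<in> vector_fields M" and Y: "Y \<in> vector_fields M" and Z: "Z \<in> vector_fields M"
  shows "conn X (vadd Y Z) = vadd (conn X Y) (conn X Z)"
proof (intro ext)
  fix p f
  show "conn X (vadd Y Z) p f = vadd (conn X Y) (conn X Z) p f"
  proof (cases "p \<in> carrier G")
    case True
    have d: "X p (coord (vadd Y Z) k) = X p (coord Y k) + X p (coord Z k)" for k
    proof -
      have "X p (coord (vadd Y Z) k) = X p (\<lambda>q. coord Y k q + coord Z k q)"
        by (rule vf_cong[OF X True vadd_coord[OF Y Z]])
      also have "\<dots> = X p (coord Y k) + X p (coord Z k)"
        by (rule tangent_add[OF vector_field_tangent[OF X] coord_smooth_near[OF Y True] coord_smooth_near[OF Z True]])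
          (simp add: topspace_carrier True)
      finally show ?thesis .
    qed
    show ?thesis
      unfolding conn_def vadd_coord[OF Y Z True] d
      by (simp add: vadd_def distrib_right distrib_left sum.distrib add_ac)
  qed (simp add: conn_def vadd_def E_def)
qed

lemma conn_scale1:
  assumes X: "X \<in> vector_fields M"
  shows "conn (vscale h X) Y = vscale h (conn X Y)"
proof (intro ext)
  fix p f
  show "conn (vscale h X) Y p f = vscale h (conn X Y) p f"
  proof (cases "p \<in> carrier G")
    case True
    then show ?thesis
      unfolding conn_def vscale_coord[OF X True]
      by (simp add: vscale_def sum_distrib_left algebra_simps)
  qed (simp add: conn_def vscale_def E_def)
qed

lemma conn_scale2:
  assumes h: "smooth_fun_on M (topspace (mtop M)) h" and X: "X \<in> vector_fields M" and Y: "Y \<in> vector_fields M"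
  shows "conn X (vscale h Y) = vadd (vscale (\<lambda>p. X p h) Y) (vscale h (conn X Y))"
proof (intro ext)
  fix p f
  show "conn X (vscale h Y) p f = vadd (vscale (\<lambda>p. X p h) Y) (vscale h (conn X Y)) p f"
  proof (cases "p \<in> carrier G")
    case True
    have hp: "smooth_near M p h" unfolding smooth_near_def using h True topspace_carrier by blast
    have d: "X p (coord (vscale h Y) k) = X p h * coord Y k p + h p * X p (coord Y k)" for k
    proof -
      have "X p (coord (vscale h Y) k) = X p (\<lambda>q. h q * coord Y k q)"
        by (rule vf_cong[OF X True vscale_coord[OF Y]])
      also have "\<dots> = X p h * coord Y k p + h p * X p (coord Y k)"
        by (rule tangent_mult[OF vector_field_tangent[OF X] hp coord_smooth_near[OF Y True]])
          (simp add: topspace_carrier True)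
      finally show ?thesis .
    qed
    have "conn X (vscale h Y) p f = (\<Sum>k\<in>N. X p h * (coord Y k p * E k p f) +
        h p * ((X p (coord Y k) + (\<Sum>i\<in>N. \<Sum>j\<in>N. coord X i p * coord Y j p * \<Gamma> i j k)) * E k p f))"
      unfolding conn_def d vscale_coord[OF Y True]
      by (rule sum.cong[OF refl]) (simp add: sum_distrib_left algebra_simps)
    also have "\<dots> = X p h * Y p f + h p * conn X Y p f"
      unfolding conn_def vector_field_expand[OF Y, of p f] by (simp add: sum.distrib sum_distrib_left)
    finally show ?thesis by (simp add: vadd_def vscale_def)
  qed (simp add: conn_def vscale_def vadd_def E_def vector_field_outside[OF Y] topspace_carrier)
qed

lemma second_derivative_expand:
  assumes X: "X \<in> vector_fields M" and Y: "Y \<in> vector_fields M" and p: "p \<in> carrier G" and f: "smooth_near M p f"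
  shows "X p (\<lambda>q. Y q f) = (\<Sum>k\<in>N. X p (coord Y k) * E k p f) +
    (\<Sum>i\<in>N. \<Sum>j\<in>N. coord X i p * coord Y j p * E i p (\<lambda>q. E j q f))"
proof -
  have XT: "X p \<in> tangent_space M p" by (rule vector_field_tangent[OF X]) (simp add: topspace_carrier p)
  have s: "smooth_near M p (\<lambda>q. E k q f)" for k by (rule vector_field_smooth_near[OF E_vector_field f])
  have "X p (\<lambda>q. Y q f) = X p (\<lambda>q. \<Sum>k\<in>N. coord Y k q * E k q f)"
    by (rule arg_cong[where f = "X p"], rule ext, rule vector_field_expand[OF Y])
  also have "\<dots> = (\<Sum>k\<in>N. X p (\<lambda>q. coord Y k q * E k q f))"
    by (rule tangent_sum[OF XT smooth_near_mult[OF coord_smooth_near[OF Y p] s]])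
  also have "\<dots> = (\<Sum>k\<in>N. X p (coord Y k) * E k p f + coord Y k p * X p (\<lambda>q. E k q f))"
    by (rule sum.cong[OF refl]) (rule tangent_mult[OF XT coord_smooth_near[OF Y p] s])
  also have "\<dots> = (\<Sum>k\<in>N. X p (coord Y k) * E k p f) +
      (\<Sum>k\<in>N. \<Sum>i\<in>N. coord X i p * coord Y k p * E i p (\<lambda>q. E k q f))"
    unfolding vector_field_expand[OF X, of p "\<lambda>q. E _ q f"]
    by (simp add: sum.distrib sum_distrib_left mult_ac)
  also have "(\<Sum>k\<in>N. \<Sum>i\<in>N. coord X i p * coord Y k p * E i p (\<lambda>q. E k q f)) =
      (\<Sum>i\<in>N. \<Sum>k\<in>N. coord X i p * coord Y k p * E i p (\<lambda>q. E k q f))" by (rule sum.swap)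
  finally show ?thesis .
qed

text \<open>The derivatives of the coefficients are the same on both sides by \<open>second_derivative_expand\<close>.  What
  is left is the identity \<open>\<Gamma>_torsion\<close> in the frame.\<close>

lemma conn_torsion:
  assumes X: "X \<in> vector_fields M" and Y: "Y \<in> vector_fields M"
  shows "vdiff (conn X Y) (conn Y X) = lie_bracket M X Y"
proof (intro ext)
  fix p f
  show "vdiff (conn X Y) (conn Y X) p f = lie_bracket M X Y p f"
  proof (cases "p \<in> carrier G \<and> smooth_near M p f")
    case True
    then have p: "p \<in> carrier G" and f: "smooth_near M p f" by auto
    let ?x = "\<lambda>i. coord X i p" and ?y = "\<lambda>i. coord Y i p" and ?e = "\<lambda>k. E k p f"
    let ?e2 = "\<lambda>i j. E i p (\<lambda>q. E j q f)"
    have "vdiff (conn X Y) (conn Y X) p f = (\<Sum>k\<in>N. X p (coord Y k) * ?e k) - (\<Sum>k\<in>N. Y p (coord X k) * ?e k) +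
        (\<Sum>k\<in>N. ((\<Sum>i\<in>N. \<Sum>j\<in>N. ?x i * ?y j * \<Gamma> i j k) - (\<Sum>i\<in>N. \<Sum>j\<in>N. ?y i * ?x j * \<Gamma> i j k)) * ?e k)"
      unfolding vdiff_def conn_def
      by (simp add: distrib_right left_diff_distrib sum.distrib sum_subtractf)
    also have "(\<Sum>k\<in>N. ((\<Sum>i\<in>N. \<Sum>j\<in>N. ?x i * ?y j * \<Gamma> i j k) - (\<Sum>i\<in>N. \<Sum>j\<in>N. ?y i * ?x j * \<Gamma> i j k)) * ?e k) =
        (\<Sum>i\<in>N. \<Sum>j\<in>N. ?x i * ?y j * (?e2 i j - ?e2 j i))"
      unfolding torsion_sum \<Gamma>_torsion bracket_expand[symmetric] using f by (simp add: lie_bracket_def)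
    also have "\<dots> = (\<Sum>i\<in>N. \<Sum>j\<in>N. ?x i * ?y j * ?e2 i j) - (\<Sum>i\<in>N. \<Sum>j\<in>N. ?y i * ?x j * ?e2 i j)"
      unfolding right_diff_distrib sum_subtractf by (subst (4) sum.swap) (simp add: mult.commute)
    finally show ?thesis
      using f second_derivative_expand[OF X Y p f] second_derivative_expand[OF Y X p f]
      by (simp add: lie_bracket_def)
  next
    case False
    have "E k p f = 0" for k
      using False tangent_nonsmooth[OF E_tangent] by (cases "p \<in> carrier G") (auto simp: E_def)
    moreover have "lie_bracket M X Y p f = 0"
      using False vector_field_outside[OF X, of p] vector_field_outside[OF Y, of p]
      by (auto simp: lie_bracket_def topspace_carrier)
    ultimately show ?thesis by (simp add: vdiff_def conn_def)
  qed
qed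

lemma conn_metric:
  assumes X: "X \<in> vector_fields M" and Y: "Y \<in> vector_fields M" and Z: "Z \<in> vector_fields M"
    and p: "p \<in> carrier G"
  shows "X p (\<lambda>q. g q (Y q) (Z q)) = g p (conn X Y p) (Z p) + g p (Y p) (conn X Z p)"
proof -
  have pM: "p \<in> topspace (mtop M)" using p by (simp add: topspace_carrier)
  note XT = vector_field_tangent[OF X pM]
  have exp: "g q (V q) (W q) = (\<Sum>k\<in>N. coord V k q * coord W k q)"
    if "V \<in> vector_fields M" "W \<in> vector_fields M" "q \<in> carrier G" for V W q
    unfolding coord_def
    by (rule g_expand) (use that vector_field_tangent topspace_carrier in auto)
  have "X p (\<lambda>q. g q (Y q) (Z q)) = X p (\<lambda>q. \<Sum>k\<in>N. coord Y k q * coord Z k q)"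
    by (rule vf_cong[OF X p exp[OF Y Z]])
  also have "\<dots> = (\<Sum>k\<in>N. X p (\<lambda>q. coord Y k q * coord Z k q))"
    by (rule tangent_sum[OF XT smooth_near_mult[OF coord_smooth_near[OF Y p] coord_smooth_near[OF Z p]]])
  also have "\<dots> = (\<Sum>k\<in>N. X p (coord Y k) * coord Z k p + coord Y k p * X p (coord Z k))"
    by (rule sum.cong[OF refl]) (rule tangent_mult[OF XT coord_smooth_near[OF Y p] coord_smooth_near[OF Z p]])
  finally have L: "X p (\<lambda>q. g q (Y q) (Z q)) =
      (\<Sum>k\<in>N. X p (coord Y k) * coord Z k p) + (\<Sum>k\<in>N. coord Y k p * X p (coord Z k))"
    by (simp add: sum.distrib)
  have 1: "g p (conn X Y p) (Z p) = (\<Sum>k\<in>N. X p (coord Y k) * coord Z k p) +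
      (\<Sum>k\<in>N. (\<Sum>i\<in>N. \<Sum>j\<in>N. coord X i p * coord Y j p * \<Gamma> i j k) * coord Z k p)"
    unfolding exp[OF conn_vector_field[OF X Y] Z p] sum.distrib[symmetric]
    by (rule sum.cong[OF refl]) (simp add: conn_coord[OF p] distrib_right)
  have 2: "g p (Y p) (conn X Z p) = (\<Sum>k\<in>N. coord Y k p * X p (coord Z k)) +
      (\<Sum>k\<in>N. coord Y k p * (\<Sum>i\<in>N. \<Sum>j\<in>N. coord X i p * coord Z j p * \<Gamma> i j k))"
    unfolding exp[OF Y conn_vector_field[OF X Z] p] sum.distrib[symmetric]
    by (rule sum.cong[OF refl]) (simp add: conn_coord[OF p] distrib_left)
  show ?thesis
    unfolding L 1 2 using skew_sum[of \<Gamma> "\<lambda>i. coord X i p" "\<lambda>i. coord Y i p" N "\<lambda>i. coord Z i p", OF \<Gamma>_skew] by linarith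
qed

text \<open>The connection \<open>conn\<close> shows that the choice in \<open>levi_civita\<close> is made from a nonempty set.  The chosen
  connection is used below through its characteristic properties alone.\<close>

lemma levi_civita: "is_levi_civita M g (levi_civita M g)"
proof -
  have "is_levi_civita M g conn"
    unfolding is_levi_civita_def affine_connection_def
    using conn_vector_field conn_add1 conn_add2 conn_scale1 conn_scale2 conn_torsion conn_metric
    by (simp add: topspace_carrier)
  then show ?thesis unfolding levi_civita_def by (rule someI[of "is_levi_civita M g"])
qed


section \<open>Curvature in a left-invariant orthonormal frame\<close>

abbreviation nabla :: "'a connection" where
  "nabla \<equiv> levi_civita M g"

lemma nabla_vector_field: "X \<in> vector_fields M \<Longrightarrow> Y \<in> vector_fields M \<Longrightarrow> nabla X Y \<in> vector_fields M"
  using levi_civita by (simp add: is_levi_civita_def affine_connection_def)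

lemma nabla_add:
  "X \<in> vector_fields M \<Longrightarrow> Y \<in> vector_fields M \<Longrightarrow> Z \<in> vector_fields M \<Longrightarrow>
    nabla (vadd X Y) Z = vadd (nabla X Z) (nabla Y Z)"
  using levi_civita by (simp add: is_levi_civita_def affine_connection_def)

lemma nabla_scale:
  "smooth_fun_on M (topspace (mtop M)) h \<Longrightarrow> X \<in> vector_fields M \<Longrightarrow> Y \<in> vector_fields M \<Longrightarrow>
    nabla (vscale h X) Y = vscale h (nabla X Y)"
  using levi_civita by (simp add: is_levi_civita_def affine_connection_def)

lemma nabla_torsion:
  "X \<in> vector_fields M \<Longrightarrow> Y \<in> vector_fields M \<Longrightarrow> vdiff (nabla X Y) (nabla Y X) = lie_bracket M X Y"
  using levi_civita by (simp add: is_levi_civita_def)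

lemma nabla_metric:
  "X \<in> vector_fields M \<Longrightarrow> Y \<in> vector_fields M \<Longrightarrow> Z \<in> vector_fields M \<Longrightarrow> p \<in> carrier G \<Longrightarrow>
    X p (\<lambda>q. g q (Y q) (Z q)) = g p (nabla X Y p) (Z p) + g p (Y p) (nabla X Z p)"
  using levi_civita by (simp add: is_levi_civita_def topspace_carrier)

lemma nabla_tangent:
  "X \<in> vector_fields M \<Longrightarrow> Y \<in> vector_fields M \<Longrightarrow> p \<in> carrier G \<Longrightarrow> nabla X Y p \<in> tangent_space M p"
  by (rule vector_field_tangent[OF nabla_vector_field]) (simp_all add: topspace_carrier)

lemma nabla_sum:
  assumes A: "finite A" and h: "\<And>n. n \<in> A \<Longrightarrow> smooth_fun_on M (topspace (mtop M)) (h n)"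
    and Y: "Y \<in> vector_fields M"
  shows "nabla (\<lambda>p f. \<Sum>n\<in>A. h n p * E n p f) Y = (\<lambda>p f. \<Sum>n\<in>A. h n p * nabla (E n) Y p f)"
  using A h
proof (induction A)
  case empty
  have "vscale (\<lambda>_. 0) (E 0) = (\<lambda>p f. 0)" by (simp add: vscale_def)
  then show ?case
    using nabla_scale[OF smooth_fun_on_const[OF openin_topspace] E_vector_field Y, of 0 0]
    by (simp add: vscale_def)
next
  case (insert a A)
  have ha: "smooth_fun_on M (topspace (mtop M)) (h a)" using insert.prems by simp
  have 1: "vscale (h a) (E a) \<in> vector_fields M"
    using comb_vector_field[of "{a}" h] ha by (simp add: vscale_def)
  have 2: "(\<lambda>p f. \<Sum>n\<in>A. h n p * E n p f) \<in> vector_fields M"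
    by (rule comb_vector_field) (use insert.prems in simp)
  have "(\<lambda>p f. \<Sum>n\<in>insert a A. h n p * E n p f) =
      vadd (vscale (h a) (E a)) (\<lambda>p f. \<Sum>n\<in>A. h n p * E n p f)"
    using insert.hyps by (simp add: vadd_def vscale_def)
  then have "nabla (\<lambda>p f. \<Sum>n\<in>insert a A. h n p * E n p f) Y =
      vadd (vscale (h a) (nabla (E a) Y)) (\<lambda>p f. \<Sum>n\<in>A. h n p * nabla (E n) Y p f)"
    using nabla_add[OF 1 2 Y] nabla_scale[OF ha E_vector_field Y] insert.IH insert.prems by simp
  then show ?case using insert.hyps by (simp add: vadd_def vscale_def)
qed

lemma g_nabla_expand:
  assumes X: "X \<in> vector_fields M" and Y: "Y \<in> vector_fields M" and p: "p \<in> carrier G"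
    and v: "v \<in> tangent_space M p"
  shows "g p (nabla X Y p) v = (\<Sum>n\<in>N. coord X n p * g p (nabla (E n) Y p) v)"
proof -
  have exp: "X = (\<lambda>p f. \<Sum>n\<in>N. coord X n p * E n p f)" by (intro ext vector_field_expand[OF X])
  have "nabla X Y = nabla (\<lambda>p f. \<Sum>n\<in>N. coord X n p * E n p f) Y"
    by (rule arg_cong[where f = "\<lambda>Z. nabla Z Y", OF exp])
  also have "\<dots> = (\<lambda>p f. \<Sum>n\<in>N. coord X n p * nabla (E n) Y p f)"
    by (rule nabla_sum[OF finN coord_smooth[OF X] Y])
  finally have "g p (nabla X Y p) v = g p (\<lambda>f. \<Sum>n\<in>N. coord X n p * nabla (E n) Y p f) v" by simp
  also have "\<dots> = (\<Sum>n\<in>N. coord X n p * g p (nabla (E n) Y p) v)"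
    by (rule g_sum[OF v nabla_tangent[OF E_vector_field Y p]])
  finally show ?thesis .
qed

text \<open>The uniqueness argument for the Levi-Civita connection, applied to the frame: with derivatives of
  inner products vanishing, metricity and freeness of torsion are linear equations for the
  coefficients.\<close>

lemma nabla_E:
  assumes p: "p \<in> carrier G"
  shows "g p (nabla (E i) (E j) p) (E k p) = \<Gamma> i j k"
proof -
  define a where "a = (\<lambda>i j k. g p (nabla (E i) (E j) p) (E k p))"
  note T = E_tangent[OF p] and NT = nabla_tangent[OF E_vector_field E_vector_field p]
  have skew: "a i j k + a i k j = 0" for i j k
  proof -
    have "E i p (\<lambda>q. g q (E j q) (E k q)) = E i p (\<lambda>q. g \<one> (E j \<one>) (E k \<one>))"
      by (rule vf_cong[OF E_vector_field p g_E])
    also have "\<dots> = 0" by (rule tangent_const[OF T])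
    finally have "0 = g p (nabla (E i) (E j) p) (E k p) + g p (E j p) (nabla (E i) (E k) p)"
      using nabla_metric[OF E_vector_field E_vector_field E_vector_field p] by simp
    also have "g p (E j p) (nabla (E i) (E k) p) = g p (nabla (E i) (E k) p) (E j p)"
      by (rule g_sym[OF T NT])
    finally show ?thesis by (simp add: a_def)
  qed
  have tors: "a i j k - a j i k = c i j k" for i j k
    using g_vdiff[where X = "nabla (E i) (E j)" and Y = "nabla (E j) (E i)", OF NT NT T, of k] bracket_coord[OF p, of i j k]
    unfolding nabla_torsion[OF E_vector_field E_vector_field] by (simp add: a_def)
  have "c i j k - c j k i + c k i j = (a i j k - a i k j) - (a j k i + a j i k) + (a k i j + a k j i)"
    unfolding tors[symmetric] by (simp add: algebra_simps)
  also have "a i k j = - a i j k" using skew[of i j k] by simp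
  finally have "2 * a i j k = c i j k - c j k i + c k i j" unfolding skew by simp
  then show ?thesis by (simp add: a_def \<Gamma>_def)
qed

text \<open>The inner product of the inner derivative with \<open>E l\<close> is constant, so metricity moves the outer
  derivative to \<open>E l\<close> at the cost of a sign.\<close>

lemma nabla_nabla_E:
  assumes p: "p \<in> carrier G"
  shows "g p (nabla (E i) (nabla (E j) (E k)) p) (E l p) = - (\<Sum>n\<in>N. \<Gamma> j k n * \<Gamma> i l n)"
proof -
  note V = E_vector_field
  have "E i p (\<lambda>q. g q (nabla (E j) (E k) q) (E l q)) = E i p (\<lambda>q. \<Gamma> j k l)"
    by (rule vf_cong[OF V p nabla_E])
  also have "\<dots> = 0" by (rule tangent_const[OF E_tangent[OF p]])
  finally have "0 = g p (nabla (E i) (nabla (E j) (E k)) p) (E l p) +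
      g p (nabla (E j) (E k) p) (nabla (E i) (E l) p)"
    using nabla_metric[OF V nabla_vector_field[OF V V] V p] by simp
  then show ?thesis
    using g_expand[OF nabla_tangent[OF V V p] nabla_tangent[OF V V p], of j k i l]
    by (simp add: nabla_E[OF p])
qed

lemma curvature_E:
  "g \<one> (riemann_curvature M g (E i) (E j) (E j) \<one>) (E i \<one>) =
    (\<Sum>k\<in>N. - (\<Gamma> j j k * \<Gamma> i i k) + \<Gamma> i j k * \<Gamma> j i k - c i j k * \<Gamma> k j i)"
proof -
  note V = E_vector_field and T = E_tangent[OF one_closed]
  note NV = nabla_vector_field[OF V V]
  have B: "lie_bracket M (E i) (E j) \<in> vector_fields M" by (rule lie_bracket_vector_field[OF V V])
  have tan: "nabla X Y \<one> \<in> tangent_space M \<one>" if "X \<in> vector_fields M" "Y \<in> vector_fields M" for X Y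
    by (rule nabla_tangent[OF that one_closed])
  let ?R1 = "nabla (E i) (nabla (E j) (E j))" and ?R2 = "nabla (E j) (nabla (E i) (E j))"
    and ?R3 = "nabla (lie_bracket M (E i) (E j)) (E j)"
  have R: "?R1 \<one> \<in> tangent_space M \<one>" "?R2 \<one> \<in> tangent_space M \<one>" "?R3 \<one> \<in> tangent_space M \<one>"
    by (rule tan[OF V NV], rule tan[OF V NV], rule tan[OF B V])
  have "vdiff ?R1 ?R2 \<one> \<in> tangent_space M \<one>"
    using tangent_space_linear[OF R(1,2), of 1 "-1"] by (simp add: vdiff_def)
  then have "g \<one> (riemann_curvature M g (E i) (E j) (E j) \<one>) (E i \<one>) =
      g \<one> (nabla (E i) (nabla (E j) (E j)) \<one>) (E i \<one>) - g \<one> (nabla (E j) (nabla (E i) (E j)) \<one>) (E i \<one>) -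
      g \<one> (nabla (lie_bracket M (E i) (E j)) (E j) \<one>) (E i \<one>)"
    unfolding riemann_curvature_def Let_def
    by (simp add: g_vdiff[where Y = ?R3, OF _ R(3) T] g_vdiff[where X = ?R1 and Y = ?R2, OF R(1,2) T])
  also have "g \<one> (nabla (lie_bracket M (E i) (E j)) (E j) \<one>) (E i \<one>) = (\<Sum>k\<in>N. c i j k * \<Gamma> k j i)"
    unfolding g_nabla_expand[OF B V one_closed T] nabla_E[OF one_closed] coord_def bracket_coord[OF one_closed] ..
  finally show ?thesis
    unfolding nabla_nabla_E[OF one_closed] by (simp add: sum.distrib sum_subtractf sum_negf)
qed

text \<open>Orthonormality makes the denominator of the sectional curvature equal to 1, so flatness says that the
  expression of \<open>curvature_E\<close> vanishes.  The cyclic identity rewrites it in terms of \<open>c\<close>.\<close>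

lemma flat_imp_structure_constants_zero:
  assumes flat: "flat M g" and cyclic: "cyclic G M g" and ijk: "i \<in> N" "j \<in> N" "k \<in> N"
  shows "c i j k = 0"
proof -
  have cyc: "c i j k + c j k i + c k i j = 0" for i j k
    using cyclic E_lie_algebra unfolding cyclic_def lie_inner_def c_def by blast
  have \<Gamma>c: "\<Gamma> i j k = c k j i" for i j k
  proof -
    have "c i j k + c k i j = - c j k i" using cyc[of i j k] by simp
    then show ?thesis using c_anti[of j k i] by (simp add: \<Gamma>_def)
  qed
  have "(\<Sum>k\<in>N. - (c k j j * c k i i) + c k j i * c k i j - c i j k * c i j k) = 0"
    if i: "i \<in> N" and j: "j \<in> N" for i j
  proof (cases "i = j")
    \<comment> \<open>A single vector spans no plane, but the expression vanishes for it identically.\<close>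
    case True
    have "c i i k = 0" for k using c_anti[of i i k] by simp
    then show ?thesis using True by simp
  next
    case False
    note T = E_tangent[OF one_closed]
    have g1: "g \<one> (E i \<one>) (E i \<one>) = 1" "g \<one> (E j \<one>) (E j \<one>) = 1" "g \<one> (E i \<one>) (E j \<one>) = 0"
      "g \<one> (E j \<one>) (E i \<one>) = 0"
      using orth i j False by auto
    have "lin_indep2 (E i \<one>) (E j \<one>)"
      unfolding lin_indep2_def
    proof (intro allI impI)
      fix a b assume z: "(\<lambda>f. a * E i \<one> f + b * E j \<one> f) = (\<lambda>_. 0)"
      have "g \<one> (\<lambda>f. a * E i \<one> f + b * E j \<one> f) (E i \<one>) = a"
        "g \<one> (\<lambda>f. a * E i \<one> f + b * E j \<one> f) (E j \<one>) = b"
        using g_linear[OF T T T] g1 by simp_all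
      then show "a = 0 \<and> b = 0" unfolding z using g_zero[OF T] by simp
    qed
    then have "sectional_curvature M g \<one> (E i) (E j) = 0"
      using flat E_vector_field topspace_carrier one_closed unfolding flat_def by blast
    then show ?thesis
      using curvature_E[of i j] by (simp add: sectional_curvature_def g1 \<Gamma>c)
  qed
  from scalar_curvature_vanishing[OF finN c_anti cyc this ijk] show ?thesis .
qed

text \<open>All coefficients \<open>\<Gamma> i j k\<close> vanish and the frame is parallel.  The component of \<open>\<nabla> X Y\<close> along \<open>E k\<close> is
  therefore the derivative along \<open>X\<close> of the component \<open>h\<close> of \<open>Y\<close>, and the corresponding component of the
  curvature is \<open>X (Y h) - Y (X h) - [X, Y] h = 0\<close>.\<close>

lemma comm_group_imp_flat:
  assumes comm: "comm_group G"
  shows "flat M g"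
proof -
  interpret cg: comm_group G by (rule comm)
  note V = E_vector_field
  have c0: "c i j k = 0" for i j k
  proof -
    have "lie_bracket M (E i) (E j) = (\<lambda>p f. 0)" by (rule abelian_lie_bracket) (rule cg.m_comm)
    then show ?thesis unfolding c_def using g_zero[OF E_tangent[OF one_closed]] by simp
  qed
  then have \<Gamma>0: "\<Gamma> i j k = 0" for i j k by (simp add: \<Gamma>_def)
  have nabla_coord: "coord (nabla X Y) k p = X p (coord Y k)"
    if X: "X \<in> vector_fields M" and Y: "Y \<in> vector_fields M" and p: "p \<in> carrier G" for X Y k p
  proof -
    have "g p (nabla X (E k) p) (E n p) = 0" for n
      unfolding g_nabla_expand[OF X V p E_tangent[OF p]] nabla_E[OF p] \<Gamma>0 by simp
    moreover have "Y p \<in> tangent_space M p"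
      by (rule vector_field_tangent[OF Y]) (simp add: topspace_carrier p)
    ultimately have "g p (Y p) (nabla X (E k) p) = 0"
      using g_expand[OF _ nabla_tangent[OF X V p]] by simp
    then show ?thesis using nabla_metric[OF X Y V p] by (simp add: coord_def[abs_def])
  qed
  have "g p (riemann_curvature M g X Y Y p) (X p) = 0"
    if X: "X \<in> vector_fields M" and Y: "Y \<in> vector_fields M" and p: "p \<in> carrier G" for X Y p
  proof -
    have B: "lie_bracket M X Y \<in> vector_fields M" by (rule lie_bracket_vector_field[OF X Y])
    have pM: "p \<in> topspace (mtop M)" using p by (simp add: topspace_carrier)
    note NV = nabla_vector_field
    have T: "nabla X (nabla Y Y) p \<in> tangent_space M p" "nabla Y (nabla X Y) p \<in> tangent_space M p"
      "nabla (lie_bracket M X Y) Y p \<in> tangent_space M p"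
      by (rule nabla_tangent[OF X NV[OF Y Y] p], rule nabla_tangent[OF Y NV[OF X Y] p],
          rule nabla_tangent[OF B Y p])
    have T2: "vdiff (nabla X (nabla Y Y)) (nabla Y (nabla X Y)) p \<in> tangent_space M p"
      using tangent_space_linear[OF T(1,2), of 1 "-1"] by (simp add: vdiff_def)
    have R: "riemann_curvature M g X Y Y p \<in> tangent_space M p"
      using tangent_space_linear[OF T2 T(3), of 1 "-1"]
      by (simp add: riemann_curvature_def vdiff_def Let_def)
    have "g p (riemann_curvature M g X Y Y p) (E k p) = 0" for k
    proof -
      have "g p (riemann_curvature M g X Y Y p) (E k p) =
          coord (nabla X (nabla Y Y)) k p - coord (nabla Y (nabla X Y)) k p - coord (nabla (lie_bracket M X Y) Y) k p"
        unfolding riemann_curvature_def Let_def coord_def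
        using
          g_vdiff[where X = "vdiff (nabla X (nabla Y Y)) (nabla Y (nabla X Y))" and
            Y = "nabla (lie_bracket M X Y) Y", OF T2 T(3) E_tangent[OF p]]
          g_vdiff[where X = "nabla X (nabla Y Y)" and Y = "nabla Y (nabla X Y)", OF T(1,2) E_tangent[OF p]]
        by simp
      also have "\<dots> = X p (coord (nabla Y Y) k) - Y p (coord (nabla X Y) k) - lie_bracket M X Y p (coord Y k)"
        by (simp add: nabla_coord X Y B NV p)
      also have "X p (coord (nabla Y Y) k) = X p (\<lambda>q. Y q (coord Y k))"
        by (rule vf_cong[OF X p nabla_coord[OF Y Y]])
      also have "Y p (coord (nabla X Y) k) = Y p (\<lambda>q. X q (coord Y k))"
        by (rule vf_cong[OF Y p nabla_coord[OF X Y]])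
      finally show ?thesis using coord_smooth_near[OF Y p, of k] by (simp add: lie_bracket_def)
    qed
    then show ?thesis using g_expand[OF R vector_field_tangent[OF X pM]] by simp
  qed
  then show ?thesis by (simp add: flat_def sectional_curvature_def topspace_carrier)
qed

end


section \<open>Flatness and commutativity\<close>

theorem proposition3p4:
  fixes G :: "'a monoid"
    and M :: "('a, 'e::euclidean_space) manifold_data"
    and g :: "'a metric_tensor"
  assumes "metric_lie_group G M g"
    and "connected_space (mtop M)"
    and "cyclic G M g"
  shows "flat M g \<longleftrightarrow> comm_group G"
proof -
  interpret lie_grp G M by standard (use assms(1) in \<open>simp add: metric_lie_group_def\<close>)
  have 1: "\<one>\<^bsub>G\<^esub> \<in> topspace (mtop M)" by (simp add: topspace_carrier)
  obtain U \<phi> and D :: "'e set" and \<xi> where chart: "(U, \<phi>) \<in> charts M" "\<one>\<^bsub>G\<^esub> \<in> U" "plot M D \<xi>"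
    "\<And>q. q \<in> U \<Longrightarrow> \<phi> q \<in> D \<and> \<xi> (\<phi> q) = q"
    by (rule chart_at[OF 1]) (rule that)
  interpret metric_lie_grp G M U \<phi> D \<xi> "\<phi> \<one>\<^bsub>G\<^esub>" g
    by standard (use chart assms(1) in simp_all)
  obtain N where N: "finite N" "\<forall>m\<in>N. \<forall>n\<in>N. g \<one>\<^bsub>G\<^esub> (E m \<one>\<^bsub>G\<^esub>) (E n \<one>\<^bsub>G\<^esub>) = (if m = n then 1 else 0)"
    "\<forall>w p f. E w p f = (\<Sum>n\<in>N. g \<one>\<^bsub>G\<^esub> (E w \<one>\<^bsub>G\<^esub>) (E n \<one>\<^bsub>G\<^esub>) * E n p f)"
    using orthonormal_frame_exists by blast
  interpret lie_frame G M U \<phi> D \<xi> "\<phi> \<one>\<^bsub>G\<^esub>" g N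
    by standard (rule N(1), rule N(2)[rule_format], assumption, assumption, rule N(3)[rule_format])
  show ?thesis
  proof
    assume "flat M g"
    then have "lie_bracket M (E u) (E v) = (\<lambda>p f. 0)" for u v
      by (intro bracket_zero flat_imp_structure_constants_zero assms(3))
    then show "comm_group G" by (rule connected_abelian[OF _ assms(2)])
  qed (rule comm_group_imp_flat)
qed

end
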